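(* Assume the nonstandard universe is $\kappa$-saturated, where $\kappa$ is an uncountable cardinal. Let $\mathcal H$ be an internal complex Hilbert space, let $\mathcal M\subseteq\mathcal B(\mathcal H)$ be an internal unital $C^*$-algebra, and let $\theta:\mathcal M\to{}^*\mathbb C$ be an $S$-continuous internal weight. Then the weight $\widehat\theta$ on the nonstandard hull $\widehat{\mathcal M}$, defined by $\widehat\theta(\widehat a)={}^\circ\theta(a)$, is $\kappa$-normal.
   Context: Work in a nonstandard universe (in the sense of Robinson's nonstandard analysis). $\kappa$-saturation: every family of fewer than $\kappa$ internal sets with the finite intersection property has nonempty intersection. All $C^*$-algebras are unital. For $r,s\in{}^*\mathbb R$, $r\approx s$ means $|r-s|<1/n$ for all standard $n\ge1$; $r$ is finite ($|r|<\infty$) if $|r|<n$ for some standard $n$; ${}^\circ r$ is the standard part of a finite $r$ (similarly for ${}^*\mathbb C$). For an internal $C^*$-algebra $\mathcal M$, $\mathrm{Fin}(\mathcal M)=\{a\in\mathcal M:\|a\|<\infty\}$; $a\approx b$ means $\|a-b\|\approx0$; $\widehat a=\{x\in\mathcal M:x\approx a\}$; the nonstandard hull is the ordinary $C^*$-algebra $\widehat{\mathcal M}=\{\widehat a:a\in\mathrm{Fin}(\mathcal M)\}$ with operations induced from representatives and $\|\widehat a\|={}^\circ\|a\|$. For any $C^*$-algebra, the subscript $+$ denotes its set of positive elements, and $a\le b$ means $b-a$ is positive. A weight on a $C^*$-algebra $\mathcal N$ is a map $\theta:\mathcal N_+\to[0,\infty]$ that is additive and satisfies $\theta(\lambda a)=\lambda\theta(a)$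 for $\lambda\in[0,\infty)$ (with $0\cdot\infty=0$). If $\theta(1)<\infty$ it takes finite values and extends uniquely to a linear functional $\mathcal N\to\mathbb C$, also denoted $\theta$. An internal weight $\theta:\mathcal M_+\to{}^*[0,\infty]$ is the transferred notion; it is $S$-continuous if $\theta(\epsilon)\approx0$ for every $\epsilon\in\mathcal M_+$ with $\epsilon\approx0$. This is equivalent to $\theta(1)$ being finite, so such a $\theta$ is regarded as an internal linear functional $\mathcal M\to{}^*\mathbb C$; moreover $a\approx b$ in $\mathrm{Fin}(\mathcal M)$ implies $\theta(a)\approx\theta(b)$, so $\widehat\theta$ is well defined and its restriction to $\widehat{\mathcal M}_+$ is a weight. A weight $\theta$ on $\mathcal N$ is $\kappa$-normal if for every uniformly norm-bounded (upward) directed $\mathcal F\subset\mathcal N_+$ with $|\mathcal F|<\kappa$ whose supremum $\sup\mathcal F$ exists in $\mathcal N_+$, one has $\theta(\sup\mathcal F)=\sup_{a\in\mathcal F}\theta(a)$. *)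

theory Defs
  imports
    "HOL-Analysis.Abstract_Metric_Spaces"
    "HOL-Library.Extended_Nonnegative_Real"
    "HOL-Algebra.Module"
begin

unbundle cardinal_syntax


section \<open>Superstructures\<close>

text \<open>
  A superstructure \<open>V(X)\<close> over a set \<open>X\<close> of individuals is the union of \<open>V\<^sub>0(X) = X\<close> and
  \<open>V\<^sub>n\<^sub>+\<^sub>1(X) = V\<^sub>n(X) \<union> Pow(V\<^sub>n(X))\<close>.  It is rendered as a type whose elements are all the members of
  \<open>V(X)\<close>, with its membership relation; full closure under subsets of each level makes it
  isomorphic to the set-theoretic superstructure over the individuals.
\<close>

record 'u sstr =
  indiv :: "'u set"
  mem :: "'u \<Rightarrow> 'u \<Rightarrow> bool"

definition elts :: "'u sstr \<Rightarrow> 'u \<Rightarrow> 'u set" where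
  "elts V s = {x. mem V x s}"

primrec level :: "'u sstr \<Rightarrow> nat \<Rightarrow> 'u set" where
  "level V 0 = indiv V"
| "level V (Suc n) = level V n \<union> {s. s \<notin> indiv V \<and> elts V s \<subseteq> level V n}"

definition superstructure :: "'u sstr \<Rightarrow> bool" where
  "superstructure V \<longleftrightarrow>
     (\<forall>x\<in>indiv V. elts V x = {}) \<and>
     (\<forall>s t. s \<notin> indiv V \<longrightarrow> t \<notin> indiv V \<longrightarrow> elts V s = elts V t \<longrightarrow> s = t) \<and>
     (\<forall>n A. A \<subseteq> level V n \<longrightarrow> (\<exists>s. s \<notin> indiv V \<and> elts V s = A)) \<and>
     (\<Union>n. level V n) = UNIV"

definition mkset :: "'u sstr \<Rightarrow> 'u set \<Rightarrow> 'u" where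
  "mkset V A = (THE s. s \<notin> indiv V \<and> elts V s = A)"

definition opair :: "'u sstr \<Rightarrow> 'u \<Rightarrow> 'u \<Rightarrow> 'u" where
  "opair V x y = mkset V {mkset V {x}, mkset V {x, y}}"

definition cart :: "'u sstr \<Rightarrow> 'u set \<Rightarrow> 'u set \<Rightarrow> 'u set" where
  "cart V A B = {opair V x y | x y. x \<in> A \<and> y \<in> B}"

text \<open>Functions inside a superstructure are identified with their graphs.\<close>

definition func :: "'u sstr \<Rightarrow> 'u \<Rightarrow> 'u set \<Rightarrow> 'u set \<Rightarrow> bool" where
  "func V f A B \<longleftrightarrow> f \<notin> indiv V \<and> elts V f \<subseteq> cart V A B \<and>
     (\<forall>x\<in>A. \<exists>!y. opair V x y \<in> elts V f)"

definition app :: "'u sstr \<Rightarrow> 'u \<Rightarrow> 'u \<Rightarrow> 'u" where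
  "app V f x = (THE y. opair V x y \<in> elts V f)"

definition app2 :: "'u sstr \<Rightarrow> 'u \<Rightarrow> 'u \<Rightarrow> 'u \<Rightarrow> 'u" where
  "app2 V f x y = app V f (opair V x y)"


section \<open>Nonstandard universes\<close>

text \<open>Formulas of the language of set theory with bounded quantifiers only; variables are natural
  numbers, and \<open>BEx i j \<phi>\<close> stands for \<open>\<exists>v\<^sub>i \<in> v\<^sub>j. \<phi>\<close>.\<close>

datatype fm = Eq nat nat | Mem nat nat | Neg fm | Conj fm fm | BEx nat nat fm

primrec sat :: "'u sstr \<Rightarrow> fm \<Rightarrow> (nat \<Rightarrow> 'u) \<Rightarrow> bool" where
  "sat V (Eq i j) e \<longleftrightarrow> e i = e j"
| "sat V (Mem i j) e \<longleftrightarrow> mem V (e i) (e j)"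
| "sat V (Neg p) e \<longleftrightarrow> \<not> sat V p e"
| "sat V (Conj p q) e \<longleftrightarrow> sat V p e \<and> sat V q e"
| "sat V (BEx i j p) e \<longleftrightarrow> (\<exists>x\<in>elts V (e j). sat V p (e(i := x)))"

text \<open>
  \<open>std N\<close> and \<open>nst N\<close> are the two superstructures and \<open>star N\<close> is the embedding of the first into the
  second.  \<open>cnum N\<close> records which objects of \<open>std N\<close> serve as the complex numbers; they may be
  individuals or sets of any fixed level.  The reals are the complex numbers with zero imaginary
  part.
\<close>

record ('u, 'v) nonstd =
  std :: "'u sstr"
  nst :: "'v sstr"
  star :: "'u \<Rightarrow> 'v"
  cnum :: "complex \<Rightarrow> 'u"

definition nonstandard_universe :: "('u, 'v) nonstd \<Rightarrow> bool" where
  "nonstandard_universe N \<longleftrightarrow>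
     superstructure (std N) \<and> superstructure (nst N) \<and>
     inj (cnum N) \<and> (\<exists>n. range (cnum N) \<subseteq> level (std N) n) \<and>
     star N (mkset (std N) (indiv (std N))) = mkset (nst N) (indiv (nst N)) \<and>
     (\<forall>p e. sat (nst N) p (star N \<circ> e) \<longleftrightarrow> sat (std N) p e)"

definition internal :: "('u, 'v) nonstd \<Rightarrow> 'v \<Rightarrow> bool" where
  "internal N x \<longleftrightarrow> (\<exists>K. K \<notin> indiv (std N) \<and> x \<in> elts (nst N) (star N K))"

definition saturated :: "('u, 'v) nonstd \<Rightarrow> 'k rel \<Rightarrow> bool" where
  "saturated N \<kappa> \<longleftrightarrow>
     (\<forall>S. (\<forall>s\<in>S. internal N s \<and> s \<notin> indiv (nst N)) \<longrightarrow> |S| <o \<kappa> \<longrightarrow>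
          (\<forall>T\<subseteq>S. finite T \<longrightarrow> (\<exists>x. \<forall>t\<in>T. x \<in> elts (nst N) t)) \<longrightarrow>
          (\<exists>x. \<forall>s\<in>S. x \<in> elts (nst N) s))"

text \<open>
  \<open>internal_inst N P x\<close> says that \<open>x\<close> is an ``internal \<open>P\<close>'': it lies in \<open>*K\<close> for some set \<open>K\<close> of the
  standard superstructure all of whose members satisfy \<open>P\<close>.  Since \<open>{k \<in> V\<^sub>n(X). P k}\<close> is such a set
  for each \<open>n\<close>, this is the notion obtained by transfer of \<open>P\<close>.
\<close>

definition internal_inst :: "('u, 'v) nonstd \<Rightarrow> ('u \<Rightarrow> bool) \<Rightarrow> 'v \<Rightarrow> bool" where
  "internal_inst N P x \<longleftrightarrow>
     (\<exists>K. K \<notin> indiv (std N) \<and> (\<forall>k\<in>elts (std N) K. P k) \<and> x \<in> elts (nst N) (star N K))"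


section \<open>Hyperreal and hypercomplex numbers\<close>

definition scx :: "('u, 'v) nonstd \<Rightarrow> complex \<Rightarrow> 'v" where
  "scx N c = star N (cnum N c)"

definition star_pred :: "('u, 'v) nonstd \<Rightarrow> (complex \<Rightarrow> bool) \<Rightarrow> 'v \<Rightarrow> bool" where
  "star_pred N P x \<longleftrightarrow> x \<in> elts (nst N) (star N (mkset (std N) {cnum N a | a. P a}))"

definition star_rel :: "('u, 'v) nonstd \<Rightarrow> (complex \<Rightarrow> complex \<Rightarrow> bool) \<Rightarrow> 'v \<Rightarrow> 'v \<Rightarrow> bool" where
  "star_rel N R x y \<longleftrightarrow>
     opair (nst N) x y \<in>
       elts (nst N) (star N (mkset (std N) {opair (std N) (cnum N a) (cnum N b) | a b. R a b}))"

definition near :: "('u, 'v) nonstd \<Rightarrow> 'v \<Rightarrow> 'v \<Rightarrow> bool" where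
  "near N x y \<longleftrightarrow> (\<forall>n\<ge>1::nat. star_rel N (\<lambda>a b. cmod (a - b) < 1 / real n) x y)"

definition limited :: "('u, 'v) nonstd \<Rightarrow> 'v \<Rightarrow> bool" where
  "limited N x \<longleftrightarrow> (\<exists>n::nat. star_pred N (\<lambda>a. cmod a < real n) x)"

definition stdpart :: "('u, 'v) nonstd \<Rightarrow> 'v \<Rightarrow> complex" where
  "stdpart N x = (THE c. near N x (scx N c))"


section \<open>Hilbert spaces and \<open>C\<^sup>*\<close>-algebras of operators\<close>

definition complex_ring :: "complex ring" where
  "complex_ring = \<lparr>carrier = UNIV, monoid.mult = (*), one = 1, zero = 0, add = (+)\<rparr>"

text \<open>The multiplicative fields of the underlying record play no role for inner product spaces.\<close>

record 'h ip_space = "(complex, 'h) module" +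
  ip :: "'h \<Rightarrow> 'h \<Rightarrow> complex"

definition hnorm :: "('h, 'm) ip_space_scheme \<Rightarrow> 'h \<Rightarrow> real" where
  "hnorm H x = sqrt (Re (ip H x x))"

definition complex_hilbert_space :: "('h, 'm) ip_space_scheme \<Rightarrow> bool" where
  "complex_hilbert_space H \<longleftrightarrow>
     Module.module complex_ring H \<and>
     (\<forall>x\<in>carrier H. \<forall>y\<in>carrier H. \<forall>z\<in>carrier H. ip H (x \<oplus>\<^bsub>H\<^esub> y) z = ip H x z + ip H y z) \<and>
     (\<forall>c. \<forall>x\<in>carrier H. \<forall>y\<in>carrier H. ip H (c \<odot>\<^bsub>H\<^esub> x) y = c * ip H x y) \<and>
     (\<forall>x\<in>carrier H. \<forall>y\<in>carrier H. ip H y x = cnj (ip H x y)) \<and>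
     (\<forall>x\<in>carrier H. 0 \<le> Re (ip H x x)) \<and>
     (\<forall>x\<in>carrier H. ip H x x = 0 \<longrightarrow> x = \<zero>\<^bsub>H\<^esub>) \<and>
     Metric_space.mcomplete (carrier H) (\<lambda>x y. hnorm H (x \<ominus>\<^bsub>H\<^esub> y))"

definition bounded_operator :: "('h, 'm) ip_space_scheme \<Rightarrow> ('h \<Rightarrow> 'h) \<Rightarrow> bool" where
  "bounded_operator H T \<longleftrightarrow>
     (\<forall>x\<in>carrier H. T x \<in> carrier H) \<and>
     (\<forall>x\<in>carrier H. \<forall>y\<in>carrier H. T (x \<oplus>\<^bsub>H\<^esub> y) = T x \<oplus>\<^bsub>H\<^esub> T y) \<and>
     (\<forall>c. \<forall>x\<in>carrier H. T (c \<odot>\<^bsub>H\<^esub> x) = c \<odot>\<^bsub>H\<^esub> T x) \<and>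
     (\<exists>B. \<forall>x\<in>carrier H. hnorm H (T x) \<le> B * hnorm H x)"

definition opnorm :: "('h, 'm) ip_space_scheme \<Rightarrow> ('h \<Rightarrow> 'h) \<Rightarrow> real" where
  "opnorm H T = Sup {hnorm H (T x) | x. x \<in> carrier H \<and> hnorm H x \<le> 1}"

text \<open>The data of a unital \<open>C\<^sup>*\<close>-algebra: ring operations, complex scalars, involution and norm.\<close>

record 'a cstar = "(complex, 'a) module" +
  adj :: "'a \<Rightarrow> 'a"
  nrm :: "'a \<Rightarrow> real"

text \<open>
  \<open>A\<close> is a unital \<open>C\<^sup>*\<close>-subalgebra of \<open>B(H)\<close>, where \<open>BH\<close> is the set of all objects representing
  bounded operators on \<open>H\<close> and \<open>ev T\<close> is the operator represented by \<open>T\<close>.  The unit of \<open>A\<close> is not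
  required to be the identity operator.
\<close>

definition operator_cstar_algebra ::
    "('h, 'm) ip_space_scheme \<Rightarrow> 'a set \<Rightarrow> ('a \<Rightarrow> 'h \<Rightarrow> 'h) \<Rightarrow> ('a, 'n) cstar_scheme \<Rightarrow> bool" where
  "operator_cstar_algebra H BH ev A \<longleftrightarrow>
     carrier A \<subseteq> BH \<and>
     \<zero>\<^bsub>A\<^esub> \<in> carrier A \<and> (\<forall>x\<in>carrier H. ev \<zero>\<^bsub>A\<^esub> x = \<zero>\<^bsub>H\<^esub>) \<and>
     \<one>\<^bsub>A\<^esub> \<in> carrier A \<and> (\<forall>a\<in>carrier A. \<one>\<^bsub>A\<^esub> \<otimes>\<^bsub>A\<^esub> a = a \<and> a \<otimes>\<^bsub>A\<^esub> \<one>\<^bsub>A\<^esub> = a) \<and>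
     (\<forall>a\<in>carrier A. \<forall>b\<in>carrier A. a \<oplus>\<^bsub>A\<^esub> b \<in> carrier A \<and>
        (\<forall>x\<in>carrier H. ev (a \<oplus>\<^bsub>A\<^esub> b) x = ev a x \<oplus>\<^bsub>H\<^esub> ev b x)) \<and>
     (\<forall>c. \<forall>a\<in>carrier A. c \<odot>\<^bsub>A\<^esub> a \<in> carrier A \<and>
        (\<forall>x\<in>carrier H. ev (c \<odot>\<^bsub>A\<^esub> a) x = c \<odot>\<^bsub>H\<^esub> ev a x)) \<and>
     (\<forall>a\<in>carrier A. \<forall>b\<in>carrier A. a \<otimes>\<^bsub>A\<^esub> b \<in> carrier A \<and>
        (\<forall>x\<in>carrier H. ev (a \<otimes>\<^bsub>A\<^esub> b) x = ev a (ev b x))) \<and>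
     (\<forall>a\<in>carrier A. adj A a \<in> carrier A \<and>
        (\<forall>x\<in>carrier H. \<forall>y\<in>carrier H. ip H (ev a x) y = ip H x (ev (adj A a) y))) \<and>
     (\<forall>a\<in>carrier A. nrm A a = opnorm H (ev a)) \<and>
     (\<forall>T\<in>BH. (\<forall>\<epsilon>>0. \<exists>a\<in>carrier A. opnorm H (\<lambda>x. ev T x \<ominus>\<^bsub>H\<^esub> ev a x) < \<epsilon>) \<longrightarrow> T \<in> carrier A)"


section \<open>Positive elements and weights\<close>

definition cpos :: "('a, 'm) cstar_scheme \<Rightarrow> 'a set" where
  "cpos A = {adj A b \<otimes>\<^bsub>A\<^esub> b | b. b \<in> carrier A}"

definition cle :: "('a, 'm) cstar_scheme \<Rightarrow> 'a \<Rightarrow> 'a \<Rightarrow> bool" where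
  "cle A a b \<longleftrightarrow> b \<ominus>\<^bsub>A\<^esub> a \<in> cpos A"

definition weight :: "('a, 'm) cstar_scheme \<Rightarrow> ('a \<Rightarrow> ennreal) \<Rightarrow> bool" where
  "weight A w \<longleftrightarrow>
     (\<forall>a\<in>cpos A. \<forall>b\<in>cpos A. w (a \<oplus>\<^bsub>A\<^esub> b) = w a + w b) \<and>
     (\<forall>t\<ge>0. \<forall>a\<in>cpos A. w (complex_of_real t \<odot>\<^bsub>A\<^esub> a) = ennreal t * w a)"

text \<open>\<open>f\<close> is the linear extension to the whole algebra of the weight \<open>w\<close> with \<open>w 1 < \<infinity>\<close>.\<close>

definition weight_extension ::
    "('a, 'm) cstar_scheme \<Rightarrow> ('a \<Rightarrow> ennreal) \<Rightarrow> ('a \<Rightarrow> complex) \<Rightarrow> bool" where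
  "weight_extension A w f \<longleftrightarrow>
     weight A w \<and> w \<one>\<^bsub>A\<^esub> < \<infinity> \<and>
     (\<forall>a\<in>cpos A. w a < \<infinity> \<and> f a = complex_of_real (enn2real (w a))) \<and>
     (\<forall>a\<in>carrier A. \<forall>b\<in>carrier A. f (a \<oplus>\<^bsub>A\<^esub> b) = f a + f b) \<and>
     (\<forall>c. \<forall>a\<in>carrier A. f (c \<odot>\<^bsub>A\<^esub> a) = c * f a)"

definition directed_up :: "('a, 'm) cstar_scheme \<Rightarrow> 'a set \<Rightarrow> bool" where
  "directed_up A F \<longleftrightarrow> F \<noteq> {} \<and> (\<forall>a\<in>F. \<forall>b\<in>F. \<exists>c\<in>F. cle A a c \<and> cle A b c)"

definition is_sup :: "('a, 'm) cstar_scheme \<Rightarrow> 'a set \<Rightarrow> 'a \<Rightarrow> bool" where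
  "is_sup A F s \<longleftrightarrow> s \<in> cpos A \<and> (\<forall>a\<in>F. cle A a s) \<and>
     (\<forall>u\<in>cpos A. (\<forall>a\<in>F. cle A a u) \<longrightarrow> cle A s u)"

definition kappa_normal :: "'k rel \<Rightarrow> ('a, 'm) cstar_scheme \<Rightarrow> ('a \<Rightarrow> ennreal) \<Rightarrow> bool" where
  "kappa_normal \<kappa> A w \<longleftrightarrow>
     (\<forall>F s. F \<subseteq> cpos A \<longrightarrow> directed_up A F \<longrightarrow> (\<exists>C. \<forall>a\<in>F. nrm A a \<le> C) \<longrightarrow> |F| <o \<kappa> \<longrightarrow>
            is_sup A F s \<longrightarrow> w s = (SUP a\<in>F. w a))"


section \<open>Internal Hilbert spaces, \<open>C\<^sup>*\<close>-algebras and weights\<close>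

text \<open>
  A Hilbert space and an algebra, as objects of a superstructure: tuples consisting of a carrier
  set, distinguished elements and graphs of the operations.  The same tuples are used on the
  standard and on the nonstandard side.
\<close>

record 'u hcode =
  hcar :: 'u
  hadd :: 'u
  hzero :: 'u
  hscale :: 'u
  hip :: 'u

record 'u acode =
  acar :: 'u
  aadd :: 'u
  azero :: 'u
  aone :: 'u
  ascale :: 'u
  amult :: 'u
  aadj :: 'u
  anorm :: 'u

definition htuple :: "'u sstr \<Rightarrow> 'u hcode \<Rightarrow> 'u" where
  "htuple V h = opair V (hcar h) (opair V (hadd h) (opair V (hzero h) (opair V (hscale h) (hip h))))"

definition atuple :: "'u sstr \<Rightarrow> 'u acode \<Rightarrow> 'u" where
  "atuple V a =
     opair V (acar a) (opair V (aadd a) (opair V (azero a) (opair V (aone a)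
       (opair V (ascale a) (opair V (amult a) (opair V (aadj a) (anorm a)))))))"

definition cval :: "('u, 'v) nonstd \<Rightarrow> 'u \<Rightarrow> complex" where
  "cval N z = the_inv (cnum N) z"

definition hspace :: "('u, 'v) nonstd \<Rightarrow> 'u hcode \<Rightarrow> 'u ip_space" where
  "hspace N h =
     \<lparr>carrier = elts (std N) (hcar h),
      monoid.mult = undefined, one = undefined,
      zero = hzero h,
      add = app2 (std N) (hadd h),
      smult = (\<lambda>c. app2 (std N) (hscale h) (cnum N c)),
      ip = (\<lambda>x y. cval N (app2 (std N) (hip h) x y))\<rparr>"

definition standard_hilbert :: "('u, 'v) nonstd \<Rightarrow> 'u hcode \<Rightarrow> bool" where
  "standard_hilbert N h \<longleftrightarrow>
     (let V = std N; E = elts V (hcar h); C = range (cnum N) in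
        hcar h \<notin> indiv V \<and>
        func V (hadd h) (cart V E E) E \<and>
        func V (hscale h) (cart V C E) E \<and>
        func V (hip h) (cart V E E) C \<and>
        complex_hilbert_space (hspace N h))"

definition calg :: "('u, 'v) nonstd \<Rightarrow> 'u acode \<Rightarrow> 'u cstar" where
  "calg N a =
     \<lparr>carrier = elts (std N) (acar a),
      monoid.mult = app2 (std N) (amult a), one = aone a,
      zero = azero a,
      add = app2 (std N) (aadd a),
      smult = (\<lambda>c. app2 (std N) (ascale a) (cnum N c)),
      adj = app (std N) (aadj a),
      nrm = (\<lambda>x. Re (cval N (app (std N) (anorm a) x)))\<rparr>"

definition bounded_operators :: "('u, 'v) nonstd \<Rightarrow> 'u hcode \<Rightarrow> 'u set" where
  "bounded_operators N h =
     {T. func (std N) T (elts (std N) (hcar h)) (elts (std N) (hcar h)) \<and>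
         bounded_operator (hspace N h) (app (std N) T)}"

definition standard_cstar :: "('u, 'v) nonstd \<Rightarrow> 'u hcode \<Rightarrow> 'u acode \<Rightarrow> bool" where
  "standard_cstar N h a \<longleftrightarrow>
     (let V = std N; M = elts V (acar a); C = range (cnum N) in
        standard_hilbert N h \<and>
        acar a \<notin> indiv V \<and>
        func V (aadd a) (cart V M M) M \<and>
        func V (ascale a) (cart V C M) M \<and>
        func V (amult a) (cart V M M) M \<and>
        func V (aadj a) M M \<and>
        func V (anorm a) M {cnum N (complex_of_real r) | r. True} \<and>
        operator_cstar_algebra (hspace N h) (bounded_operators N h) (app V) (calg N a))"

definition standard_weight :: "('u, 'v) nonstd \<Rightarrow> 'u acode \<Rightarrow> 'u \<Rightarrow> bool" where
  "standard_weight N a \<theta> \<longleftrightarrow>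
     func (std N) \<theta> (elts (std N) (acar a)) (range (cnum N)) \<and>
     (\<exists>w. weight_extension (calg N a) w (\<lambda>x. cval N (app (std N) \<theta> x)))"

definition internal_hilbert :: "('u, 'v) nonstd \<Rightarrow> 'v hcode \<Rightarrow> bool" where
  "internal_hilbert N H \<longleftrightarrow>
     internal_inst N (\<lambda>k. \<exists>h. k = htuple (std N) h \<and> standard_hilbert N h) (htuple (nst N) H)"

definition internal_cstar :: "('u, 'v) nonstd \<Rightarrow> 'v hcode \<Rightarrow> 'v acode \<Rightarrow> bool" where
  "internal_cstar N H M \<longleftrightarrow>
     internal_inst N
       (\<lambda>k. \<exists>h a. k = opair (std N) (htuple (std N) h) (atuple (std N) a) \<and> standard_cstar N h a)
       (opair (nst N) (htuple (nst N) H) (atuple (nst N) M))"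

text \<open>Internal weights with \<open>\<theta>(1) < \<infinity>\<close> (in the transferred sense), given by their internal linear extension
  \<open>M \<rightarrow> *\<complex>\<close>.\<close>

definition internal_weight :: "('u, 'v) nonstd \<Rightarrow> 'v acode \<Rightarrow> 'v \<Rightarrow> bool" where
  "internal_weight N M \<theta> \<longleftrightarrow>
     internal_inst N
       (\<lambda>k. \<exists>a t. k = opair (std N) (atuple (std N) a) t \<and> standard_weight N a t)
       (opair (nst N) (atuple (nst N) M) \<theta>)"


section \<open>The nonstandard hull\<close>

definition inorm :: "('u, 'v) nonstd \<Rightarrow> 'v acode \<Rightarrow> 'v \<Rightarrow> 'v" where
  "inorm N M a = app (nst N) (anorm M) a"

definition approx :: "('u, 'v) nonstd \<Rightarrow> 'v acode \<Rightarrow> 'v \<Rightarrow> 'v \<Rightarrow> bool" where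
  "approx N M a b \<longleftrightarrow>
     near N (inorm N M (app2 (nst N) (aadd M) a (app2 (nst N) (ascale M) (scx N (-1)) b))) (scx N 0)"

definition Fin :: "('u, 'v) nonstd \<Rightarrow> 'v acode \<Rightarrow> 'v set" where
  "Fin N M = {a \<in> elts (nst N) (acar M). limited N (inorm N M a)}"

definition hat :: "('u, 'v) nonstd \<Rightarrow> 'v acode \<Rightarrow> 'v \<Rightarrow> 'v set" where
  "hat N M a = {x \<in> elts (nst N) (acar M). approx N M x a}"

definition ns_hull :: "('u, 'v) nonstd \<Rightarrow> 'v acode \<Rightarrow> 'v set cstar" where
  "ns_hull N M =
     \<lparr>carrier = hat N M ` Fin N M,
      monoid.mult = (\<lambda>X Y. \<Union>a\<in>X. \<Union>b\<in>Y. hat N M (app2 (nst N) (amult M) a b)),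
      one = hat N M (aone M),
      zero = hat N M (azero M),
      add = (\<lambda>X Y. \<Union>a\<in>X. \<Union>b\<in>Y. hat N M (app2 (nst N) (aadd M) a b)),
      smult = (\<lambda>c X. \<Union>a\<in>X. hat N M (app2 (nst N) (ascale M) (scx N c) a)),
      adj = (\<lambda>X. \<Union>a\<in>X. hat N M (app (nst N) (aadj M) a)),
      nrm = (\<lambda>X. THE r. \<forall>a\<in>X. r = Re (stdpart N (inorm N M a)))\<rparr>"

definition internal_pos :: "('u, 'v) nonstd \<Rightarrow> 'v acode \<Rightarrow> 'v set" where
  "internal_pos N M =
     {app2 (nst N) (amult M) (app (nst N) (aadj M) b) b | b. b \<in> elts (nst N) (acar M)}"

definition S_continuous :: "('u, 'v) nonstd \<Rightarrow> 'v acode \<Rightarrow> 'v \<Rightarrow> bool" where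
  "S_continuous N M \<theta> \<longleftrightarrow>
     (\<forall>\<epsilon>\<in>internal_pos N M. approx N M \<epsilon> (azero M) \<longrightarrow> near N (app (nst N) \<theta> \<epsilon>) (scx N 0))"

definition hull_functional :: "('u, 'v) nonstd \<Rightarrow> 'v \<Rightarrow> 'v set \<Rightarrow> complex" where
  "hull_functional N \<theta> X = (THE c. \<forall>a\<in>X. c = stdpart N (app (nst N) \<theta> a))"

definition hull_weight :: "('u, 'v) nonstd \<Rightarrow> 'v \<Rightarrow> 'v set \<Rightarrow> ennreal" where
  "hull_weight N \<theta> X = ennreal (Re (hull_functional N \<theta> X))"

end

theory Submission
  imports Defs
begin

text \<open>
  An internal object \<open>z\<close> determines an ultrafilter on the standard universe, consisting of the sets whose
  star contains \<open>z\<close>, and every standard function \<open>g\<close> has a value at \<open>z\<close>, its germ.  By transfer, statements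
  about germs hold iff they hold along the ultrafilter, so a finite family of elements of the internal
  algebra can be handled as a family of elements of standard algebras, and standard parts as limits.

  Given a directed family \<open>F\<close> in the hull with weights at most \<open>\<rho>\<close>, the internal conditions
  ``\<open>\<parallel>c\<parallel> < K\<close>, \<open>Re \<theta>(c\<^sup>* c) < \<rho> + 1/n\<close> and \<open>c\<^sup>* c - a\<close> is within \<open>1/n\<close> of a square \<open>b\<^sup>* b\<close>'', one for each
  representative \<open>a\<close> of a member of \<open>F\<close> and each \<open>n\<close>, are finitely satisfiable because \<open>F\<close> is directed.
  By saturation some \<open>c\<close> satisfies all of them; its square is an upper bound of \<open>F\<close> of weight at most \<open>\<rho>\<close>,
  which dominates the supremum.  Transitivity of the order on the hull needs sums of squares to be squares:
  in the standard algebras they are approximately so, by the square root iteration, and saturation makes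
  the approximation exact.
\<close>

section \<open>Superstructures\<close>

text \<open>Transfer is available for bounded formulas only, and an internal algebra is in general
  not the star of one standard algebra but a member of the star of a set of them. An arbitrary HOL
  predicate, however, can be evaluated at each member of a family of standard algebras, and its
  truth along the ultrafilter is all that germs need. Hence formulas occur only for sets, pairs and
  graphs. Positivity means being a square \<open>b\<^sup>* b\<close>, so an inequality in the hull
  is an existence claim about some \<open>b\<close>. That is why the saturated conditions ask for an
  element \<open>c\<close> whose square is the majorant (the square is positive and its weight is
  real), why each condition contains its own approximate root, and why tolerances appear: equality
  in the hull says nothing exact about the standard algebras. The bound on
  \<open>\<parallel>c\<parallel>\<close> keeps the solution finite, so that it has a class in the
  hull. Uncountability of \<kappa> enters because one condition is imposed for each member of
  \<open>F\<close> and each natural number.\<close>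

definition bdd :: "'u sstr \<Rightarrow> 'u set \<Rightarrow> bool" where
  "bdd V A \<longleftrightarrow> (\<exists>n. A \<subseteq> level V n)"

lemma level_mono: "n \<le> m \<Longrightarrow> level V n \<subseteq> level V m"
  by (induction m rule: dec_induct) auto

lemma bdd_subset: "bdd V B \<Longrightarrow> A \<subseteq> B \<Longrightarrow> bdd V A"
  unfolding bdd_def by blast

lemma bdd_level [simp]: "bdd V (level V n)"
  unfolding bdd_def by blast

lemma bdd_empty [simp]: "bdd V {}"
  unfolding bdd_def by blast

lemma bdd_Un [simp]: "bdd V (A \<union> B) \<longleftrightarrow> bdd V A \<and> bdd V B"
proof -
  have "bdd V (A \<union> B)" if "A \<subseteq> level V m" "B \<subseteq> level V n" for m n
    using that level_mono[of m "max m n" V] level_mono[of n "max m n" V]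
    by (auto simp: bdd_def intro!: exI[of _ "max m n"])
  moreover have "bdd V A \<and> bdd V B" if "A \<union> B \<subseteq> level V m" for m
    using that by (auto simp: bdd_def)
  ultimately show ?thesis by (metis bdd_def)
qed

lemma bdd_Int [simp]: "bdd V A \<Longrightarrow> bdd V (A \<inter> B)" "bdd V B \<Longrightarrow> bdd V (A \<inter> B)"
  by (auto intro: bdd_subset)

lemma bdd_Diff [simp]: "bdd V A \<Longrightarrow> bdd V (A - B)"
  by (auto intro: bdd_subset)

lemma bdd_Collect [simp]: "bdd V A \<Longrightarrow> bdd V {k \<in> A. P k}"
  by (auto intro: bdd_subset)

locale sstr =
  fixes V :: "'u sstr"
  assumes V: "superstructure V"
begin

lemma in_level: "\<exists>n. x \<in> level V n"
  using V unfolding superstructure_def by auto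

lemma bdd_singleton [simp]: "bdd V {x}"
  using in_level[of x] by (auto simp: bdd_def)

lemma bdd_insert [simp]: "bdd V (insert x A) \<longleftrightarrow> bdd V A"
  using bdd_Un[of V "{x}" A] by simp

lemma mkset_unique: "s \<notin> indiv V \<Longrightarrow> elts V s = A \<Longrightarrow> mkset V A = s"
  unfolding mkset_def using V unfolding superstructure_def
  by (intro the_equality) auto

text \<open>The levels are closed under all subsets, and extensionality makes the witness unique, so
  the description in \<open>mkset\<close> is proper for sets inside one level.\<close>

lemma elts_mkset [simp]: "bdd V A \<Longrightarrow> elts V (mkset V A) = A"
  and mkset_notin [simp]: "bdd V A \<Longrightarrow> mkset V A \<notin> indiv V"
proof -
  have "\<exists>s. s \<notin> indiv V \<and> elts V s = A" if "bdd V A"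
  proof -
    obtain n where "A \<subseteq> level V n" using \<open>bdd V A\<close> unfolding bdd_def by blast
    moreover have "\<forall>n A. A \<subseteq> level V n \<longrightarrow> (\<exists>s. s \<notin> indiv V \<and> elts V s = A)"
      using V unfolding superstructure_def by simp
    ultimately show ?thesis by simp
  qed
  moreover have "elts V (mkset V A) = A \<and> mkset V A \<notin> indiv V" if "s \<notin> indiv V" "elts V s = A" for s
    using mkset_unique[OF that] that by simp
  ultimately show "bdd V A \<Longrightarrow> elts V (mkset V A) = A" "bdd V A \<Longrightarrow> mkset V A \<notin> indiv V"
    by metis+
qed

lemma mem_mkset [simp]: "bdd V A \<Longrightarrow> mem V x (mkset V A) \<longleftrightarrow> x \<in> A"
  using elts_mkset[of A] unfolding elts_def by blast

lemma mkset_elts: "s \<notin> indiv V \<Longrightarrow> mkset V (elts V s) = s"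
  by (rule mkset_unique) auto

lemma mkset_inj: "bdd V A \<Longrightarrow> bdd V B \<Longrightarrow> mkset V A = mkset V B \<longleftrightarrow> A = B"
  by (metis elts_mkset)

lemma elts_level: "s \<in> level V n \<Longrightarrow> elts V s \<subseteq> level V n"
proof (induction n)
  case 0
  then show ?case using V unfolding superstructure_def by auto
next
  case (Suc n)
  then show ?case by auto
qed

lemma bdd_elts [simp]: "bdd V (elts V s)"
  using in_level[of s] elts_level unfolding bdd_def by blast

lemma elts_indiv: "s \<in> indiv V \<Longrightarrow> elts V s = {}"
  using V unfolding superstructure_def by auto

lemma mkset_level: "A \<subseteq> level V n \<Longrightarrow> mkset V A \<in> level V (Suc n)"
  using elts_mkset[of A] mkset_notin[of A] unfolding level.simps bdd_def by blast

text \<open>Kuratowski pairs in bounded form: every quantifier on the right ranges over the elements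
  of \<open>p\<close> or of an element of \<open>p\<close>. This is the shape that
  \<open>fPair\<close> copies.\<close>

lemma eq_opair_iff:
  "p = opair V x y \<longleftrightarrow>
    (\<exists>a\<in>elts V p. \<exists>b\<in>elts V p. (\<forall>c\<in>elts V p. c = a \<or> c = b) \<and>
       (mem V x a \<and> (\<forall>c\<in>elts V a. c = x)) \<and>
       (mem V x b \<and> mem V y b \<and> (\<forall>c\<in>elts V b. c = x \<or> c = y)))" (is "_ \<longleftrightarrow> ?R")
proof
  assume p: "p = opair V x y"
  have "elts V p = {mkset V {x}, mkset V {x, y}}" by (simp add: p opair_def)
  then show ?R
    by (intro bexI[of _ "mkset V {x}"] bexI[of _ "mkset V {x,y}"]) auto
next
  assume ?R
  then obtain a b where "a \<in> elts V p" "b \<in> elts V p" "\<forall>c\<in>elts V p. c = a \<or> c = b"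
    "x \<in> elts V a \<and> (\<forall>c\<in>elts V a. c = x)"
    "x \<in> elts V b \<and> y \<in> elts V b \<and> (\<forall>c\<in>elts V b. c = x \<or> c = y)"
    by (auto simp: elts_def)
  then have ab: "elts V p = {a, b}" and a: "elts V a = {x}" and b: "elts V b = {x, y}"
    by (simp_all add: set_eq_iff) blast+
  \<comment> \<open>Each of the three has an element, whereas individuals have none; only then does
    extensionality identify it.\<close>
  have "a \<notin> indiv V" "b \<notin> indiv V" "p \<notin> indiv V"
    using a b ab elts_indiv[of a] elts_indiv[of b] elts_indiv[of p] by auto
  then have "a = mkset V {x}" "b = mkset V {x, y}" "p = mkset V {a, b}"
    using mkset_unique[OF _ a] mkset_unique[OF _ b] mkset_unique[OF _ ab] by metis+
  then show "p = opair V x y" by (simp add: opair_def)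
qed

lemma opair_inject [simp]: "opair V x y = opair V x' y' \<longleftrightarrow> x = x' \<and> y = y'"
proof
  assume "opair V x y = opair V x' y'"
  then have "{mkset V {x}, mkset V {x, y}} = {mkset V {x'}, mkset V {x', y'}}"
    unfolding opair_def by (subst (asm) mkset_inj) auto
  then have "{{x}, {x, y}} = {{x'}, {x', y'}}"
    by (auto simp: doubleton_eq_iff mkset_inj)
  then show "x = x' \<and> y = y'"
    by (auto simp: doubleton_eq_iff)
qed simp

lemma opair_level: "x \<in> level V n \<Longrightarrow> y \<in> level V n \<Longrightarrow> opair V x y \<in> level V (Suc (Suc n))"
  unfolding opair_def by (intro mkset_level) (auto intro: mkset_level simp del: level.simps)

lemma bdd_opair:
  assumes "bdd V A" "bdd V B" "\<And>p. p \<in> P \<Longrightarrow> \<exists>x\<in>A. \<exists>y\<in>B. p = opair V x y"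
  shows "bdd V P"
proof -
  obtain n where "A \<union> B \<subseteq> level V n"
    using assms bdd_Un[of V A B] unfolding bdd_def by blast
  then have "P \<subseteq> level V (Suc (Suc n))"
    using assms(3) opair_level by (fastforce simp del: level.simps)
  then show ?thesis unfolding bdd_def by blast
qed

text \<open>Levels are transitive, and \<open>x\<close> and \<open>y\<close> are elements of
  elements of the pair.\<close>

lemma opair_components_level:
  assumes "opair V x y \<in> level V n"
  shows "x \<in> level V n \<and> y \<in> level V n"
proof -
  obtain a b where "a \<in> elts V (opair V x y)" "b \<in> elts V (opair V x y)" "x \<in> elts V a" "y \<in> elts V b"
    using eq_opair_iff[of "opair V x y" x y] by (auto simp: elts_def)
  then show ?thesis using assms elts_level by blast
qed

definition ofst :: "'u \<Rightarrow> 'u" where "ofst p = (THE x. \<exists>y. p = opair V x y)"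
definition osnd :: "'u \<Rightarrow> 'u" where "osnd p = (THE y. \<exists>x. p = opair V x y)"

lemma ofst_opair [simp]: "ofst (opair V x y) = x"
  unfolding ofst_def by auto
lemma osnd_opair [simp]: "osnd (opair V x y) = y"
  unfolding osnd_def by auto

end

section \<open>Derived connectives of bounded formulas\<close>

definition fAll :: "nat \<Rightarrow> nat \<Rightarrow> fm \<Rightarrow> fm" where "fAll i j p = Neg (BEx i j (Neg p))"
definition fDisj :: "fm \<Rightarrow> fm \<Rightarrow> fm" where "fDisj p q = Neg (Conj (Neg p) (Neg q))"
definition fImp :: "fm \<Rightarrow> fm \<Rightarrow> fm" where "fImp p q = Neg (Conj p (Neg q))"

text \<open>The bound variables are 100, 101 and 102, so that the formula can be used with any free
  variables below 100.\<close>

definition fPair :: "nat \<Rightarrow> nat \<Rightarrow> nat \<Rightarrow> fm" where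
  "fPair p x y = BEx 100 p (BEx 101 p (Conj (fAll 102 p (fDisj (Eq 102 100) (Eq 102 101)))
     (Conj (Conj (Mem x 100) (fAll 102 100 (Eq 102 x)))
       (Conj (Mem x 101) (Conj (Mem y 101) (fAll 102 101 (fDisj (Eq 102 x) (Eq 102 y))))))))"

lemma sat_derived [simp]:
  "sat V (fAll i j p) e \<longleftrightarrow> (\<forall>x\<in>elts V (e j). sat V p (e(i := x)))"
  "sat V (fDisj p q) e \<longleftrightarrow> sat V p e \<or> sat V q e"
  "sat V (fImp p q) e \<longleftrightarrow> (sat V p e \<longrightarrow> sat V q e)"
  by (auto simp: fAll_def fDisj_def fImp_def)

lemma (in sstr) sat_fPair [simp]:
  assumes "p < 100" "x < 100" "y < 100"
  shows "sat V (fPair p x y) e \<longleftrightarrow> e p = opair V (e x) (e y)"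
  using assms unfolding fPair_def eq_opair_iff[of "e p" "e x" "e y"] by simp

section \<open>Internal objects and their filters\<close>

locale nsu =
  fixes N :: "('u, 'v) nonstd"
  assumes universe: "nonstandard_universe N"
begin

sublocale S: sstr "std N"
  using universe by unfold_locales (auto simp: nonstandard_universe_def)
sublocale T: sstr "nst N"
  using universe by unfold_locales (auto simp: nonstandard_universe_def)

lemma transfer: "sat (std N) p e \<Longrightarrow> sat (nst N) p (star N \<circ> e)"
  using universe by (auto simp: nonstandard_universe_def)

section \<open>Stars of bounded sets\<close>

definition st :: "'u set \<Rightarrow> 'v set" where
  "st A = elts (nst N) (star N (mkset (std N) A))"

text \<open>The Boolean identity from which the others follow: the transferred formula says that
  each element of \<open>A\<close> lies in exactly one of \<open>A \<inter> B\<close> and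
  \<open>A - B\<close>. Since \<open>B\<close> may be unbounded, only its intersection with
  \<open>A\<close> is starred.\<close>

lemma st_Diff: 
  assumes "bdd (std N) A"
  shows "st (A - B) = st A - st (A \<inter> B)"
proof -
  let ?m = "mkset (std N)"
  define e where "e = (!) [?m {}, ?m A, ?m (A \<inter> B), ?m (A - B)]"
  define p where "p = Conj (fAll 0 1 (fDisj (Conj (Mem 0 2) (Neg (Mem 0 3))) (Conj (Neg (Mem 0 2)) (Mem 0 3))))
    (fAll 0 3 (Mem 0 1))"
  have "sat (std N) p e" using assms by (simp add: p_def e_def)
  from transfer[OF this] show ?thesis
    by (auto simp: p_def e_def st_def elts_def)
qed

lemma st_mono: "bdd (std N) B \<Longrightarrow> A \<subseteq> B \<Longrightarrow> st A \<subseteq> st B"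
  using st_Diff[of B "B - A"] by (simp add: double_diff)

lemma st_empty: "st {} = {}"
  using st_Diff[of "{}" "{}"] by simp

lemma st_Int:
  assumes "bdd (std N) A" "bdd (std N) B"
  shows "st (A \<inter> B) = st A \<inter> st B"
proof
  show "st (A \<inter> B) \<subseteq> st A \<inter> st B" using st_mono assms by blast
  have "st (B - A) \<inter> st A \<subseteq> {}"
    using st_Diff[of "A \<union> B" A] st_mono[of "B" "B - A"] st_mono[of "A \<union> B - A" "B - A"] assms
    by (simp add: Int_absorb1 Un_Diff Int_Un_distrib2) blast
  moreover have "st (B - A) = st B - st (A \<inter> B)"
    using st_Diff[of B A] assms by (simp add: Int_commute)
  ultimately show "st A \<inter> st B \<subseteq> st (A \<inter> B)" by blast
qed

definition gr :: "'u set \<Rightarrow> ('u \<Rightarrow> 'u) \<Rightarrow> 'u set" where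
  "gr A g = {opair (std N) k (g k) | k. k \<in> A}"

lemma bdd_gr [simp]: "bdd (std N) A \<Longrightarrow> bdd (std N) (g ` A) \<Longrightarrow> bdd (std N) (gr A g)"
  by (rule S.bdd_opair[of A "g ` A"]) (auto simp: gr_def)

section \<open>The ultrafilter of an internal object\<close>

definition intern :: "'v \<Rightarrow> bool" where "intern z \<longleftrightarrow> (\<exists>A. bdd (std N) A \<and> z \<in> st A)"

lemma internal_iff_intern: "internal N z \<longleftrightarrow> intern z"
proof
  assume "internal N z"
  then obtain K where K: "K \<notin> indiv (std N)" "z \<in> elts (nst N) (star N K)" unfolding internal_def by blast
  then have "z \<in> st (elts (std N) K)" unfolding st_def by (simp add: S.mkset_elts)
  then show "intern z" unfolding intern_def using S.bdd_elts by blast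
next
  assume "intern z"
  then show "internal N z" unfolding internal_def intern_def st_def using S.mkset_notin by blast
qed

text \<open>The properties that hold throughout some set whose star contains \<open>z\<close>. They
  form a filter because stars commute with intersections, and a proper one because the star of the
  empty set is empty.\<close>

definition ult :: "'v \<Rightarrow> 'u filter" where
  "ult z = Abs_filter (\<lambda>P. \<exists>A. bdd (std N) A \<and> z \<in> st A \<and> (\<forall>k\<in>A. P k))"

lemma eventually_ult:
  assumes "intern z"
  shows "eventually P (ult z) \<longleftrightarrow> (\<exists>A. bdd (std N) A \<and> z \<in> st A \<and> (\<forall>k\<in>A. P k))"
  unfolding ult_def
proof (rule eventually_Abs_filter, rule is_filter.intro)
  show "\<exists>A. bdd (std N) A \<and> z \<in> st A \<and> (\<forall>k\<in>A. True)"
    using assms unfolding intern_def by auto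
next
  fix P Q
  assume "\<exists>A. bdd (std N) A \<and> z \<in> st A \<and> (\<forall>k\<in>A. P k)" "\<exists>A. bdd (std N) A \<and> z \<in> st A \<and> (\<forall>k\<in>A. Q k)"
  then obtain A B where A: "bdd (std N) A" "z \<in> st A" "\<forall>k\<in>A. P k" and B: "bdd (std N) B" "z \<in> st B" "\<forall>k\<in>B. Q k"
    by blast
  then show "\<exists>A. bdd (std N) A \<and> z \<in> st A \<and> (\<forall>k\<in>A. P k \<and> Q k)"
    by (intro exI[of _ "A \<inter> B"]) (auto simp: st_Int)
qed blast

lemma eventually_ultI: "bdd (std N) A \<Longrightarrow> z \<in> st A \<Longrightarrow> (\<And>k. k \<in> A \<Longrightarrow> P k) \<Longrightarrow> eventually P (ult z)"
  using eventually_ult[of z P] unfolding intern_def by blast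

lemma ult_neq_bot: "intern z \<Longrightarrow> ult z \<noteq> bot"
  unfolding trivial_limit_def by (subst eventually_ult) (auto simp flip: ex_in_conv simp: st_empty)

text \<open>A bounded set is split by \<open>P\<close> into two parts whose stars split its star, so
  \<open>z\<close> falls into one of them.\<close>

lemma ult_ultra:
  assumes z: "intern z"
  shows "eventually P (ult z) \<or> eventually (\<lambda>k. \<not> P k) (ult z)"
proof -
  obtain A where A: "bdd (std N) A" "z \<in> st A" using z unfolding intern_def by blast
  let ?P = "{k\<in>A. P k}"
  have "z \<in> st ?P \<or> z \<in> st (A - ?P)"
    using st_Diff[of A ?P] A by (auto simp: Int_absorb1)
  then show ?thesis
  proof
    assume "z \<in> st ?P"
    then have "eventually P (ult z)" by (rule eventually_ultI[rotated]) (use A(1) in auto)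
    then show ?thesis ..
  next
    assume "z \<in> st (A - ?P)"
    then have "eventually (\<lambda>k. \<not> P k) (ult z)" by (rule eventually_ultI[rotated]) (use A(1) in auto)
    then show ?thesis ..
  qed
qed

lemma ult_not: "intern z \<Longrightarrow> eventually (\<lambda>k. \<not> P k) (ult z) \<longleftrightarrow> \<not> eventually P (ult z)"
  using ult_ultra[of z P] eventually_conj[of P "ult z" "\<lambda>k. \<not> P k"] ult_neq_bot[of z]
  by (auto simp: trivial_limit_def)

text \<open>\<open>g\<close> is bounded on a set whose star contains \<open>z\<close>; only there is its graph an object of the standard
  universe.\<close>

definition bg :: "'v \<Rightarrow> ('u \<Rightarrow> 'u) \<Rightarrow> bool" where
  "bg z g \<longleftrightarrow> (\<exists>A. bdd (std N) A \<and> z \<in> st A \<and> bdd (std N) (g ` A))"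

lemma bg_intern: "bg z g \<Longrightarrow> intern z"
  unfolding bg_def intern_def by blast

lemma bgI:
  assumes "intern z" "bdd (std N) B" "eventually (\<lambda>k. g k \<in> B) (ult z)"
  shows "bg z g"
proof -
  obtain A where "bdd (std N) A" "z \<in> st A" "\<forall>k\<in>A. g k \<in> B"
    using assms eventually_ult by blast
  then show ?thesis
    unfolding bg_def using assms(2) by (meson bdd_subset image_subsetI)
qed

lemma bg_witness:
  assumes "bg z g" "eventually P (ult z)"
  obtains A where "bdd (std N) A" "z \<in> st A" "bdd (std N) (g ` A)" "\<And>k. k \<in> A \<Longrightarrow> P k"
proof -
  obtain A where A: "bdd (std N) A" "z \<in> st A" "bdd (std N) (g ` A)" using assms(1) unfolding bg_def by blast
  obtain B where B: "bdd (std N) B" "z \<in> st B" "\<forall>k\<in>B. P k"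
    using assms bg_intern eventually_ult by blast
  show thesis
    using A B by (intro that[of "A \<inter> B"]) (auto simp: st_Int intro: bdd_subset[of _ "g ` A"])
qed

section \<open>Values of standard functions at internal objects\<close>

definition germ :: "'v \<Rightarrow> ('u \<Rightarrow> 'u) \<Rightarrow> 'v" where
  "germ z g = (THE y. \<exists>A. bdd (std N) A \<and> bdd (std N) (g ` A) \<and> z \<in> st A \<and> opair (nst N) z y \<in> st (gr A g))"

text \<open>Transfer of three facts about a graph: totality on \<open>A\<close>, values in the
  image, and single-valuedness.\<close>

lemma st_graph:
  assumes "bdd (std N) A" "bdd (std N) (g ` A)"
  shows "z \<in> st A \<Longrightarrow> \<exists>y\<in>st (g ` A). opair (nst N) z y \<in> st (gr A g)"
    and "opair (nst N) z y \<in> st (gr A g) \<Longrightarrow> z \<in> st A \<and> y \<in> st (g ` A)"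
    and "opair (nst N) z y \<in> st (gr A g) \<Longrightarrow> opair (nst N) z y' \<in> st (gr A g) \<Longrightarrow> y = y'"
proof -
  let ?m = "mkset (std N)"
  \<comment> \<open>Slots 0 to 4 are placeholders for the bound variables; \<open>A\<close>, its
    image and the graph occupy 5 to 7.\<close>
  define e where "e = (!) [?m {}, ?m {}, ?m {}, ?m {}, ?m {}, ?m A, ?m (g ` A), ?m (gr A g)]"
  define p where "p = fAll 0 5 (BEx 1 6 (BEx 2 7 (fPair 2 0 1)))"
  have "sat (std N) p e" using assms by (auto simp: p_def e_def gr_def[of A g, symmetric]) (auto simp: gr_def)
  from transfer[OF this] show "z \<in> st A \<Longrightarrow> \<exists>y\<in>st (g ` A). opair (nst N) z y \<in> st (gr A g)"
    by (auto simp: p_def e_def st_def)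
  define p where "p = fAll 2 7 (BEx 0 5 (BEx 1 6 (fPair 2 0 1)))"
  have "sat (std N) p e" using assms by (auto simp: p_def e_def gr_def[of A g, symmetric]) (auto simp: gr_def)
  from transfer[OF this] show *: "opair (nst N) z y \<in> st (gr A g) \<Longrightarrow> z \<in> st A \<and> y \<in> st (g ` A)" for z y
    by (fastforce simp: p_def e_def st_def)
  define p where "p = fAll 0 5 (fAll 1 6 (fAll 2 6 (fAll 3 7 (fAll 4 7 (fImp (Conj (fPair 3 0 1) (fPair 4 0 2)) (Eq 1 2))))))"
  have "sat (std N) p e" using assms by (auto simp: p_def e_def gr_def[of A g, symmetric]) (auto simp: gr_def)
  from transfer[OF this]
  show "opair (nst N) z y \<in> st (gr A g) \<Longrightarrow> opair (nst N) z y' \<in> st (gr A g) \<Longrightarrow> y = y'"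
    using *[of z y] *[of z y'] by (fastforce simp: p_def e_def st_def)
qed

lemma gr_mono: "A \<subseteq> B \<Longrightarrow> gr A g \<subseteq> gr B g"
  unfolding gr_def by blast

text \<open>The value does not depend on the set over which the graph is formed.\<close>

lemma germ_iff:
  assumes A: "bdd (std N) A" "bdd (std N) (g ` A)" "z \<in> st A"
  shows "germ z g = y \<longleftrightarrow> opair (nst N) z y \<in> st (gr A g)"
proof -
  let ?Q = "\<lambda>y. \<exists>A. bdd (std N) A \<and> bdd (std N) (g ` A) \<and> z \<in> st A \<and> opair (nst N) z y \<in> st (gr A g)"
  have uniq: "y = y'" if Q: "?Q y" "?Q y'" for y y'
  proof -
    obtain A where A: "bdd (std N) A" "bdd (std N) (g ` A)" "opair (nst N) z y \<in> st (gr A g)" using Q(1) by blast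
    obtain B where B: "bdd (std N) B" "bdd (std N) (g ` B)" "opair (nst N) z y' \<in> st (gr B g)" using Q(2) by blast
    \<comment> \<open>Graphs over two sets are compared inside the graph over their union, which is
      still single-valued.\<close>
    let ?C = "A \<union> B"
    have "bdd (std N) ?C" "bdd (std N) (g ` ?C)" using A B by (auto simp: image_Un)
    then show ?thesis
      using st_graph(3)[of ?C g z y y'] A(3) B(3) st_mono[of "gr ?C g" "gr A g"] st_mono[of "gr ?C g" "gr B g"]
        gr_mono[of A ?C g] gr_mono[of B ?C g] bdd_gr[of ?C g] by blast
  qed
  obtain y0 where y0: "opair (nst N) z y0 \<in> st (gr A g)" using st_graph(1)[OF A] by blast
  then have "?Q y0" using A by blast
  then have "germ z g = y0" unfolding germ_def using uniq by blast
  then show ?thesis using y0 uniq A by blast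
qed

lemma germ_in: "bdd (std N) A \<Longrightarrow> bdd (std N) (g ` A) \<Longrightarrow> z \<in> st A \<Longrightarrow> germ z g \<in> st (g ` A)"
  using germ_iff[of A g z "germ z g"] st_graph(2)[of A g] by auto

lemma intern_germ: "bg z g \<Longrightarrow> intern (germ z g)"
  using germ_in unfolding bg_def intern_def by blast

lemma germ_cong:
  assumes "bg z g" "bg z h" "eventually (\<lambda>k. g k = h k) (ult z)"
  shows "germ z g = germ z h"
proof -
  obtain A where A: "bdd (std N) A" "z \<in> st A" "bdd (std N) (g ` A)" "\<And>k. k \<in> A \<Longrightarrow> g k = h k"
    using assms bg_witness by blast
  have "g ` A = h ` A" "gr A g = gr A h" using A(4) by (auto simp: gr_def)
  moreover have "opair (nst N) z (germ z h) \<in> st (gr A h)"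
    using germ_iff[of A h z "germ z h"] A(1-3) \<open>g ` A = h ` A\<close> by simp
  ultimately show ?thesis using germ_iff[OF A(1,3,2), of "germ z h"] by simp
qed

text \<open>If \<open>g\<close> and \<open>h\<close> differ almost everywhere, their graphs over a
  common set are disjoint, while equal germs would put one pair into both stars.\<close>

lemma germ_eq_iff:
  assumes g: "bg z g" and h: "bg z h"
  shows "germ z g = germ z h \<longleftrightarrow> eventually (\<lambda>k. g k = h k) (ult z)"
proof (rule ccontr)
  assume "\<not> ?thesis"
  then have eq: "germ z g = germ z h" and "\<not> eventually (\<lambda>k. g k = h k) (ult z)"
    using germ_cong[OF g h] by blast+
  then have "eventually (\<lambda>k. g k \<noteq> h k) (ult z)" using ult_not g bg_intern by blast
  then obtain A where A: "bdd (std N) A" "z \<in> st A" "bdd (std N) (g ` A)" "\<And>k. k \<in> A \<Longrightarrow> g k \<noteq> h k"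
    using g bg_witness by blast
  obtain B where B: "bdd (std N) B" "z \<in> st B" "bdd (std N) (h ` B)" using h unfolding bg_def by blast
  let ?C = "A \<inter> B"
  have C: "bdd (std N) ?C" "z \<in> st ?C" "bdd (std N) (g ` ?C)" "bdd (std N) (h ` ?C)"
    using A B by (auto simp: st_Int intro: bdd_subset[of _ "g ` A"] bdd_subset[of _ "h ` B"])
  have "opair (nst N) z (germ z g) \<in> st (gr ?C g) \<inter> st (gr ?C h)"
    using germ_iff[of ?C g z "germ z g"] germ_iff[of ?C h z "germ z g"] C eq by auto
  also have "\<dots> = st (gr ?C g \<inter> gr ?C h)" using C by (simp add: st_Int)
  also have "gr ?C g \<inter> gr ?C h = {}" using A(4) by (auto simp: gr_def)
  finally show False by (simp add: st_empty)
qed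

text \<open>Half of the theorem of Los, for formulas in at most three germs; the free variables are 1, 2 and 3.\<close>

lemma los:
  assumes g: "bg z g1" "bg z g2" "bg z g3"
    and ev: "eventually (\<lambda>k. \<forall>e. e 1 = g1 k \<longrightarrow> e 2 = g2 k \<longrightarrow> e 3 = g3 k \<longrightarrow> sat (std N) \<phi> e) (ult z)"
  shows "\<exists>e. e 1 = germ z g1 \<and> e 2 = germ z g2 \<and> e 3 = germ z g3 \<and> sat (nst N) \<phi> e"
proof -
  obtain B where B: "bdd (std N) B" "z \<in> st B" "bdd (std N) (g1 ` B)"
    "\<And>k e. k \<in> B \<Longrightarrow> e 1 = g1 k \<Longrightarrow> e 2 = g2 k \<Longrightarrow> e 3 = g3 k \<Longrightarrow> sat (std N) \<phi> e"
    by (rule bg_witness[OF g(1) ev]) simp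
  obtain B2 where B2: "bdd (std N) B2" "z \<in> st B2" "bdd (std N) (g2 ` B2)" using g(2) unfolding bg_def by blast
  obtain B3 where B3: "bdd (std N) B3" "z \<in> st B3" "bdd (std N) (g3 ` B3)" using g(3) unfolding bg_def by blast
  define A where "A = B \<inter> B2 \<inter> B3"
  have A: "bdd (std N) A" "z \<in> st A" "bdd (std N) (g1 ` A)" "bdd (std N) (g2 ` A)" "bdd (std N) (g3 ` A)"
    unfolding A_def using B(1-3) B2 B3
    by (auto simp: st_Int intro: bdd_subset[of _ "g1 ` B"] bdd_subset[of _ "g2 ` B2"] bdd_subset[of _ "g3 ` B3"])
  have sat: "k \<in> A \<Longrightarrow> e 1 = g1 k \<Longrightarrow> e 2 = g2 k \<Longrightarrow> e 3 = g3 k \<Longrightarrow> sat (std N) \<phi> e" for k e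
    using B(4) A_def by blast
  let ?m = "mkset (std N)"
  define e where "e = (!) [?m {}, ?m {}, ?m {}, ?m {}, ?m {}, ?m {}, ?m {}, ?m A,
    ?m (g1 ` A), ?m (g2 ` A), ?m (g3 ` A), ?m (gr A g1), ?m (gr A g2), ?m (gr A g3)]"
  \<comment> \<open>Points, values and pairs are all quantified over bounded sets, and the pairs tie
    the values 1, 2, 3 to the point 0. The other slots of the resulting environment are beyond
    control, which is why the hypothesis admits every environment with the right entries at 1, 2,
    3.\<close>
  define p where "p = fAll 0 7 (fAll 1 8 (fAll 2 9 (fAll 3 10 (fAll 4 11 (fAll 5 12 (fAll 6 13
     (fImp (fPair 4 0 1) (fImp (fPair 5 0 2) (fImp (fPair 6 0 3) \<phi>)))))))))"
  have "sat (std N) \<phi> (e (0 := k, 1 := u, 2 := v, 3 := w, 4 := x, 5 := y, 6 := z))"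
    if "k \<in> A" "x = opair (std N) k u" "y = opair (std N) k v" "z = opair (std N) k w"
       "x \<in> gr A g1" "y \<in> gr A g2" "z \<in> gr A g3" for k u v w x y z
    by (rule sat[of k]) (use that in \<open>auto simp: gr_def\<close>)
  moreover have "elts (std N) (e 7) = A" "elts (std N) (e 8) = g1 ` A" "elts (std N) (e 9) = g2 ` A"
    "elts (std N) (e 10) = g3 ` A" "elts (std N) (e 11) = gr A g1" "elts (std N) (e 12) = gr A g2"
    "elts (std N) (e 13) = gr A g3"
    using A by (simp_all add: e_def)
  ultimately have "sat (std N) p e" unfolding p_def sat_derived
    by (intro ballI impI) (simp del: fun_upd_apply add: fun_upd_other fun_upd_same)
  from transfer[OF this]
  have *: "\<forall>a\<in>st A. \<forall>u\<in>st (g1 ` A). \<forall>v\<in>st (g2 ` A). \<forall>w\<in>st (g3 ` A). \<forall>x\<in>st (gr A g1). \<forall>y\<in>st (gr A g2).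
    \<forall>z\<in>st (gr A g3). x = opair (nst N) a u \<longrightarrow> y = opair (nst N) a v \<longrightarrow> z = opair (nst N) a w \<longrightarrow>
    sat (nst N) \<phi> ((star N \<circ> e) (0 := a, 1 := u, 2 := v, 3 := w, 4 := x, 5 := y, 6 := z))"
    by (simp add: p_def e_def st_def)
  let ?e = "(star N \<circ> e)(0 := z, 1 := germ z g1, 2 := germ z g2, 3 := germ z g3, 4 := opair (nst N) z (germ z g1),
    5 := opair (nst N) z (germ z g2), 6 := opair (nst N) z (germ z g3))"
  have "sat (nst N) \<phi> ?e"
    using * A germ_in[of A _ z] germ_iff[of A _ z] by blast
  moreover have "?e 1 = germ z g1" "?e 2 = germ z g2" "?e 3 = germ z g3" by simp_all
  ultimately show ?thesis by blast
qed

text \<open>The half of the theorem of Los is applied to the membership formula and to its negation;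
  maximality of the ultrafilter yields the equivalence.\<close>

lemma mem_germ_iff:
  assumes g: "bg z g" and h: "bg z h"
  shows "mem (nst N) (germ z g) (germ z h) \<longleftrightarrow> eventually (\<lambda>k. mem (std N) (g k) (h k)) (ult z)"
proof -
  have "mem (nst N) (germ z g) (germ z h)" if "eventually (\<lambda>k. mem (std N) (g k) (h k)) (ult z)"
    using los[OF g h h eventually_mono[OF that], of "Mem 1 2"] by auto
  moreover have "\<not> mem (nst N) (germ z g) (germ z h)" if "eventually (\<lambda>k. \<not> mem (std N) (g k) (h k)) (ult z)"
    using los[OF g h h eventually_mono[OF that], of "Neg (Mem 1 2)"] by auto
  ultimately show ?thesis using ult_ultra[OF bg_intern[OF g]] by blast
qed

lemma bg_opair:
  assumes g: "bg z g" and h: "bg z h"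
  shows "bg z (\<lambda>k. opair (std N) (g k) (h k))"
proof -
  obtain A where A: "bdd (std N) A" "z \<in> st A" "bdd (std N) (g ` A)" using g unfolding bg_def by blast
  obtain B where B: "bdd (std N) B" "z \<in> st B" "bdd (std N) (h ` B)" using h unfolding bg_def by blast
  have "bdd (std N) ((\<lambda>k. opair (std N) (g k) (h k)) ` (A \<inter> B))"
    by (rule S.bdd_opair[of "g ` A" "h ` B"]) (use A B in auto)
  then show ?thesis unfolding bg_def using A B by (intro exI[of _ "A \<inter> B"]) (auto simp: st_Int)
qed

lemma germ_opair:
  assumes g: "bg z g" and h: "bg z h"
  shows "germ z (\<lambda>k. opair (std N) (g k) (h k)) = opair (nst N) (germ z g) (germ z h)"
  using los[OF bg_opair[OF g h] g h, of "fPair 1 2 3"] by auto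

lemma bg_const [simp]: "intern z \<Longrightarrow> bg z (\<lambda>_. c)"
  by (rule bgI[of z "{c}"]) auto

lemma bg_id [simp]: "intern z \<Longrightarrow> bg z (\<lambda>k. k)"
  unfolding bg_def intern_def by auto

text \<open>Transfer of the fact that \<open>c\<close> is the only element of its singleton.\<close>

lemma germ_const: 
  assumes "intern z"
  shows "germ z (\<lambda>_. c) = star N c"
proof -
  obtain A where A: "bdd (std N) A" "z \<in> st A" using assms unfolding intern_def by blast
  have "bdd (std N) ((\<lambda>_. c) ` A)" by (rule bdd_subset[of _ "{c}"]) auto
  then have "germ z (\<lambda>_. c) \<in> st ((\<lambda>_. c) ` A)" using germ_in A by blast
  then have in1: "germ z (\<lambda>_. c) \<in> st {c}"
    using st_mono[of "{c}" "(\<lambda>_. c) ` A"] by auto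
  define e where "e = (!) [c, c, mkset (std N) {c}]"
  define p where "p = fAll 0 2 (Eq 0 1)"
  have "sat (std N) p e" by (simp add: p_def e_def)
  from transfer[OF this] show ?thesis using in1 by (simp add: p_def e_def st_def)
qed

text \<open>Hence each internal object is a germ, over the ultrafilter that it generates
  itself.\<close>

lemma germ_id: 
  assumes "intern z"
  shows "germ z (\<lambda>k. k) = z"
proof -
  obtain A where A: "bdd (std N) A" "z \<in> st A" using assms unfolding intern_def by blast
  define e where "e = (!) [mkset (std N) {}, mkset (std N) {}, mkset (std N) A, mkset (std N) (gr A (\<lambda>k. k))]"
  define p where "p = fAll 0 2 (BEx 1 3 (fPair 1 0 0))"
  have "sat (std N) p e" using A by (simp add: p_def e_def) (auto simp: gr_def)
  from transfer[OF this] have "\<forall>x\<in>st A. opair (nst N) x x \<in> st (gr A (\<lambda>k. k))"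
    by (simp add: p_def e_def st_def)
  then show ?thesis using germ_iff[of A "\<lambda>k. k" z z] A by simp
qed

lemma germ_in_st_iff:
  assumes g: "bg z g" and A: "bdd (std N) A"
  shows "germ z g \<in> st A \<longleftrightarrow> eventually (\<lambda>k. g k \<in> A) (ult z)"
  using mem_germ_iff[OF g bg_const, of "mkset (std N) A"] bg_intern[OF g] A
  by (simp add: germ_const st_def elts_def)

text \<open>The ultrafilter of a germ is the image of \<open>ult z\<close> under \<open>g\<close>;
  one direction is shown for \<open>P\<close> and its negation, and maximality supplies the
  other.\<close>

lemma ult_germ:
  assumes g: "bg z g"
  shows "eventually P (ult (germ z g)) \<longleftrightarrow> eventually (\<lambda>k. P (g k)) (ult z)"
proof -
  have *: "eventually P (ult (germ z g))" if ev: "eventually (\<lambda>k. P (g k)) (ult z)" for P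
  proof -
    obtain A where A: "bdd (std N) A" "z \<in> st A" "bdd (std N) (g ` A)" "\<And>k. k \<in> A \<Longrightarrow> P (g k)"
      using bg_witness[OF g ev] by blast
    then show ?thesis using germ_in[of A g z] eventually_ultI[of "g ` A"] by blast
  qed
  show ?thesis
    using *[of P] *[of "\<lambda>k. \<not> P k"] ult_not[OF bg_intern[OF g]] ult_not[OF intern_germ[OF g]] by blast
qed

lemma bg_comp:
  assumes g: "bg z g" and h: "bg (germ z g) h"
  shows "bg z (\<lambda>k. h (g k))"
proof -
  obtain B where B: "bdd (std N) B" "germ z g \<in> st B" "bdd (std N) (h ` B)" using h unfolding bg_def by blast
  have "eventually (\<lambda>k. g k \<in> B) (ult z)" using germ_in_st_iff[OF g B(1)] B(2) by blast
  then show ?thesis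
    by (intro bgI[of z "h ` B"]) (use bg_intern[OF g] B in \<open>auto elim: eventually_mono\<close>)
qed

text \<open>Change of base point: a value at a germ is the value of the composite at the original
  point.\<close>

lemma germ_germ:
  assumes g: "bg z g" and h: "bg (germ z g) h"
  shows "germ (germ z g) h = germ z (\<lambda>k. h (g k))"
proof -
  obtain B where B: "bdd (std N) B" "germ z g \<in> st B" "bdd (std N) (h ` B)" using h unfolding bg_def by blast
  note gh = bg_comp[OF g h]
  have "opair (nst N) (germ z g) (germ z (\<lambda>k. h (g k))) = germ z (\<lambda>k. opair (std N) (g k) (h (g k)))"
    using germ_opair[OF g gh] by simp
  also have "\<dots> \<in> st (gr B h)"
  proof (subst germ_in_st_iff[OF bg_opair[OF g gh]])
    show "bdd (std N) (gr B h)" using B by simp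
    have "eventually (\<lambda>k. g k \<in> B) (ult z)" using germ_in_st_iff[OF g B(1)] B(2) by blast
    then show "eventually (\<lambda>k. opair (std N) (g k) (h (g k)) \<in> gr B h) (ult z)"
      by (rule eventually_mono) (auto simp: gr_def)
  qed
  finally show ?thesis using germ_iff[OF B(1,3,2)] by blast
qed

text \<open>Transitivity of a level transfers, so elements of an internal object lie in the star of
  that level.\<close>

lemma intern_elt:
  assumes z: "intern z" and y: "y \<in> elts (nst N) z"
  shows "intern y"
proof -
  obtain A where A: "bdd (std N) A" "z \<in> st A" using z unfolding intern_def by blast
  then obtain n where n: "A \<subseteq> level (std N) n" unfolding bdd_def by blast
  let ?L = "mkset (std N) (level (std N) n)"
  define e where "e = (!) [?L, ?L, ?L]"
  define p where "p = fAll 0 2 (fAll 1 0 (Mem 1 2))"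
  have "sat (std N) p e" using S.elts_level by (fastforce simp: p_def e_def)
  from transfer[OF this] have "y \<in> st (level (std N) n)"
    using y st_mono[OF _ n] A(2) by (auto simp: p_def e_def st_def elts_def)
  then show ?thesis unfolding intern_def using bdd_level by blast
qed

lemma intern_opair:
  assumes "intern x" "intern y"
  shows "intern (opair (nst N) x y)"
proof -
  obtain A B where A: "bdd (std N) A" "x \<in> st A" and B: "bdd (std N) B" "y \<in> st B"
    using assms unfolding intern_def by blast
  let ?m = "mkset (std N)"
  define C where "C = {opair (std N) x y | x y. x \<in> A \<and> y \<in> B}"
  have C: "bdd (std N) C" by (rule S.bdd_opair[of A B]) (use A B in \<open>auto simp: C_def\<close>)
  define e where "e = (!) [?m {}, ?m {}, ?m {}, ?m A, ?m B, ?m C]"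
  define p where "p = fAll 0 3 (fAll 1 4 (BEx 2 5 (fPair 2 0 1)))"
  have "sat (std N) p e" using A B C by (simp add: p_def e_def) (auto simp: C_def)
  from transfer[OF this] have "opair (nst N) x y \<in> st C"
    using A B by (auto simp: p_def e_def st_def)
  then show ?thesis unfolding intern_def using C by auto
qed

lemma intern_opair_iff: "intern (opair (nst N) x y) \<longleftrightarrow> intern x \<and> intern y"
proof -
  obtain a b where "a \<in> elts (nst N) (opair (nst N) x y)" "b \<in> elts (nst N) (opair (nst N) x y)"
      "x \<in> elts (nst N) a" "y \<in> elts (nst N) b"
    using T.eq_opair_iff[of "opair (nst N) x y" x y] by (auto simp: elts_def)
  then show ?thesis using intern_elt intern_opair by metis
qed

text \<open>A pair serves as a common base point: both components, and hence all objects represented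
  over either of them, become germs over one ultrafilter.\<close>

lemma germ_projections:
  assumes z: "intern (opair (nst N) x y)"
  shows "bg (opair (nst N) x y) S.ofst" "bg (opair (nst N) x y) S.osnd"
    "germ (opair (nst N) x y) S.ofst = x" "germ (opair (nst N) x y) S.osnd = y"
    "eventually (\<lambda>k. k = opair (std N) (S.ofst k) (S.osnd k)) (ult (opair (nst N) x y))"
proof -
  let ?z = "opair (nst N) x y"
  obtain A B where A: "bdd (std N) A" "x \<in> st A" and B: "bdd (std N) B" "y \<in> st B"
    using z intern_opair_iff unfolding intern_def by blast
  let ?m = "mkset (std N)"
  define C where "C = {opair (std N) x y | x y. x \<in> A \<and> y \<in> B}"
  have C: "bdd (std N) C" by (rule S.bdd_opair[of A B]) (use A B in \<open>auto simp: C_def\<close>)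
  define e where "e = (!) [?m {}, ?m {}, ?m {}, ?m A, ?m B, ?m C]"
  define p where "p = fAll 0 3 (fAll 1 4 (BEx 2 5 (fPair 2 0 1)))"
  have "sat (std N) p e" using A B C by (simp add: p_def e_def) (auto simp: C_def)
  from transfer[OF this] have zC: "?z \<in> st C"
    using A B by (auto simp: p_def e_def st_def)
  show ev: "eventually (\<lambda>k. k = opair (std N) (S.ofst k) (S.osnd k)) (ult ?z)"
    by (rule eventually_ultI[OF C zC]) (auto simp: C_def)
  show f: "bg ?z S.ofst" 
    unfolding bg_def by (intro exI[of _ C]) (use C zC A B in \<open>auto simp: C_def intro: bdd_subset[of _ A]\<close>)
  show s: "bg ?z S.osnd" 
    unfolding bg_def by (intro exI[of _ C]) (use C zC A B in \<open>auto simp: C_def intro: bdd_subset[of _ B]\<close>)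
  have "?z = germ ?z (\<lambda>k. k)" using germ_id z by simp
  also have "\<dots> = germ ?z (\<lambda>k. opair (std N) (S.ofst k) (S.osnd k))"
    by (rule germ_cong) (use ev z f s bg_opair in auto)
  also have "\<dots> = opair (nst N) (germ ?z S.ofst) (germ ?z S.osnd)" by (rule germ_opair[OF f s])
  finally show "germ ?z S.ofst = x" "germ ?z S.osnd = y" by auto
qed

end

lemma app_mem:
  assumes "func V f D E" "x \<in> D"
  shows "opair V x y \<in> elts V f \<longleftrightarrow> y = app V f x"
proof -
  have ex: "\<exists>!y. opair V x y \<in> elts V f" using assms unfolding func_def by simp
  have "opair V x (app V f x) \<in> elts V f" unfolding app_def by (rule theI'[OF ex])
  with ex show ?thesis by (auto elim!: ex1E)
qed

lemma app_in: 
  assumes V: "superstructure V" and f: "func V f D E" and x: "x \<in> D"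
  shows "app V f x \<in> E"
proof -
  have "opair V x (app V f x) \<in> cart V D E"
    using app_mem[OF f x, of "app V f x"] f unfolding func_def by blast
  then show ?thesis unfolding cart_def using sstr.opair_inject[OF sstr.intro[OF V]] by auto
qed

section \<open>Hypercomplex numbers as germs\<close>

context nsu
begin

lemma inj_cnum: "cnum N a = cnum N b \<longleftrightarrow> a = b"
  using universe by (auto simp: nonstandard_universe_def dest: injD)

lemma cval_cnum [simp]: "cval N (cnum N c) = c"
  using universe by (simp add: cval_def nonstandard_universe_def the_inv_f_f)

lemma bdd_cnum: "bdd (std N) (range (cnum N))"
  using universe by (auto simp: nonstandard_universe_def bdd_def)

lemma bg_cnum [simp]: "intern z \<Longrightarrow> bg z (\<lambda>k. cnum N (q k))"
  by (rule bgI[OF _ bdd_cnum]) auto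

lemma star_pred_germ:
  assumes z: "intern z"
  shows "star_pred N P (germ z (\<lambda>k. cnum N (q k))) \<longleftrightarrow> eventually (\<lambda>k. P (q k)) (ult z)"
proof -
  have "bdd (std N) {cnum N a | a. P a}" by (rule bdd_subset[OF bdd_cnum]) auto
  from germ_in_st_iff[OF bg_cnum[OF z] this, of q] show ?thesis
    by (simp add: star_pred_def st_def inj_cnum)
qed

lemma star_rel_germ:
  assumes z: "intern z"
  shows "star_rel N R (germ z (\<lambda>k. cnum N (p k))) (germ z (\<lambda>k. cnum N (q k))) \<longleftrightarrow>
    eventually (\<lambda>k. R (p k) (q k)) (ult z)"
proof -
  let ?B = "{opair (std N) (cnum N a) (cnum N b) | a b. R a b}"
  have "bdd (std N) ?B" by (rule S.bdd_opair[OF bdd_cnum bdd_cnum]) auto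
  from germ_in_st_iff[OF bg_opair[OF bg_cnum[OF z] bg_cnum[OF z]] this, of p q] show ?thesis
    by (simp add: star_rel_def st_def inj_cnum germ_opair[OF bg_cnum[OF z] bg_cnum[OF z]])
qed

lemma scx_germ: "intern z \<Longrightarrow> scx N c = germ z (\<lambda>_. cnum N c)"
  by (simp add: scx_def germ_const)

text \<open>The discs of radius \<open>1/n\<close> form a neighbourhood base at \<open>c\<close>, so
  infinite closeness is convergence along the ultrafilter.\<close>

lemma near_germ_scx:
  assumes z: "intern z"
  shows "near N (germ z (\<lambda>k. cnum N (p k))) (scx N c) \<longleftrightarrow> (p \<longlongrightarrow> c) (ult z)"
proof -
  have "near N (germ z (\<lambda>k. cnum N (p k))) (scx N c) \<longleftrightarrow>
      (\<forall>n\<ge>1::nat. eventually (\<lambda>k. cmod (p k - c) < 1 / real n) (ult z))"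
    unfolding near_def scx_germ[OF z] star_rel_germ[OF z] ..
  also have "\<dots> \<longleftrightarrow> (p \<longlongrightarrow> c) (ult z)"
  proof
    assume *: "\<forall>n\<ge>1::nat. eventually (\<lambda>k. cmod (p k - c) < 1 / real n) (ult z)"
    show "(p \<longlongrightarrow> c) (ult z)"
    proof (rule tendstoI)
      fix e :: real assume "e > 0"
      then obtain n :: nat where n: "n \<noteq> 0" "inverse (real n) < e"
        using real_arch_inverse[of e] by auto
      have "eventually (\<lambda>k. cmod (p k - c) < 1 / real n) (ult z)" using * n by simp
      then show "eventually (\<lambda>k. dist (p k) c < e) (ult z)"
        by (rule eventually_mono) (use n in \<open>simp add: dist_norm inverse_eq_divide\<close>)
    qed
  qed (auto simp: tendsto_iff dist_norm)
  finally show ?thesis .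
qed

lemma limited_germ:
  assumes z: "intern z"
  shows "limited N (germ z (\<lambda>k. cnum N (p k))) \<longleftrightarrow> (\<exists>B. eventually (\<lambda>k. cmod (p k) \<le> B) (ult z))"
proof -
  have "\<exists>n::nat. eventually (\<lambda>k. cmod (p k) < real n) (ult z)"
    if "eventually (\<lambda>k. cmod (p k) \<le> B) (ult z)" for B
  proof -
    obtain n :: nat where "B < real n" using reals_Archimedean2 by blast
    then show ?thesis by (intro exI[of _ n] eventually_mono[OF that]) auto
  qed
  moreover have "eventually (\<lambda>k. cmod (p k) \<le> real n) (ult z)"
    if "eventually (\<lambda>k. cmod (p k) < real n) (ult z)" for n
    by (rule eventually_mono[OF that]) simp
  ultimately show ?thesis unfolding limited_def star_pred_germ[OF z] by blast
qed

text \<open>Compactness of the disc gives a cluster point, and maximality of the ultrafilter makes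
  it a limit.\<close>

lemma ult_convergent:
  assumes z: "intern z" and B: "eventually (\<lambda>k. cmod (p k) \<le> B) (ult z)"
  shows "\<exists>c. (p \<longlongrightarrow> c) (ult z)"
proof -
  have "filtermap p (ult z) \<noteq> bot" using ult_neq_bot[OF z] by (simp add: filtermap_bot_iff)
  moreover have "eventually (\<lambda>c. c \<in> cball 0 B) (filtermap p (ult z))"
    using B by (simp add: eventually_filtermap)
  ultimately obtain c where c: "inf (nhds c) (filtermap p (ult z)) \<noteq> bot"
    using compact_cball[of "0::complex" B] unfolding compact_filter by blast
  have "(p \<longlongrightarrow> c) (ult z)"
  proof (rule topological_tendstoI)
    fix S assume S: "open S" "c \<in> S"
    show "eventually (\<lambda>k. p k \<in> S) (ult z)"
    proof (rule ccontr)
      assume "\<not> ?thesis"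
      then have "eventually (\<lambda>k. p k \<notin> S) (ult z)" using ult_not[OF z] by blast
      then have "eventually (\<lambda>x. x \<notin> S) (filtermap p (ult z))" by (simp add: eventually_filtermap)
      moreover have "eventually (\<lambda>x. x \<in> S) (nhds c)" using S by (rule eventually_nhds_in_open)
      ultimately have "eventually (\<lambda>_. False) (inf (nhds c) (filtermap p (ult z)))"
        unfolding eventually_inf by (metis (mono_tags, lifting))
      then show False using c by (simp add: trivial_limit_def)
    qed
  qed
  then show ?thesis ..
qed

lemma stdpart_germ:
  assumes z: "intern z" and "(p \<longlongrightarrow> c) (ult z)"
  shows "stdpart N (germ z (\<lambda>k. cnum N (p k))) = c"
  unfolding stdpart_def near_germ_scx[OF z]
  using assms ult_neq_bot[OF z] tendsto_unique by blast

end

section \<open>Operator algebras over a standard Hilbert space\<close>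

text \<open>The properties of an operator algebra that survive the passage to the hull; \<open>nrm_one_minus\<close> is all that the
  square root iteration needs from spectral theory.\<close>

locale star_seminorm =
  fixes A :: "('a, 'm) cstar_scheme" (structure) and f :: "'a \<Rightarrow> complex"
  assumes closed [simp, intro]: "\<zero> \<in> carrier A" "\<one> \<in> carrier A"
      "a \<in> carrier A \<Longrightarrow> b \<in> carrier A \<Longrightarrow> a \<oplus> b \<in> carrier A"
      "a \<in> carrier A \<Longrightarrow> b \<in> carrier A \<Longrightarrow> a \<otimes> b \<in> carrier A"
      "a \<in> carrier A \<Longrightarrow> c \<odot> a \<in> carrier A"
      "a \<in> carrier A \<Longrightarrow> adj A a \<in> carrier A"
    and add_assoc: "a \<in> carrier A \<Longrightarrow> b \<in> carrier A \<Longrightarrow> d \<in> carrier A \<Longrightarrow> (a \<oplus> b) \<oplus> d = a \<oplus> (b \<oplus> d)"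
    and add_commute: "a \<in> carrier A \<Longrightarrow> b \<in> carrier A \<Longrightarrow> a \<oplus> b = b \<oplus> a"
    and add_zero [simp]: "a \<in> carrier A \<Longrightarrow> \<zero> \<oplus> a = a"
    and add_neg [simp]: "a \<in> carrier A \<Longrightarrow> (-1) \<odot> a \<oplus> a = \<zero>"
    and smult_add: "a \<in> carrier A \<Longrightarrow> b \<in> carrier A \<Longrightarrow> c \<odot> (a \<oplus> b) = c \<odot> a \<oplus> c \<odot> b"
    and smult_add_left: "a \<in> carrier A \<Longrightarrow> (c + c') \<odot> a = c \<odot> a \<oplus> c' \<odot> a"
    and smult_smult: "a \<in> carrier A \<Longrightarrow> c \<odot> (c' \<odot> a) = (c * c') \<odot> a"
    and smult_1 [simp]: "a \<in> carrier A \<Longrightarrow> 1 \<odot> a = a"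
    and mult_one [simp]: "a \<in> carrier A \<Longrightarrow> \<one> \<otimes> a = a" "a \<in> carrier A \<Longrightarrow> a \<otimes> \<one> = a"
    and mult_add: "a \<in> carrier A \<Longrightarrow> b \<in> carrier A \<Longrightarrow> d \<in> carrier A \<Longrightarrow> (a \<oplus> b) \<otimes> d = a \<otimes> d \<oplus> b \<otimes> d"
      "a \<in> carrier A \<Longrightarrow> b \<in> carrier A \<Longrightarrow> d \<in> carrier A \<Longrightarrow> d \<otimes> (a \<oplus> b) = d \<otimes> a \<oplus> d \<otimes> b"
    and mult_smult: "a \<in> carrier A \<Longrightarrow> b \<in> carrier A \<Longrightarrow> (c \<odot> a) \<otimes> b = c \<odot> (a \<otimes> b)"
      "a \<in> carrier A \<Longrightarrow> b \<in> carrier A \<Longrightarrow> a \<otimes> (c \<odot> b) = c \<odot> (a \<otimes> b)"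
    and adj_add: "a \<in> carrier A \<Longrightarrow> b \<in> carrier A \<Longrightarrow> adj A (a \<oplus> b) = adj A a \<oplus> adj A b"
    and adj_smult: "a \<in> carrier A \<Longrightarrow> adj A (c \<odot> a) = cnj c \<odot> adj A a"
    and mult_assoc: "a \<in> carrier A \<Longrightarrow> b \<in> carrier A \<Longrightarrow> d \<in> carrier A \<Longrightarrow> (a \<otimes> b) \<otimes> d = a \<otimes> (b \<otimes> d)"
    and adj_adj: "a \<in> carrier A \<Longrightarrow> adj A (adj A a) = a"
    and adj_mult: "a \<in> carrier A \<Longrightarrow> b \<in> carrier A \<Longrightarrow> adj A (a \<otimes> b) = adj A b \<otimes> adj A a"
    and nrm_nonneg [simp]: "a \<in> carrier A \<Longrightarrow> 0 \<le> nrm A a"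
    and nrm_add: "a \<in> carrier A \<Longrightarrow> b \<in> carrier A \<Longrightarrow> nrm A (a \<oplus> b) \<le> nrm A a + nrm A b"
    and nrm_smult: "a \<in> carrier A \<Longrightarrow> nrm A (c \<odot> a) = cmod c * nrm A a"
    and nrm_mult: "a \<in> carrier A \<Longrightarrow> b \<in> carrier A \<Longrightarrow> nrm A (a \<otimes> b) \<le> nrm A a * nrm A b"
    and nrm_adj: "a \<in> carrier A \<Longrightarrow> nrm A (adj A a) \<le> nrm A a"
    and nrm_star: "a \<in> carrier A \<Longrightarrow> (nrm A a)\<^sup>2 \<le> nrm A (adj A a \<otimes> a)"
    and nrm_one: "nrm A \<one> \<le> 1"
    and nrm_one_minus: "a \<in> carrier A \<Longrightarrow> nrm A a < 1 \<Longrightarrow> nrm A (\<one> \<oplus> (-1) \<odot> (adj A a \<otimes> a)) \<le> 1"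
    and f_add: "a \<in> carrier A \<Longrightarrow> b \<in> carrier A \<Longrightarrow> f (a \<oplus> b) = f a + f b"
    and f_smult: "a \<in> carrier A \<Longrightarrow> f (c \<odot> a) = c * f a"
    and f_pos: "a \<in> carrier A \<Longrightarrow> f (adj A a \<otimes> a) = complex_of_real (Re (f (adj A a \<otimes> a))) \<and>
      0 \<le> Re (f (adj A a \<otimes> a))"
begin

lemma f_zero: "f \<zero> = 0"
  using f_add[of \<zero> \<zero>] by simp

lemma adj_one: "adj A \<one> = \<one>"
  using adj_mult[of "adj A \<one>" \<one>] adj_adj[of \<one>] by simp

lemma add_left_commute:
  "a \<in> carrier A \<Longrightarrow> b \<in> carrier A \<Longrightarrow> d \<in> carrier A \<Longrightarrow> a \<oplus> (b \<oplus> d) = b \<oplus> (a \<oplus> d)"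
  using add_assoc[of a b d] add_assoc[of b a d] add_commute[of a b] by simp

lemmas add_ac = add_assoc add_commute add_left_commute

text \<open>Differences use the scalar -1, as \<open>approx\<close> does, and so are built from
  operations that have representing families; the library's \<open>a_minus\<close> goes through a
  description of the inverse.\<close>

abbreviation sub :: "'a \<Rightarrow> 'a \<Rightarrow> 'a" where
  "sub a b \<equiv> a \<oplus> (-1) \<odot> b"

lemma neg_cancel [simp]: "a \<in> carrier A \<Longrightarrow> b \<in> carrier A \<Longrightarrow> (-1) \<odot> a \<oplus> (a \<oplus> b) = b"
  by (simp flip: add_assoc)

lemma add_zero_right [simp]: "a \<in> carrier A \<Longrightarrow> a \<oplus> \<zero> = a"
  using add_commute[of a \<zero>] by simp

lemma sub_self [simp]: "a \<in> carrier A \<Longrightarrow> sub a a = \<zero>"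
  using add_commute[of a "(-1) \<odot> a"] by simp

lemma smult_zero [simp]: "a \<in> carrier A \<Longrightarrow> 0 \<odot> a = \<zero>" "c \<odot> \<zero> = \<zero>"
proof -
  show *: "0 \<odot> a = \<zero>" if "a \<in> carrier A" for a
    using that smult_add_left[of a 1 "-1"] by simp
  show "c \<odot> \<zero> = \<zero>"
    using *[of \<one>] smult_smult[of \<one> c 0] by simp
qed

lemma mult_zero [simp]: "a \<in> carrier A \<Longrightarrow> \<zero> \<otimes> a = \<zero>" "a \<in> carrier A \<Longrightarrow> a \<otimes> \<zero> = \<zero>"
  using mult_smult[of \<zero> a 0] mult_smult[of a \<zero> 0] by simp_all

lemma adj_zero [simp]: "adj A \<zero> = \<zero>"
  using adj_smult[of \<zero> 0] by simp

lemma sub_add_cancel: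
  assumes "a \<in> carrier A" "b \<in> carrier A" "d \<in> carrier A"
  shows "sub (a \<oplus> b) (a \<oplus> d) = sub b d"
proof -
  have "sub (a \<oplus> b) (a \<oplus> d) = (-1) \<odot> a \<oplus> (a \<oplus> sub b d)"
    using assms by (simp add: smult_add add_ac del: neg_cancel)
  then show ?thesis using assms by simp
qed

lemma sub_trans:
  "a \<in> carrier A \<Longrightarrow> b \<in> carrier A \<Longrightarrow> d \<in> carrier A \<Longrightarrow> sub a b \<oplus> sub b d = sub a d"
  by (simp add: add_assoc)

lemma sub_add:
  "a \<in> carrier A \<Longrightarrow> b \<in> carrier A \<Longrightarrow> a' \<in> carrier A \<Longrightarrow> b' \<in> carrier A \<Longrightarrow>
    sub (a \<oplus> b) (a' \<oplus> b') = sub a a' \<oplus> sub b b'"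
  by (simp add: smult_add add_ac del: neg_cancel)

lemma sub_mult:
  assumes "a \<in> carrier A" "b \<in> carrier A" "a' \<in> carrier A" "b' \<in> carrier A"
  shows "sub (a \<otimes> b) (a' \<otimes> b') = a \<otimes> sub b b' \<oplus> sub a a' \<otimes> b'"
  using assms sub_trans[of "a \<otimes> b" "a \<otimes> b'" "a' \<otimes> b'"] by (simp add: mult_add mult_smult)

lemma nrm_sub_commute: "a \<in> carrier A \<Longrightarrow> b \<in> carrier A \<Longrightarrow> nrm A (sub a b) = nrm A (sub b a)"
  using nrm_smult[of "sub a b" "-1"] add_commute[of "(-1) \<odot> a" b] by (simp add: smult_add smult_smult)

lemma nrm_zero [simp]: "nrm A \<zero> = 0"
  using nrm_smult[of \<zero> 0] by simp

lemma nrm_sub_trans: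
  "a \<in> carrier A \<Longrightarrow> b \<in> carrier A \<Longrightarrow> d \<in> carrier A \<Longrightarrow> nrm A (sub a d) \<le> nrm A (sub a b) + nrm A (sub b d)"
  using nrm_add[of "sub a b" "sub b d"] by (simp add: sub_trans)

lemma nrm_le_sub:
  assumes "a \<in> carrier A" "b \<in> carrier A"
  shows "nrm A a \<le> nrm A b + nrm A (sub a b)"
proof -
  have "b \<oplus> sub a b = (-1) \<odot> b \<oplus> (b \<oplus> a)" using assms by (simp add: add_ac del: neg_cancel)
  then show ?thesis using assms nrm_add[of b "sub a b"] by simp
qed

text \<open>The iteration \<open>y \<mapsto> (x + y\<^sup>2) / 2\<close> approximates \<open>1 - \<surd>(1 - x)\<close>; the same iteration for the number \<open>1\<close>
  majorises its increments.\<close>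

lemma approx_sqrt:
  assumes x: "x \<in> carrier A" "adj A x = x" "nrm A x \<le> 1" and e: "e > 0"
  shows "\<exists>d\<in>carrier A. nrm A (sub (sub \<one> x) (adj A d \<otimes> d)) < e"
proof -
  define y where "y = rec_nat \<zero> (\<lambda>_ u. (1/2) \<odot> (x \<oplus> u \<otimes> u))"
  define t where "t = rec_nat 0 (\<lambda>_ u::real. (1 + u\<^sup>2) / 2)"
  have y0: "y 0 = \<zero>" and yS: "y (Suc n) = (1/2) \<odot> (x \<oplus> y n \<otimes> y n)" for n by (simp_all add: y_def)
  have t0: "t 0 = 0" and tS: "t (Suc n) = (1 + (t n)\<^sup>2) / 2" for n by (simp_all add: t_def)
  have yc [simp]: "y n \<in> carrier A" for n by (induction n) (use x in \<open>simp_all add: y0 yS\<close>)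
  have yadj: "adj A (y n) = y n" for n
  proof (induction n)
    case 0
    show ?case by (simp add: y0)
  next
    case (Suc n)
    then show ?case using x by (simp add: yS adj_smult adj_add adj_mult)
  qed
  \<comment> \<open>The iterates are polynomials in \<open>x\<close>, so they commute with
    \<open>x\<close> and, one step apart, with each other.\<close>
  have yx: "y n \<otimes> x = x \<otimes> y n" for n
  proof (induction n)
    case 0
    show ?case using x by (simp add: y0)
  next
    case (Suc n)
    have "(y n \<otimes> y n) \<otimes> x = y n \<otimes> (x \<otimes> y n)" using x Suc by (simp add: mult_assoc)
    also have "\<dots> = x \<otimes> (y n \<otimes> y n)" using x Suc by (simp flip: mult_assoc)
    finally show ?case using x by (simp add: yS mult_smult mult_add)
  qed
  have comm: "y (Suc n) \<otimes> y n = y n \<otimes> y (Suc n)" for n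
    using x yx[of n] by (simp add: yS mult_smult mult_add mult_assoc)
  have tpos: "0 \<le> t n" for n by (induction n) (auto simp: t0 tS)
  have t1: "t n \<le> 1" for n
  proof (induction n)
    case (Suc n)
    then have "(t n)\<^sup>2 \<le> 1" using tpos[of n] by (simp add: power_le_one)
    then show ?case by (simp add: tS)
  qed (simp add: t0)
  have yt: "nrm A (y n) \<le> t n" for n
  proof (induction n)
    case (Suc n)
    have "nrm A (x \<oplus> y n \<otimes> y n) \<le> 1 + nrm A (y n) * nrm A (y n)"
      using nrm_add[of x "y n \<otimes> y n"] nrm_mult[of "y n" "y n"] x by simp
    also have "\<dots> \<le> 1 + (t n)\<^sup>2" using Suc by (simp add: power2_eq_square mult_mono tpos)
    finally show ?case using x by (simp add: yS tS nrm_smult)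
  qed (simp add: y0 t0)
  have diff: "nrm A (sub (y (Suc n)) (y n)) \<le> t (Suc n) - t n" for n
  proof (induction n)
    case 0
    show ?case using yt[of 1] by (simp add: y0 t0)
  next
    case (Suc n)
    let ?p = "y (Suc n)" and ?q = "y n"
    \<comment> \<open>Since \<open>p\<close> and \<open>q\<close> commute,
      \<open>p\<^sup>2 - q\<^sup>2 = (p - q)(p + q)\<close>. The same factorisation for the numbers
      \<open>t\<close> turns the bound on one increment into the bound on the next.\<close>
    have "sub ?p ?q \<otimes> (?p \<oplus> ?q) = sub (?q \<otimes> ?p \<oplus> ?p \<otimes> ?p) (?q \<otimes> ?p \<oplus> ?q \<otimes> ?q)"
      using comm[of n] by (simp add: mult_add mult_smult smult_add add_ac del: neg_cancel add_neg sub_self)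
    also have "\<dots> = sub (?p \<otimes> ?p) (?q \<otimes> ?q)" by (rule sub_add_cancel) auto
    also have "\<dots> = sub (x \<oplus> ?p \<otimes> ?p) (x \<oplus> ?q \<otimes> ?q)" using x by (intro sub_add_cancel[symmetric]) auto
    finally have eq: "sub (y (Suc (Suc n))) ?p = (1/2) \<odot> (sub ?p ?q \<otimes> (?p \<oplus> ?q))"
      using x by (simp add: yS[of "Suc n"]) (simp add: yS[of n] smult_add smult_smult)
    have "nrm A (sub ?p ?q \<otimes> (?p \<oplus> ?q)) \<le> nrm A (sub ?p ?q) * nrm A (?p \<oplus> ?q)" by (rule nrm_mult) auto
    also have "\<dots> \<le> (t (Suc n) - t n) * (t (Suc n) + t n)"
      using Suc nrm_add[of ?p ?q] yt[of n] yt[of "Suc n"] order_trans[OF nrm_nonneg Suc]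
      by (intro mult_mono) auto
    finally have "nrm A (sub (y (Suc (Suc n))) ?p) \<le> (t (Suc n) - t n) * (t (Suc n) + t n) / 2"
      unfolding eq by (subst nrm_smult) auto
    also have "\<dots> = t (Suc (Suc n)) - t (Suc n)"
    proof -
      have "(t (Suc n) - t n) * (t (Suc n) + t n) = (t (Suc n))\<^sup>2 - (t n)\<^sup>2"
        by (simp add: algebra_simps power2_eq_square)
      moreover have "t (Suc (Suc n)) - t (Suc n) = ((t (Suc n))\<^sup>2 - (t n)\<^sup>2) / 2"
        by (rule trans[OF arg_cong2[of _ _ _ _ minus, OF tS tS]]) (simp add: field_simps)
      ultimately show ?thesis by simp
    qed
    finally show ?case .
  qed
  have "t n \<le> t (Suc n)" for n
    using order_trans[OF nrm_nonneg diff[of n]] by simp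
  then have "incseq t" by (rule incseq_SucI)
  \<comment> \<open>A bounded monotone sequence has increments tending to 0. One small increment is
    all that is taken from this; no limit of the iterates \<open>y n\<close> is formed.\<close>
  then obtain l where l: "t \<longlonglongrightarrow> l" using incseq_convergent[of t 1] t1 by blast
  then have "(\<lambda>n. t (Suc n) - t n) \<longlonglongrightarrow> l - l" by (intro tendsto_diff LIMSEQ_Suc)
  then have "eventually (\<lambda>n. t (Suc n) - t n < e / 2) sequentially" using e by (intro order_tendstoD(2)) auto
  then obtain n where n: "t (Suc n) - t n < e / 2" using eventually_sequentially by auto
  \<comment> \<open>With \<open>d = 1 - y\<close> the error \<open>(1 - x) - d\<^sup>2\<close>
    equals \<open>2 y - (x + y\<^sup>2)\<close>, twice the difference of \<open>y\<close> and the
    next iterate; hence the threshold \<open>e / 2\<close> above.\<close>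
  define d where "d = sub \<one> (y n)"
  have dc: "d \<in> carrier A" by (simp add: d_def)
  have "adj A d = d" by (simp add: d_def adj_add adj_smult adj_one yadj)
  then have "adj A d \<otimes> d = \<one> \<oplus> ((-1) \<odot> y n \<oplus> (-1) \<odot> sub (y n) (y n \<otimes> y n))"
    using dc by (simp add: d_def mult_add mult_smult smult_add add_assoc)
  then have "sub (sub \<one> x) (adj A d \<otimes> d) = sub ((-1) \<odot> x) ((-1) \<odot> y n \<oplus> (-1) \<odot> sub (y n) (y n \<otimes> y n))"
    using x by (simp only:) (rule sub_add_cancel; simp)
  also have "\<dots> = 2 \<odot> sub (y n) (y (Suc n))"
    using x smult_add_left[of "y n" 1 1]
    by (simp add: yS smult_add smult_smult add_ac del: neg_cancel)
  finally have "nrm A (sub (sub \<one> x) (adj A d \<otimes> d)) = 2 * nrm A (sub (y n) (y (Suc n)))"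
    by (simp add: nrm_smult del: y0)
  also have "\<dots> < e" using n diff[of n] nrm_sub_commute[of "y n" "y (Suc n)"] by simp
  finally show ?thesis using dc by blast
qed

text \<open>Divide \<open>b\<close> and \<open>c\<close> by \<open>s\<close>. Then
  \<open>1 - b\<^sup>* b\<close> and \<open>1 - c\<^sup>* c\<close> have norm at most 1, hence so
  has their mean \<open>x\<close>, and \<open>1 - x\<close> is half the sum of the two squares. Its
  approximate root is scaled back.\<close>

lemma approx_sum_of_squares:
  assumes b: "b \<in> carrier A" and c: "c \<in> carrier A" and e: "e > 0"
  shows "\<exists>d\<in>carrier A. nrm A (sub (adj A b \<otimes> b \<oplus> adj A c \<otimes> c) (adj A d \<otimes> d)) < e"
proof -
  \<comment> \<open>The summand 1 keeps both norms strictly below \<open>s\<close>, as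
    \<open>nrm_one_minus\<close> demands, and \<open>s\<close> away from 0.\<close>
  define s where "s = nrm A b + nrm A c + 1"
  have s: "s > 0" "nrm A b < s" "nrm A c < s" using nrm_nonneg[OF b] nrm_nonneg[OF c] unfolding s_def by linarith+
  define i where "i = complex_of_real (1 / s)"
  have sq: "adj A (complex_of_real r \<odot> a) \<otimes> (complex_of_real r \<odot> a) = complex_of_real (r\<^sup>2) \<odot> (adj A a \<otimes> a)"
    if "a \<in> carrier A" for r a
    using that by (simp add: adj_smult mult_smult smult_smult power2_eq_square)
  have one: "nrm A (sub \<one> (complex_of_real ((1 / s)\<^sup>2) \<odot> (adj A a \<otimes> a))) \<le> 1" if "a \<in> carrier A" "nrm A a < s" for a
    using nrm_one_minus[of "complex_of_real (1/s) \<odot> a"] sq[of a "1/s"] that s by (simp add: nrm_smult del: of_real_divide of_real_power)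
  define P where "P a = complex_of_real ((1 / s)\<^sup>2) \<odot> (adj A a \<otimes> a)" for a
  have P: "P a \<in> carrier A" "adj A (P a) = P a" if "a \<in> carrier A" for a
    using that by (simp_all add: P_def adj_smult adj_mult adj_adj)
  define x where "x = (1/2) \<odot> (sub \<one> (P b) \<oplus> sub \<one> (P c))"
  have x: "x \<in> carrier A" "adj A x = x"
    using P b c by (simp_all add: x_def adj_smult adj_add adj_one)
  have "nrm A (sub \<one> (P b) \<oplus> sub \<one> (P c)) \<le> 1 + 1"
    using nrm_add[of "sub \<one> (P b)" "sub \<one> (P c)"] one[OF b s(2)] one[OF c s(3)] P b c unfolding P_def[symmetric] by simp
  then have "nrm A x \<le> 1" using P b c by (simp add: x_def nrm_smult)
  then obtain d where d: "d \<in> carrier A" "nrm A (sub (sub \<one> x) (adj A d \<otimes> d)) < e / (2 * s\<^sup>2)"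
    using approx_sqrt[OF x, of "e / (2 * s\<^sup>2)"] e s by auto
  have "\<one> = (1/2) \<odot> (\<one> \<oplus> \<one>)"
    using smult_add_left[of \<one> "1/2" "1/2"] by (simp add: smult_add)
  then have "sub \<one> x = (1/2) \<odot> sub (\<one> \<oplus> \<one>) (sub \<one> (P b) \<oplus> sub \<one> (P c))"
    using P b c by (simp add: x_def smult_add smult_smult)
  also have "sub (\<one> \<oplus> \<one>) (sub \<one> (P b) \<oplus> sub \<one> (P c)) = sub \<one> (sub \<one> (P b)) \<oplus> sub \<one> (sub \<one> (P c))"
    using P b c by (intro sub_add) auto
  also have "\<dots> = P b \<oplus> P c"
  proof -
    have "sub \<one> (sub \<one> a) = a" if "a \<in> carrier A" for a
      using sub_add_cancel[of \<one> \<zero> "(-1) \<odot> a"] that by (simp add: smult_smult)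
    then show ?thesis using P b c by simp
  qed
  finally have eq: "sub \<one> x = (1/2) \<odot> (P b \<oplus> P c)" .
  \<comment> \<open>Scaling \<open>d\<close> by \<open>r\<close> multiplies its square, and with it
    the error, by \<open>2 s\<^sup>2\<close>; the tolerance \<open>e / (2 s\<^sup>2)\<close> was
    chosen for this.\<close>
  define r where "r = sqrt 2 * s"
  have r2: "r\<^sup>2 = 2 * s\<^sup>2" by (simp add: r_def power_mult_distrib)
  let ?d = "complex_of_real r \<odot> d"
  have "complex_of_real (r\<^sup>2) \<odot> sub (sub \<one> x) (adj A d \<otimes> d) = sub (adj A b \<otimes> b \<oplus> adj A c \<otimes> c) (adj A ?d \<otimes> ?d)"
    unfolding eq sq[OF d(1)] using b c d s
    by (simp add: P_def smult_add smult_smult r2 power_divide)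
  then have "nrm A (sub (adj A b \<otimes> b \<oplus> adj A c \<otimes> c) (adj A ?d \<otimes> ?d)) = 2 * s\<^sup>2 * nrm A (sub (sub \<one> x) (adj A d \<otimes> d))"
    using nrm_smult[of "sub (sub \<one> x) (adj A d \<otimes> d)" "complex_of_real (r\<^sup>2)"] x d r2
    by (simp add: norm_mult norm_power)
  also have "\<dots> < e" using d(2) s by (simp add: field_simps)
  finally show ?thesis using d(1) by blast
qed

end

text \<open>Definiteness of the norm holds in each standard algebra but is lost for standard parts
  of norms, so it is kept apart from \<open>star_seminorm\<close>.\<close>

locale star_functional = star_seminorm A f
  for A :: "('a, 'm) cstar_scheme" (structure) and f :: "'a \<Rightarrow> complex" +
  assumes nrm_eq_0: "a \<in> carrier A \<Longrightarrow> nrm A a = 0 \<Longrightarrow> a = \<zero>"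
begin

text \<open>Polarisation against the unit, \<open>4 t a = \<Sum> c (a + c t 1)\<^sup>* (a + c t 1)\<close> over the fourth roots of unity
  \<open>c\<close>, applied with \<open>t = \<parallel>a\<parallel>\<close>.\<close>

lemma polarisation:
  assumes a: "a \<in> carrier A"
  shows "\<exists>b. (\<forall>i. b i \<in> carrier A \<and> nrm A (adj A (b i) \<otimes> b i) \<le> 4 * nrm A a) \<and>
    f a = (\<Sum>i<4::nat. \<i> ^ i * f (adj A (b i) \<otimes> b i)) / 4"
proof (cases "nrm A a = 0")
  case True
  then have "a = \<zero>" using nrm_eq_0 a by blast
  have z: "adj A \<zero> \<otimes> \<zero> = \<zero>"
  proof -
    have "nrm A \<zero> = 0" using True \<open>a = \<zero>\<close> by simp
    then have "nrm A (adj A \<zero> \<otimes> \<zero>) \<le> 0" using nrm_mult[of "adj A \<zero>" \<zero>] by simp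
    then show ?thesis using nrm_eq_0 nrm_nonneg by (meson antisym closed)
  qed
  show ?thesis
    by (rule exI[of _ "\<lambda>_. \<zero>"]) (simp add: z \<open>a = \<zero>\<close> f_zero True[unfolded \<open>a = \<zero>\<close>])
next
  case False
  define t where "t = nrm A a"
  have t: "t > 0" using False nrm_nonneg[OF a] by (simp add: t_def)
  \<comment> \<open>Both \<open>a\<close> and \<open>t 1\<close> have norm at most \<open>t\<close>;
    after division by \<open>s\<close>, where \<open>s\<^sup>2 = t\<close>, their combinations
    \<open>b i\<close> have norm at most \<open>2 s\<close>, and the squares at most
    \<open>4 t\<close>.\<close>
  define s where "s = complex_of_real (sqrt t)"
  have s: "s \<noteq> 0" "cnj s = s" "s * s = complex_of_real t" "cmod s * cmod s = t"
    using t by (auto simp: s_def simp flip: of_real_mult)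
  define b where "b i = inverse s \<odot> (a \<oplus> (\<i> ^ i * complex_of_real t) \<odot> \<one>)" for i :: nat
  have b: "b i \<in> carrier A" for i using a by (simp add: b_def)
  have nb: "nrm A (b i) \<le> 2 * cmod s" for i
  proof -
    have "nrm A (a \<oplus> (\<i> ^ i * complex_of_real t) \<odot> \<one>) \<le> t + cmod (\<i> ^ i * complex_of_real t) * nrm A \<one>"
      using nrm_add[OF a, of "(\<i> ^ i * complex_of_real t) \<odot> \<one>"] by (simp add: nrm_smult t_def)
    also have "\<dots> \<le> t + t"
      using t nrm_one mult_left_le[of "nrm A \<one>" t] by (simp add: norm_mult norm_power)
    finally have "inverse (cmod s) * nrm A (a \<oplus> (\<i> ^ i * complex_of_real t) \<odot> \<one>) \<le> inverse (cmod s) * (t + t)"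
      by (intro mult_left_mono) auto
    also have "\<dots> = 2 * cmod s" using s(1) by (simp flip: s(4))
    finally show ?thesis using a by (simp add: b_def nrm_smult norm_inverse)
  qed
  have "nrm A (adj A (b i) \<otimes> b i) \<le> 4 * t" for i
  proof -
    have "nrm A (adj A (b i) \<otimes> b i) \<le> nrm A (b i) * nrm A (b i)"
      using nrm_mult[of "adj A (b i)" "b i"] nrm_adj[of "b i"] b[of i]
      by (meson closed(6) mult_right_mono nrm_nonneg order_trans)
    also have "\<dots> \<le> (2 * cmod s) * (2 * cmod s)"
      using nb[of i] b[of i] by (intro mult_mono) auto
    also have "\<dots> = 4 * t" using s(4) by simp
    finally show ?thesis .
  qed
  moreover have "f a = (\<Sum>i<4::nat. \<i> ^ i * f (adj A (b i) \<otimes> b i)) / 4"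
  proof -
    let ?F = "\<lambda>i. f (adj A (b i) \<otimes> b i)"
    have F0: "?F i = inverse (complex_of_real t) * (f (adj A a \<otimes> a) + (\<i> ^ i * complex_of_real t) * f (adj A a)
        + cnj (\<i> ^ i * complex_of_real t) * f a + cnj (\<i> ^ i * complex_of_real t) * (\<i> ^ i * complex_of_real t) * f \<one>)" for i
      using a s by (simp add: b_def adj_smult adj_add mult_smult mult_add smult_smult smult_add adj_one f_add f_smult
          flip: s(3)) (simp add: field_simps)
    have F: "complex_of_real t * ?F i = f (adj A a \<otimes> a) + \<i> ^ i * complex_of_real t * f (adj A a)
        + (-\<i>) ^ i * complex_of_real t * f a + (-\<i>) ^ i * \<i> ^ i * (complex_of_real t)\<^sup>2 * f \<one>" for i
      unfolding F0 using t by (simp add: power2_eq_square field_simps)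
    have "complex_of_real t * (\<Sum>i<4::nat. \<i> ^ i * ?F i) = (\<Sum>i<4::nat. \<i> ^ i * (complex_of_real t * ?F i))"
      by (simp add: sum_distrib_left mult_ac)
    \<comment> \<open>Multiplied by \<open>\<i> ^ i\<close>, the four terms carry
      \<open>\<i> ^ i\<close>, \<open>(-1) ^ i\<close>, 1 and \<open>\<i> ^ i\<close>; only the
      third, that of \<open>f a\<close>, has a nonzero sum over the four indices.\<close>
    also have "\<dots> = complex_of_real t * (4 * f a)"
      unfolding F by (simp add: eval_nat_numeral algebra_simps)
    finally show ?thesis using t by simp
  qed
  ultimately show ?thesis using b unfolding t_def by blast
qed

end

section \<open>Norms and bounded operators on a Hilbert space\<close>

locale hilbert =
  fixes H :: "('h, 'm) ip_space_scheme" (structure)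
  assumes H: "complex_hilbert_space H"
begin

sublocale module complex_ring H
  using H by (simp add: complex_hilbert_space_def)

lemma scale_simps [simp]:
  "x \<in> carrier H \<Longrightarrow> c \<odot> x \<in> carrier H"
  "x \<in> carrier H \<Longrightarrow> 1 \<odot> x = x"
  using smult_closed[of c x] smult_one[of x] by (auto simp: complex_ring_def)

lemma scale_laws:
  "x \<in> carrier H \<Longrightarrow> (c + d) \<odot> x = c \<odot> x \<oplus> d \<odot> x"
  "x \<in> carrier H \<Longrightarrow> y \<in> carrier H \<Longrightarrow> c \<odot> (x \<oplus> y) = c \<odot> x \<oplus> c \<odot> y"
  "x \<in> carrier H \<Longrightarrow> c \<odot> (d \<odot> x) = (c * d) \<odot> x"
  using smult_l_distr[of c d x] smult_r_distr[of c x y] smult_assoc1[of c d x] by (auto simp: complex_ring_def)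

lemma scale_0 [simp]: "x \<in> carrier H \<Longrightarrow> 0 \<odot> x = \<zero>"
  using smult_l_null[of x] by (simp add: complex_ring_def)

lemma scale_zero [simp]: "c \<odot> \<zero> = \<zero>"
  using smult_r_null[of c] by (simp add: complex_ring_def)

lemma neg_add [simp]: "x \<in> carrier H \<Longrightarrow> (-1) \<odot> x \<oplus> x = \<zero>"
  using scale_laws(1)[of x "-1" 1] by simp

lemma ip_add: "x \<in> carrier H \<Longrightarrow> y \<in> carrier H \<Longrightarrow> z \<in> carrier H \<Longrightarrow> ip H (x \<oplus> y) z = ip H x z + ip H y z"
  and ip_scale: "x \<in> carrier H \<Longrightarrow> y \<in> carrier H \<Longrightarrow> ip H (c \<odot> x) y = c * ip H x y"
  and ip_cnj: "x \<in> carrier H \<Longrightarrow> y \<in> carrier H \<Longrightarrow> ip H y x = cnj (ip H x y)"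
  and ip_nonneg: "x \<in> carrier H \<Longrightarrow> 0 \<le> Re (ip H x x)"
  and ip_eq_0: "x \<in> carrier H \<Longrightarrow> ip H x x = 0 \<Longrightarrow> x = \<zero>"
  using H unfolding complex_hilbert_space_def by blast+

lemma ip_add2: "x \<in> carrier H \<Longrightarrow> y \<in> carrier H \<Longrightarrow> z \<in> carrier H \<Longrightarrow> ip H z (x \<oplus> y) = ip H z x + ip H z y"
  using ip_cnj[of "x \<oplus> y" z] ip_cnj[of x z] ip_cnj[of y z] ip_add[of x y z] by simp

lemma ip_scale2: "x \<in> carrier H \<Longrightarrow> y \<in> carrier H \<Longrightarrow> ip H y (c \<odot> x) = cnj c * ip H y x"
  using ip_cnj[of "c \<odot> x" y] ip_cnj[of x y] ip_scale[of x y c] by simp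

lemma ip_zero: "x \<in> carrier H \<Longrightarrow> ip H \<zero> x = 0" "x \<in> carrier H \<Longrightarrow> ip H x \<zero> = 0"
  using ip_scale[of \<zero> x 0] ip_scale2[of \<zero> x 0] by auto

lemma ip_self: 
  assumes "x \<in> carrier H" shows "ip H x x = complex_of_real ((hnorm H x)\<^sup>2)"
  using ip_cnj[OF assms assms] ip_nonneg[OF assms] by (auto simp: hnorm_def complex_eq_iff)

lemma hnorm_nonneg [simp]: "x \<in> carrier H \<Longrightarrow> 0 \<le> hnorm H x"
  using ip_nonneg by (simp add: hnorm_def)

lemma hnorm_zero [simp]: "hnorm H \<zero> = 0"
  by (simp add: hnorm_def ip_zero)

lemma hnorm_eq_0: "x \<in> carrier H \<Longrightarrow> hnorm H x = 0 \<Longrightarrow> x = \<zero>"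
  using ip_self ip_eq_0 by simp

lemma hnorm_scale: "x \<in> carrier H \<Longrightarrow> hnorm H (c \<odot> x) = cmod c * hnorm H x"
proof -
  assume x: "x \<in> carrier H"
  have "complex_of_real ((hnorm H (c \<odot> x))\<^sup>2) = ip H (c \<odot> x) (c \<odot> x)"
    using x by (simp add: ip_self)
  also have "\<dots> = (c * cnj c) * ip H x x"
    using x by (simp add: ip_scale ip_scale2)
  also have "\<dots> = complex_of_real ((cmod c * hnorm H x)\<^sup>2)"
    unfolding power_mult_distrib of_real_mult complex_norm_square ip_self[OF x] ..
  finally have "(hnorm H (c \<odot> x))\<^sup>2 = (cmod c * hnorm H x)\<^sup>2" by (simp only: of_real_eq_iff)
  then show ?thesis
    using x by (simp add: power2_eq_iff_nonneg)
qed

lemma Cauchy_Schwarz: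
  assumes x: "x \<in> carrier H" and y: "y \<in> carrier H"
  shows "cmod (ip H x y) \<le> hnorm H x * hnorm H y"
proof (cases "hnorm H y = 0")
  case True
  then show ?thesis using hnorm_eq_0[OF y] x by (simp add: ip_zero)
next
  case False
  define n where "n = (hnorm H y)\<^sup>2"
  have n: "n > 0" using False by (simp add: n_def)
  \<comment> \<open>The scalar that minimises the norm of \<open>x + u y\<close>.\<close>
  define u where "u = - ip H x y / complex_of_real n"
  have "ip H (x \<oplus> u \<odot> y) (x \<oplus> u \<odot> y) = 
    ip H x x + cnj u * ip H x y + u * cnj (ip H x y) + u * cnj u * ip H y y"
    using x y ip_cnj[OF x y] by (simp add: ip_add ip_add2 ip_scale ip_scale2 algebra_simps)
  also have "\<dots> = complex_of_real ((hnorm H x)\<^sup>2) + cnj u * ip H x y + u * cnj (ip H x y) + u * cnj u * complex_of_real n"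
    by (simp only: ip_self[OF x] ip_self[OF y] n_def)
  also have "\<dots> = complex_of_real ((hnorm H x)\<^sup>2) - ip H x y * cnj (ip H x y) / complex_of_real n"
    using n by (simp add: u_def field_simps)
  also have "\<dots> = complex_of_real ((hnorm H x)\<^sup>2 - (cmod (ip H x y))\<^sup>2 / n)"
    by (simp add: complex_norm_square[symmetric])
  finally have "0 \<le> (hnorm H x)\<^sup>2 - (cmod (ip H x y))\<^sup>2 / n"
    using ip_nonneg[of "x \<oplus> u \<odot> y"] x y by simp
  then have "(cmod (ip H x y))\<^sup>2 \<le> (hnorm H x * hnorm H y)\<^sup>2"
    using n by (simp add: field_simps n_def)
  then show ?thesis using x y by (simp add: power2_le_iff_abs_le)
qed

lemma hnorm_add:
  assumes x: "x \<in> carrier H" and y: "y \<in> carrier H"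
  shows "hnorm H (x \<oplus> y) \<le> hnorm H x + hnorm H y"
proof -
  have "complex_of_real ((hnorm H (x \<oplus> y))\<^sup>2) = ip H (x \<oplus> y) (x \<oplus> y)"
    using x y by (simp add: ip_self)
  also have "\<dots> = ip H x x + (ip H x y + cnj (ip H x y)) + ip H y y"
    using x y ip_cnj[OF x y] by (simp add: ip_add ip_add2)
  also have "\<dots> = complex_of_real ((hnorm H x)\<^sup>2) + (ip H x y + cnj (ip H x y)) + complex_of_real ((hnorm H y)\<^sup>2)"
    by (simp only: ip_self[OF x] ip_self[OF y])
  also have "\<dots> = complex_of_real ((hnorm H x)\<^sup>2 + 2 * Re (ip H x y) + (hnorm H y)\<^sup>2)"
    by (simp add: complex_add_cnj)
  finally have "(hnorm H (x \<oplus> y))\<^sup>2 = (hnorm H x)\<^sup>2 + 2 * Re (ip H x y) + (hnorm H y)\<^sup>2"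
    by (simp only: of_real_eq_iff)
  also have "\<dots> \<le> (hnorm H x + hnorm H y)\<^sup>2"
    using complex_Re_le_cmod[of "ip H x y"] Cauchy_Schwarz[OF x y] by (simp add: power2_sum)
  finally show ?thesis using x y by (simp add: power2_le_iff_abs_le)
qed

lemma opnorm_bound:
  assumes T: "bounded_operator H T" and x: "x \<in> carrier H"
  shows "hnorm H (T x) \<le> opnorm H T * hnorm H x" and "0 \<le> opnorm H T"
proof -
  let ?S = "{hnorm H (T x) | x. x \<in> carrier H \<and> hnorm H x \<le> 1}"
  obtain B where B: "\<And>x. x \<in> carrier H \<Longrightarrow> hnorm H (T x) \<le> B * hnorm H x"
    using T unfolding bounded_operator_def by blast
  \<comment> \<open>\<open>B\<close> may be negative if the space is trivial, hence the absolute
    value.\<close>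
  have "hnorm H (T x) \<le> \<bar>B\<bar>" if "x \<in> carrier H" "hnorm H x \<le> 1" for x
  proof -
    have "B * hnorm H x \<le> \<bar>B\<bar> * 1" using that by (intro mult_mono) auto
    then show ?thesis using B[OF that(1)] by simp
  qed
  then have bdd: "bdd_above ?S" by (intro bdd_aboveI[of _ "\<bar>B\<bar>"]) auto
  have T0: "T \<zero> = \<zero>"
    using T unfolding bounded_operator_def by (metis scale_0 zero_closed)
  have le: "hnorm H (T x) \<le> opnorm H T" if "x \<in> carrier H" "hnorm H x \<le> 1" for x
    unfolding opnorm_def by (rule cSup_upper[OF _ bdd]) (use that in blast)
  show "0 \<le> opnorm H T" using le[of \<zero>] T0 by simp
  show "hnorm H (T x) \<le> opnorm H T * hnorm H x"
  proof (cases "hnorm H x = 0")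
    case True
    then show ?thesis using hnorm_eq_0[OF x] T0 by simp
  next
    case False
    define c where "c = complex_of_real (inverse (hnorm H x))"
    have "hnorm H (c \<odot> x) = 1" using False x by (simp add: hnorm_scale c_def norm_inverse)
    then have "hnorm H (T (c \<odot> x)) \<le> opnorm H T" using le x by simp
    moreover have "T (c \<odot> x) = c \<odot> T x" "T x \<in> carrier H" using T x unfolding bounded_operator_def by blast+
    ultimately have "cmod c * hnorm H (T x) \<le> opnorm H T" by (simp add: hnorm_scale)
    moreover have "cmod c = inverse (hnorm H x)" "hnorm H x > 0"
      using False hnorm_nonneg[OF x] by (auto simp: c_def norm_inverse)
    ultimately show ?thesis by (simp add: field_simps)
  qed
qed

lemma opnorm_le:
  assumes "0 \<le> B" "\<And>x. x \<in> carrier H \<Longrightarrow> hnorm H (T x) \<le> B * hnorm H x"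
  shows "opnorm H T \<le> B"
  unfolding opnorm_def
proof (rule cSup_least)
  have "hnorm H (T \<zero>) \<in> {hnorm H (T x) | x. x \<in> carrier H \<and> hnorm H x \<le> 1}" using hnorm_zero by fastforce
  then show "{hnorm H (T x) | x. x \<in> carrier H \<and> hnorm H x \<le> 1} \<noteq> {}" by blast
next
  fix r assume "r \<in> {hnorm H (T x) | x. x \<in> carrier H \<and> hnorm H x \<le> 1}"
  then obtain x where x: "x \<in> carrier H" "hnorm H x \<le> 1" "r = hnorm H (T x)" by blast
  then have "r \<le> B * hnorm H x" using assms by simp
  also have "\<dots> \<le> B * 1" using x assms by (intro mult_mono) auto
  finally show "r \<le> B" by simp
qed

end

text \<open>By \<open>ext\<close> an object of \<open>BH\<close> is determined by the values of its
  operator, so the algebraic laws are checked vector by vector; those for the involution follow from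
  uniqueness of the adjoint, and the norm inequalities from bounds on the operator norm.\<close>

lemma operator_algebra_star_functional:
  fixes H :: "('h, 'm) ip_space_scheme" and A :: "('a, 'n) cstar_scheme"
  assumes H: "complex_hilbert_space H" and A: "operator_cstar_algebra H BH ev A"
    and BH: "\<And>T. T \<in> BH \<Longrightarrow> bounded_operator H (ev T)"
    and ext: "\<And>a b. a \<in> BH \<Longrightarrow> b \<in> BH \<Longrightarrow> (\<And>x. x \<in> carrier H \<Longrightarrow> ev a x = ev b x) \<Longrightarrow> a = b"
    and w: "weight_extension A w f"
  shows "star_functional A f"
proof -
  interpret H: hilbert H by unfold_locales fact
  let ?C = "carrier A" and ?E = "carrier H"
  have sub: "?C \<subseteq> BH" and zero: "\<zero>\<^bsub>A\<^esub> \<in> ?C" "\<And>x. x \<in> ?E \<Longrightarrow> ev \<zero>\<^bsub>A\<^esub> x = \<zero>\<^bsub>H\<^esub>"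
    and one: "\<one>\<^bsub>A\<^esub> \<in> ?C" "\<And>a. a \<in> ?C \<Longrightarrow> \<one>\<^bsub>A\<^esub> \<otimes>\<^bsub>A\<^esub> a = a" "\<And>a. a \<in> ?C \<Longrightarrow> a \<otimes>\<^bsub>A\<^esub> \<one>\<^bsub>A\<^esub> = a"
    and add: "\<And>a b. a \<in> ?C \<Longrightarrow> b \<in> ?C \<Longrightarrow> a \<oplus>\<^bsub>A\<^esub> b \<in> ?C"
      "\<And>a b x. a \<in> ?C \<Longrightarrow> b \<in> ?C \<Longrightarrow> x \<in> ?E \<Longrightarrow> ev (a \<oplus>\<^bsub>A\<^esub> b) x = ev a x \<oplus>\<^bsub>H\<^esub> ev b x"
    and scale: "\<And>a c. a \<in> ?C \<Longrightarrow> c \<odot>\<^bsub>A\<^esub> a \<in> ?C"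
      "\<And>a c x. a \<in> ?C \<Longrightarrow> x \<in> ?E \<Longrightarrow> ev (c \<odot>\<^bsub>A\<^esub> a) x = c \<odot>\<^bsub>H\<^esub> ev a x"
    and mult: "\<And>a b. a \<in> ?C \<Longrightarrow> b \<in> ?C \<Longrightarrow> a \<otimes>\<^bsub>A\<^esub> b \<in> ?C"
      "\<And>a b x. a \<in> ?C \<Longrightarrow> b \<in> ?C \<Longrightarrow> x \<in> ?E \<Longrightarrow> ev (a \<otimes>\<^bsub>A\<^esub> b) x = ev a (ev b x)"
    and adj: "\<And>a. a \<in> ?C \<Longrightarrow> adj A a \<in> ?C"
      "\<And>a x y. a \<in> ?C \<Longrightarrow> x \<in> ?E \<Longrightarrow> y \<in> ?E \<Longrightarrow> ip H (ev a x) y = ip H x (ev (adj A a) y)"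
    and nrm: "\<And>a. a \<in> ?C \<Longrightarrow> nrm A a = opnorm H (ev a)"
    using A unfolding operator_cstar_algebra_def by simp_all
  have bo: "bounded_operator H (ev a)" if "a \<in> ?C" for a using that sub BH by blast
  have lin: "a \<in> ?C \<Longrightarrow> x \<in> ?E \<Longrightarrow> ev a x \<in> ?E"
    "a \<in> ?C \<Longrightarrow> x \<in> ?E \<Longrightarrow> y \<in> ?E \<Longrightarrow> ev a (x \<oplus>\<^bsub>H\<^esub> y) = ev a x \<oplus>\<^bsub>H\<^esub> ev a y"
    "a \<in> ?C \<Longrightarrow> x \<in> ?E \<Longrightarrow> ev a (c \<odot>\<^bsub>H\<^esub> x) = c \<odot>\<^bsub>H\<^esub> ev a x" for a x y c
    using bo unfolding bounded_operator_def by blast+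
  note ops = zero one add scale mult adj(1) lin
  have eqI: "a = b" if "a \<in> ?C" "b \<in> ?C" "\<And>x. x \<in> ?E \<Longrightarrow> ev a x = ev b x" for a b
    using that sub by (intro ext) auto
  have adj2: "ip H y (ev a x) = ip H (ev (adj A a) y) x" if "a \<in> ?C" "x \<in> ?E" "y \<in> ?E" for a x y
    using adj(2)[OF that] H.ip_cnj that ops by metis
  \<comment> \<open>The difference of the two candidates at \<open>y\<close> is orthogonal to every
    vector, in particular to itself.\<close>
  have adj_eqI: "adj A a = b" if ab: "a \<in> ?C" "b \<in> ?C"
    and eq: "\<And>x y. x \<in> ?E \<Longrightarrow> y \<in> ?E \<Longrightarrow> ip H (ev a x) y = ip H x (ev b y)" for a b
  proof (rule eqI)
    fix y assume y: "y \<in> ?E"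
    let ?u = "ev (adj A a) y" and ?v = "ev b y"
    let ?d = "?u \<oplus>\<^bsub>H\<^esub> (-1) \<odot>\<^bsub>H\<^esub> ?v"
    have u: "?u \<in> ?E" and v: "?v \<in> ?E" using y ab ops by auto
    then have "ip H ?d ?d = ip H ?d ?u - ip H ?d ?v" by (simp add: H.ip_add2 H.ip_scale2)
    also have "\<dots> = 0" using adj(2)[OF ab(1) _ y, of ?d] eq[OF _ y, of ?d] u v by simp
    finally have "?d = \<zero>\<^bsub>H\<^esub>" using H.ip_eq_0 u v by simp
    then have "?v = ?d \<oplus>\<^bsub>H\<^esub> ?v" using v by simp
    also have "\<dots> = ?u" using u v by (simp add: H.a_assoc)
    finally show "?u = ?v" by simp
  qed (use ab ops in auto)
  have nb: "hnorm H (ev a x) \<le> nrm A a * hnorm H x" "0 \<le> nrm A a" if "a \<in> ?C" "x \<in> ?E" for a x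
    using H.opnorm_bound[OF bo that(2)] that by (auto simp: nrm)
  have nonneg: "0 \<le> nrm A a" if "a \<in> ?C" for a using nb(2)[OF that H.zero_closed] .
  have nle: "nrm A a \<le> B" if "a \<in> ?C" "0 \<le> B" "\<And>x. x \<in> ?E \<Longrightarrow> hnorm H (ev a x) \<le> B * hnorm H x" for a B
    using H.opnorm_le[of B "ev a"] that by (simp add: nrm)
  have smult_le: "nrm A (c \<odot>\<^bsub>A\<^esub> a) \<le> cmod c * nrm A a" if a: "a \<in> ?C" for a c
  proof (rule nle)
    fix x assume x: "x \<in> ?E"
    then have "hnorm H (ev (c \<odot>\<^bsub>A\<^esub> a) x) = cmod c * hnorm H (ev a x)"
      using a ops by (simp add: H.hnorm_scale)
    also have "\<dots> \<le> cmod c * (nrm A a * hnorm H x)" using nb[OF a x] by (intro mult_left_mono) auto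
    finally show "hnorm H (ev (c \<odot>\<^bsub>A\<^esub> a) x) \<le> cmod c * nrm A a * hnorm H x" by (simp add: mult_ac)
  qed (use a ops nonneg in auto)
  have scale_scale: "c \<odot>\<^bsub>A\<^esub> (d \<odot>\<^bsub>A\<^esub> a) = (c * d) \<odot>\<^bsub>A\<^esub> a" if "a \<in> ?C" for a c d
    by (rule eqI) (use that ops in \<open>simp_all add: H.scale_laws\<close>)
  have scale1: "1 \<odot>\<^bsub>A\<^esub> a = a" if "a \<in> ?C" for a
    by (rule eqI) (use that ops in simp_all)
  have adj_adj: "adj A (adj A a) = a" if "a \<in> ?C" for a
    by (rule adj_eqI) (use that ops adj2 in \<open>simp_all\<close>)
  have adj_mult: "adj A (a \<otimes>\<^bsub>A\<^esub> b) = adj A b \<otimes>\<^bsub>A\<^esub> adj A a" if "a \<in> ?C" "b \<in> ?C" for a b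
    by (rule adj_eqI) (use that ops adj(2) in simp_all)
  have adj_one: "adj A \<one>\<^bsub>A\<^esub> = \<one>\<^bsub>A\<^esub>"
    using adj_mult[of "adj A \<one>\<^bsub>A\<^esub>" "\<one>\<^bsub>A\<^esub>"] adj_adj[of "\<one>\<^bsub>A\<^esub>"] ops by simp
  have star: "(nrm A a)\<^sup>2 \<le> nrm A (adj A a \<otimes>\<^bsub>A\<^esub> a)" if a: "a \<in> ?C" for a
  proof -
    let ?B = "nrm A (adj A a \<otimes>\<^bsub>A\<^esub> a)"
    have B: "0 \<le> ?B" using a ops nonneg by simp
    have "nrm A a \<le> sqrt ?B"
    proof (rule nle)
      fix x assume x: "x \<in> ?E"
      have "ip H x (ev (adj A a \<otimes>\<^bsub>A\<^esub> a) x) = ip H (ev a x) (ev a x)"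
        using a x ops adj(2)[of a x "ev a x"] by simp
      also have "\<dots> = complex_of_real ((hnorm H (ev a x))\<^sup>2)" using a x ops by (intro H.ip_self)
      finally have "(hnorm H (ev a x))\<^sup>2 = cmod (ip H x (ev (adj A a \<otimes>\<^bsub>A\<^esub> a) x))"
        by (simp only: norm_of_real abs_of_nonneg[OF zero_le_power2])
      also have "\<dots> \<le> hnorm H x * hnorm H (ev (adj A a \<otimes>\<^bsub>A\<^esub> a) x)"
        using a x ops by (intro H.Cauchy_Schwarz) auto
      also have "\<dots> \<le> hnorm H x * (?B * hnorm H x)"
        by (intro mult_left_mono nb(1) H.hnorm_nonneg) (use a x ops in auto)
      also have "\<dots> = (sqrt ?B * hnorm H x)\<^sup>2" using B by (simp add: power_mult_distrib power2_eq_square)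
      finally show "hnorm H (ev a x) \<le> sqrt ?B * hnorm H x"
        by (rule power2_le_imp_le) (use H.hnorm_nonneg[OF x] B in simp)
    qed (use a B in auto)
    then have "(nrm A a)\<^sup>2 \<le> (sqrt ?B)\<^sup>2" using nonneg[OF a] by (intro power_mono) auto
    then show ?thesis using B by simp
  qed
  have mult_le: "nrm A (a \<otimes>\<^bsub>A\<^esub> b) \<le> nrm A a * nrm A b" if "a \<in> ?C" "b \<in> ?C" for a b
  proof (rule nle)
    fix x assume x: "x \<in> ?E"
    have "hnorm H (ev (a \<otimes>\<^bsub>A\<^esub> b) x) \<le> nrm A a * hnorm H (ev b x)"
      using that x ops nb(1)[of a "ev b x"] by simp
    also have "\<dots> \<le> nrm A a * (nrm A b * hnorm H x)"
      by (intro mult_left_mono nb(1) nonneg that x)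
    finally show "hnorm H (ev (a \<otimes>\<^bsub>A\<^esub> b) x) \<le> nrm A a * nrm A b * hnorm H x" by (simp add: mult_ac)
  qed (use that ops nonneg in auto)
  have adj_le: "nrm A (adj A a) \<le> nrm A a" if a: "a \<in> ?C" for a
  proof -
    have "(nrm A (adj A a))\<^sup>2 \<le> nrm A (a \<otimes>\<^bsub>A\<^esub> adj A a)" using star[of "adj A a"] a ops adj_adj by simp
    also have "\<dots> \<le> nrm A a * nrm A (adj A a)" using a ops mult_le by simp
    finally show ?thesis
      using nonneg[OF a] nonneg[of "adj A a"] a ops by (cases "nrm A (adj A a) = 0") (auto simp: power2_eq_square)
  qed
  have one_le: "nrm A \<one>\<^bsub>A\<^esub> \<le> 1"
  proof -
    have "(nrm A \<one>\<^bsub>A\<^esub>)\<^sup>2 \<le> nrm A \<one>\<^bsub>A\<^esub>" using star[of "\<one>\<^bsub>A\<^esub>"] adj_one ops by simp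
    then show ?thesis using nonneg[OF one(1)]
      by (cases "nrm A \<one>\<^bsub>A\<^esub> = 0") (auto simp: power2_eq_square)
  qed
  have wpos: "adj A a \<otimes>\<^bsub>A\<^esub> a \<in> cpos A" if "a \<in> ?C" for a using that unfolding cpos_def by blast
  show ?thesis
  proof
    fix a assume a: "a \<in> ?C" and "nrm A a = 0"
    then show "a = \<zero>\<^bsub>A\<^esub>"
      using nb[OF a] H.hnorm_eq_0 a ops H.hnorm_nonneg by (intro eqI) (auto intro!: H.hnorm_eq_0 antisym)
  next
    fix b assume b: "b \<in> ?C" and "nrm A b < 1"
    then have b1: "nrm A b \<le> 1" by simp
    let ?s = "adj A b \<otimes>\<^bsub>A\<^esub> b"
    show "nrm A (\<one>\<^bsub>A\<^esub> \<oplus>\<^bsub>A\<^esub> (-1) \<odot>\<^bsub>A\<^esub> ?s) \<le> 1"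
    proof (rule nle)
      fix v assume v: "v \<in> ?E"
      \<comment> \<open>The unit of \<open>A\<close> may be a proper projection, so \<open>v\<close>
        is replaced by its image \<open>u\<close> under the unit; \<open>b\<close> takes the same
        value at both.\<close>
      define u where "u = ev \<one>\<^bsub>A\<^esub> v"
      have u: "u \<in> ?E" using v ops by (simp add: u_def)
      have bu: "ev b v = ev b u" using mult(2)[OF b one(1) v] one(3)[OF b] by (simp add: u_def)
      define w where "w = ev b u"
      have w: "w \<in> ?E" "ev (adj A b) w \<in> ?E" using u b ops by (auto simp: w_def)
      have e: "ev (\<one>\<^bsub>A\<^esub> \<oplus>\<^bsub>A\<^esub> (-1) \<odot>\<^bsub>A\<^esub> ?s) v = u \<oplus>\<^bsub>H\<^esub> (-1) \<odot>\<^bsub>H\<^esub> ev (adj A b) w"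
        using b v ops by (simp add: bu flip: u_def w_def)
      let ?x = "u \<oplus>\<^bsub>H\<^esub> (-1) \<odot>\<^bsub>H\<^esub> ev (adj A b) w"
      have uw: "ip H u (ev (adj A b) w) = complex_of_real ((hnorm H w)\<^sup>2)"
        using adj(2)[OF b u w(1)] H.ip_self[OF w(1)] by (simp add: w_def)
      \<comment> \<open>With \<open>w = b u\<close> the square of
        \<open>\<parallel>u - b\<^sup>* w\<parallel>\<close> is
        \<open>\<parallel>u\<parallel>\<^sup>2 - 2 \<parallel>w\<parallel>\<^sup>2 +
        \<parallel>b\<^sup>* w\<parallel>\<^sup>2\<close>, and the last term is at most
        \<open>\<parallel>w\<parallel>\<^sup>2\<close>.\<close>
      have "complex_of_real ((hnorm H ?x)\<^sup>2) = ip H ?x ?x" using u w by (simp add: H.ip_self)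
      also have "\<dots> = ip H u u - ip H u (ev (adj A b) w) - cnj (ip H u (ev (adj A b) w))
          + ip H (ev (adj A b) w) (ev (adj A b) w)"
        using u w H.ip_cnj[OF u w(2)] by (simp add: H.ip_add H.ip_add2 H.ip_scale H.ip_scale2)
      also have "\<dots> = complex_of_real ((hnorm H u)\<^sup>2 - 2 * (hnorm H w)\<^sup>2 + (hnorm H (ev (adj A b) w))\<^sup>2)"
        unfolding uw H.ip_self[OF u] H.ip_self[OF w(2)] by simp
      finally have "(hnorm H ?x)\<^sup>2 = (hnorm H u)\<^sup>2 - 2 * (hnorm H w)\<^sup>2 + (hnorm H (ev (adj A b) w))\<^sup>2"
        by (simp only: of_real_eq_iff)
      moreover have "hnorm H (ev (adj A b) w) \<le> 1 * hnorm H w"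
        using nb(1)[OF adj(1)[OF b] w(1)] adj_le[OF b] b1 H.hnorm_nonneg[OF w(1)]
        by (meson mult_right_mono order_trans)
      then have "(hnorm H (ev (adj A b) w))\<^sup>2 \<le> (hnorm H w)\<^sup>2" using H.hnorm_nonneg[OF w(2)] by (intro power_mono) auto
      moreover have "hnorm H u \<le> 1 * hnorm H v"
        using nb(1)[OF one(1) v] one_le H.hnorm_nonneg[OF v] unfolding u_def by (meson mult_right_mono order_trans)
      then have "(hnorm H u)\<^sup>2 \<le> (hnorm H v)\<^sup>2" using H.hnorm_nonneg[OF u] by (intro power_mono) auto
      ultimately have "(hnorm H ?x)\<^sup>2 \<le> (hnorm H v)\<^sup>2" using zero_le_power2[of "hnorm H w"] by linarith
      then show "hnorm H (ev (\<one>\<^bsub>A\<^esub> \<oplus>\<^bsub>A\<^esub> (-1) \<odot>\<^bsub>A\<^esub> ?s) v) \<le> 1 * hnorm H v"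
        unfolding e mult_1 by (rule power2_le_imp_le) (rule H.hnorm_nonneg[OF v])
    qed (use b ops in auto)
  next
    fix a c assume a: "a \<in> ?C"
    show "nrm A (c \<odot>\<^bsub>A\<^esub> a) = cmod c * nrm A a"
    proof (rule antisym[OF smult_le[OF a]], cases "c = 0")
      case False
      have "nrm A a \<le> cmod (inverse c) * nrm A (c \<odot>\<^bsub>A\<^esub> a)"
        using smult_le[of "c \<odot>\<^bsub>A\<^esub> a" "inverse c"] a ops scale_scale scale1 False by simp
      then have "cmod c * nrm A a \<le> cmod c * (cmod (inverse c) * nrm A (c \<odot>\<^bsub>A\<^esub> a))"
        by (rule mult_left_mono) simp
      then show "cmod c * nrm A a \<le> nrm A (c \<odot>\<^bsub>A\<^esub> a)"
        using False by (simp add: norm_inverse flip: mult.assoc)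
    qed (use a ops nonneg in simp)
  next
    fix a b assume ab: "a \<in> ?C" "b \<in> ?C"
    show "nrm A (a \<oplus>\<^bsub>A\<^esub> b) \<le> nrm A a + nrm A b"
    proof (rule nle)
      fix x assume x: "x \<in> ?E"
      have "hnorm H (ev (a \<oplus>\<^bsub>A\<^esub> b) x) \<le> hnorm H (ev a x) + hnorm H (ev b x)"
        using ab x ops H.hnorm_add by simp
      also have "\<dots> \<le> nrm A a * hnorm H x + nrm A b * hnorm H x" using ab x nb by (intro add_mono) auto
      finally show "hnorm H (ev (a \<oplus>\<^bsub>A\<^esub> b) x) \<le> (nrm A a + nrm A b) * hnorm H x" by (simp add: algebra_simps)
    qed (use ab ops nonneg in auto)
  next
    fix a assume "a \<in> ?C"
    then show "f (adj A a \<otimes>\<^bsub>A\<^esub> a) = complex_of_real (Re (f (adj A a \<otimes>\<^bsub>A\<^esub> a))) \<and>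
      0 \<le> Re (f (adj A a \<otimes>\<^bsub>A\<^esub> a))"
      using w wpos unfolding weight_extension_def by auto
  next
    fix a b assume "a \<in> ?C" "b \<in> ?C"
    then show "f (a \<oplus>\<^bsub>A\<^esub> b) = f a + f b" using w unfolding weight_extension_def by simp
  next
    fix a c assume "a \<in> ?C"
    then show "f (c \<odot>\<^bsub>A\<^esub> a) = c * f a" using w unfolding weight_extension_def by simp
  next
    fix a b assume "a \<in> ?C" "b \<in> ?C"
    then show "adj A (a \<oplus>\<^bsub>A\<^esub> b) = adj A a \<oplus>\<^bsub>A\<^esub> adj A b"
      by (intro adj_eqI) (use ops adj(2) in \<open>simp_all add: H.ip_add H.ip_add2\<close>)
  next
    fix a c assume "a \<in> ?C"
    then show "adj A (c \<odot>\<^bsub>A\<^esub> a) = cnj c \<odot>\<^bsub>A\<^esub> adj A a"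
      by (intro adj_eqI) (use ops adj(2) in \<open>simp_all add: H.ip_scale H.ip_scale2\<close>)
  qed ((simp add: ops one_le adj_adj adj_mult adj_le mult_le star nonneg scale1 scale_scale; fail |
    (rule eqI; simp add: ops H.scale_laws; fail) | (rule eqI; simp add: ops H.a_ac; fail))+)
qed

lemma (in nsu) standard_star_functional:
  assumes "standard_cstar N h a" "standard_weight N a t"
  shows "star_functional (calg N a) (\<lambda>x. cval N (app (std N) t x))"
proof -
  obtain w where w: "weight_extension (calg N a) w (\<lambda>x. cval N (app (std N) t x))"
    using assms unfolding standard_weight_def by blast
  have H: "complex_hilbert_space (hspace N h)"
    and A: "operator_cstar_algebra (hspace N h) (bounded_operators N h) (app (std N)) (calg N a)"
    using assms unfolding standard_cstar_def standard_hilbert_def Let_def by auto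
  show ?thesis
  proof (rule operator_algebra_star_functional[OF H A _ _ w])
    fix T assume "T \<in> bounded_operators N h"
    then show "bounded_operator (hspace N h) (app (std N) T)" unfolding bounded_operators_def by simp
  next
    fix F G assume FG: "F \<in> bounded_operators N h" "G \<in> bounded_operators N h"
      and eq: "\<And>x. x \<in> carrier (hspace N h) \<Longrightarrow> app (std N) F x = app (std N) G x"
    let ?E = "elts (std N) (hcar h)"
    have F: "func (std N) F ?E ?E" and G: "func (std N) G ?E ?E"
      using FG unfolding bounded_operators_def by auto
    \<comment> \<open>A function object has no elements besides the pairs of a point and its value,
      so equal values give equal element sets and, by extensionality, the same object.\<close>
    have *: "elts (std N) T = {opair (std N) x (app (std N) T x) | x. x \<in> ?E}" if T: "func (std N) T ?E ?E" for T
    proof -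
      show ?thesis
      proof (intro equalityI subsetI)
        fix p assume p: "p \<in> elts (std N) T"
        then have "p \<in> cart (std N) ?E ?E" using T unfolding func_def by blast
        then obtain x y where "p = opair (std N) x y" "x \<in> ?E" unfolding cart_def by auto
        then show "p \<in> {opair (std N) x (app (std N) T x) | x. x \<in> ?E}" using app_mem[OF T] p by auto
      qed (use app_mem[OF T] in auto)
    qed
    have "elts (std N) F = elts (std N) G"
      unfolding *[OF F] *[OF G] using eq by (auto simp: hspace_def)
    then show "F = G" using F G S.mkset_elts unfolding func_def by metis
  qed
qed

section \<open>Representing internal elements by families of standard elements\<close>

context nsu
begin

lemma bg_opairD:
  assumes "bg z (\<lambda>k. opair (std N) (f k) (g k))"
  shows "bg z f" "bg z g"
proof -
  obtain A n where A: "bdd (std N) A" "z \<in> st A" "(\<lambda>k. opair (std N) (f k) (g k)) ` A \<subseteq> level (std N) n"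
    using assms unfolding bg_def bdd_def[of _ "_ ` _"] by blast
  then have "f ` A \<subseteq> level (std N) n" "g ` A \<subseteq> level (std N) n"
    using S.opair_components_level by blast+
  then show "bg z f" "bg z g" using A(1,2) unfolding bg_def bdd_def[of _ "_ ` _"] by blast+
qed

lemma germ_opairD:
  assumes "bg z (\<lambda>k. opair (std N) (f k) (g k))" "germ z (\<lambda>k. opair (std N) (f k) (g k)) = opair (nst N) a b"
  shows "bg z f" "bg z g" "germ z f = a" "germ z g = b"
  using bg_opairD[OF assms(1)] germ_opair[OF bg_opairD[OF assms(1)]] assms(2) by auto

text \<open>Levels are transitive, so a family of elements of bounded objects is bounded, however
  its members are chosen.\<close>

lemma bg_mem:
  assumes g: "bg z g" and "eventually (\<lambda>k. mem (std N) (x k) (g k)) (ult z)"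
  shows "bg z x"
proof -
  obtain A where A: "bdd (std N) A" "z \<in> st A" "bdd (std N) (g ` A)" "\<And>k. k \<in> A \<Longrightarrow> mem (std N) (x k) (g k)"
    using bg_witness[OF assms] by blast
  obtain n where n: "g ` A \<subseteq> level (std N) n" using A(3) unfolding bdd_def by blast
  have "x ` A \<subseteq> level (std N) n"
  proof
    fix y assume "y \<in> x ` A"
    then obtain k where k: "k \<in> A" "y = x k" by blast
    then have "y \<in> elts (std N) (g k)" using A(4) by (simp add: elts_def)
    then show "y \<in> level (std N) n" using S.elts_level n k(1) by blast
  qed
  then have "bdd (std N) (x ` A)" unfolding bdd_def by blast
  then show ?thesis using A(1,2) unfolding bg_def by blast
qed

lemma bg_cong:
  assumes g: "bg z g" and "eventually (\<lambda>k. g k = h k) (ult z)"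
  shows "bg z h"
proof -
  obtain A where A: "bdd (std N) A" "z \<in> st A" "bdd (std N) (g ` A)" "\<And>k. k \<in> A \<Longrightarrow> g k = h k"
    using bg_witness[OF assms] by blast
  then have "h ` A = g ` A" by auto
  then show ?thesis using A(1-3) unfolding bg_def by metis
qed

lemma internal_instD:
  assumes "internal_inst N P x"
  shows "intern x" "eventually P (ult x)"
proof -
  obtain K where K: "K \<notin> indiv (std N)" "\<forall>k\<in>elts (std N) K. P k" "x \<in> elts (nst N) (star N K)"
    using assms unfolding internal_inst_def by blast
  then have x: "x \<in> st (elts (std N) K)" by (simp add: st_def S.mkset_elts)
  then show "intern x" unfolding intern_def using S.bdd_elts by blast
  show "eventually P (ult x)" using eventually_ultI[OF S.bdd_elts x] K(2) by blast
qed

text \<open>Enlarging the base point from \<open>z\<close> to the pair of \<open>z\<close> and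
  \<open>y\<close>: families over \<open>z\<close> are pulled back along the first projection with
  the same germs and the same truths, and \<open>y\<close> becomes the germ of the second
  projection.\<close>

lemma extend:
  assumes z: "intern z" and y: "intern y"
  shows "intern (opair (nst N) z y)"
    and "bg z f \<Longrightarrow> bg (opair (nst N) z y) (\<lambda>k. f (S.ofst k))"
    and "bg z f \<Longrightarrow> germ (opair (nst N) z y) (\<lambda>k. f (S.ofst k)) = germ z f"
    and "eventually (\<lambda>k. P (S.ofst k)) (ult (opair (nst N) z y)) \<longleftrightarrow> eventually P (ult z)"
    and "bg (opair (nst N) z y) S.osnd"
    and "germ (opair (nst N) z y) S.osnd = y"
proof -
  show i: "intern (opair (nst N) z y)" using intern_opair[OF z y] .
  note p = germ_projections[OF i]
  show "bg z f \<Longrightarrow> bg (opair (nst N) z y) (\<lambda>k. f (S.ofst k))"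
    using bg_comp[OF p(1), of f] p(3) by simp
  show "bg z f \<Longrightarrow> germ (opair (nst N) z y) (\<lambda>k. f (S.ofst k)) = germ z f"
    using germ_germ[OF p(1), of f] p(3) by simp
  show "eventually (\<lambda>k. P (S.ofst k)) (ult (opair (nst N) z y)) \<longleftrightarrow> eventually P (ult z)"
    using ult_germ[OF p(1), of P] p(3) by simp
  show "bg (opair (nst N) z y) S.osnd" "germ (opair (nst N) z y) S.osnd = y" using p by auto
qed

lemma germ_app:
  assumes f: "bg z f" and x: "bg z x"
    and func: "eventually (\<lambda>k. func (std N) (f k) (D k) (E k)) (ult z)"
    and D: "eventually (\<lambda>k. x k \<in> D k) (ult z)"
  shows "bg z (\<lambda>k. app (std N) (f k) (x k))"
    and "app (nst N) (germ z f) (germ z x) = germ z (\<lambda>k. app (std N) (f k) (x k))"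
proof -
  let ?a = "\<lambda>k. app (std N) (f k) (x k)"
  have iff: "eventually (\<lambda>k. \<forall>y. mem (std N) (opair (std N) (x k) y) (f k) \<longleftrightarrow> y = ?a k) (ult z)"
    using func D
  proof eventually_elim
    case (elim k)
    show ?case using app_mem[OF elim] by (simp add: elts_def)
  qed
  then have m: "eventually (\<lambda>k. mem (std N) (opair (std N) (x k) (?a k)) (f k)) (ult z)"
    by (rule eventually_mono) simp
  show a: "bg z ?a" using bg_opairD(2)[OF bg_mem[OF f m]] .
  show "app (nst N) (germ z f) (germ z x) = germ z ?a"
    unfolding app_def[of "nst N"]
  proof (rule the_equality)
    show "opair (nst N) (germ z x) (germ z ?a) \<in> elts (nst N) (germ z f)"
      using m mem_germ_iff[OF bg_opair[OF x a] f] germ_opair[OF x a] by (simp add: elts_def)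
  next
    \<comment> \<open>A value \<open>y\<close> of the internal function is not yet known to be a
      germ over \<open>z\<close>, so it is compared with the candidate over the larger base
      point.\<close>
    fix y assume y: "opair (nst N) (germ z x) y \<in> elts (nst N) (germ z f)"
    then have "intern y" using intern_elt[OF intern_germ[OF f]] intern_opair_iff by blast
    note e = extend[OF bg_intern[OF f] this]
    let ?z = "opair (nst N) z y"
    have "mem (nst N) (germ ?z (\<lambda>k. opair (std N) (x (S.ofst k)) (S.osnd k))) (germ ?z (\<lambda>k. f (S.ofst k)))"
      using y germ_opair[OF e(2)[OF x] e(5)] e(3)[OF f] e(3)[OF x] e(6) by (simp add: elts_def)
    then have "eventually (\<lambda>k. mem (std N) (opair (std N) (x (S.ofst k)) (S.osnd k)) (f (S.ofst k))) (ult ?z)"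
      using mem_germ_iff[OF bg_opair[OF e(2)[OF x] e(5)] e(2)[OF f]] by simp
    moreover have "eventually (\<lambda>k. \<forall>y. mem (std N) (opair (std N) (x (S.ofst k)) y) (f (S.ofst k)) \<longleftrightarrow> y = ?a (S.ofst k)) (ult ?z)"
      using iff e(4)[of "\<lambda>k. \<forall>y. mem (std N) (opair (std N) (x k) y) (f k) \<longleftrightarrow> y = ?a k"] by simp
    ultimately have "eventually (\<lambda>k. S.osnd k = ?a (S.ofst k)) (ult ?z)"
      by eventually_elim simp
    then have "germ ?z S.osnd = germ ?z (\<lambda>k. ?a (S.ofst k))" using germ_cong[OF e(5) e(2)[OF a]] by blast
    then show "y = germ z ?a" using e(6) e(3)[OF a] by simp
  qed
qed

lemma germ_app2:
  assumes f: "bg z f" and x: "bg z x" and y: "bg z y"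
    and func: "eventually (\<lambda>k. func (std N) (f k) (cart (std N) (C k) (D k)) (E k)) (ult z)"
    and D: "eventually (\<lambda>k. x k \<in> C k) (ult z)" "eventually (\<lambda>k. y k \<in> D k) (ult z)"
  shows "bg z (\<lambda>k. app2 (std N) (f k) (x k) (y k))"
    and "app2 (nst N) (germ z f) (germ z x) (germ z y) = germ z (\<lambda>k. app2 (std N) (f k) (x k) (y k))"
proof -
  have "eventually (\<lambda>k. opair (std N) (x k) (y k) \<in> cart (std N) (C k) (D k)) (ult z)"
    using D by eventually_elim (auto simp: cart_def)
  from germ_app[OF f bg_opair[OF x y] func this] germ_opair[OF x y]
  show "bg z (\<lambda>k. app2 (std N) (f k) (x k) (y k))"
    "app2 (nst N) (germ z f) (germ z x) (germ z y) = germ z (\<lambda>k. app2 (std N) (f k) (x k) (y k))"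
    by (simp_all add: app2_def)
qed

lemma atuple_inject: "atuple (std N) a = atuple (std N) b \<longleftrightarrow> a = b"
  by (cases a; cases b) (simp add: atuple_def)

end

section \<open>Internal algebras as germs of families of standard algebras\<close>

locale internal_algebra = nsu N for N :: "('u, 'v) nonstd" +
  fixes H :: "'v hcode" and M :: "'v acode" and \<theta> :: 'v
  assumes alg: "internal_cstar N H M" and wt: "internal_weight N M \<theta>"
begin

abbreviation std_alg :: "'u acode \<Rightarrow> 'u \<Rightarrow> bool" where
  "std_alg a t \<equiv> (\<exists>h. standard_cstar N h a) \<and> standard_weight N a t"

abbreviation fn :: "'u \<Rightarrow> 'u \<Rightarrow> complex" where
  "fn t x \<equiv> cval N (app (std N) t x)"

lemma std_alg_star: "std_alg a t \<Longrightarrow> star_functional (calg N a) (fn t)"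
  using standard_star_functional by blast

lemma std_alg_seminorm: "std_alg a t \<Longrightarrow> star_seminorm (calg N a) (fn t)"
  using std_alg_star star_functional.axioms(1) by blast

text \<open>Over the base point \<open>z\<close> the internal algebra and its weight are germs of
  standard algebras \<open>A k\<close> with functionals \<open>t k\<close>. The whole tuple is taken
  as one germ, which bounds all eight fields at once.\<close>

definition repr :: "'v \<Rightarrow> ('u \<Rightarrow> 'u acode) \<Rightarrow> ('u \<Rightarrow> 'u) \<Rightarrow> bool" where
  "repr z A t \<longleftrightarrow> bg z (\<lambda>k. atuple (std N) (A k)) \<and> germ z (\<lambda>k. atuple (std N) (A k)) = atuple (nst N) M \<and>
     bg z t \<and> germ z t = \<theta> \<and> eventually (\<lambda>k. std_alg (A k) (t k)) (ult z)"

lemma repr_fields: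
  assumes "repr z A t"
  shows "bg z (\<lambda>k. acar (A k)) \<and> germ z (\<lambda>k. acar (A k)) = acar M" (is ?r1)
    "bg z (\<lambda>k. aadd (A k)) \<and> germ z (\<lambda>k. aadd (A k)) = aadd M" (is ?r2)
    "bg z (\<lambda>k. azero (A k)) \<and> germ z (\<lambda>k. azero (A k)) = azero M" (is ?r3)
    "bg z (\<lambda>k. aone (A k)) \<and> germ z (\<lambda>k. aone (A k)) = aone M" (is ?r4)
    "bg z (\<lambda>k. ascale (A k)) \<and> germ z (\<lambda>k. ascale (A k)) = ascale M" (is ?r5)
    "bg z (\<lambda>k. amult (A k)) \<and> germ z (\<lambda>k. amult (A k)) = amult M" (is ?r6)
    "bg z (\<lambda>k. aadj (A k)) \<and> germ z (\<lambda>k. aadj (A k)) = aadj M" (is ?r7)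
    "bg z (\<lambda>k. anorm (A k)) \<and> germ z (\<lambda>k. anorm (A k)) = anorm M" (is ?r8)
proof -
  have 1: "bg z (\<lambda>k. atuple (std N) (A k))" "germ z (\<lambda>k. atuple (std N) (A k)) = atuple (nst N) M"
    using assms unfolding repr_def by auto
  note 2 = germ_opairD[OF 1[unfolded atuple_def]]
  note 3 = germ_opairD[OF 2(2,4)]
  note 4 = germ_opairD[OF 3(2,4)]
  note 5 = germ_opairD[OF 4(2,4)]
  note 6 = germ_opairD[OF 5(2,4)]
  note 7 = germ_opairD[OF 6(2,4)]
  note 8 = germ_opairD[OF 7(2,4)]
  show ?r1 using 2 by blast
  show ?r2 using 3 by blast
  show ?r3 using 4 by blast
  show ?r4 using 5 by blast
  show ?r5 using 6 by blast
  show ?r6 using 7 by blast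
  show ?r7 using 8 by blast
  show ?r8 using 8 by blast
qed

lemma repr_intern: "repr z A t \<Longrightarrow> intern z"
  unfolding repr_def using bg_intern by blast

lemma repr_ev: "repr z A t \<Longrightarrow> eventually (\<lambda>k. std_alg (A k) (t k)) (ult z)"
  unfolding repr_def by blast

text \<open>The algebra and the weight are internal instances over two separate base points. Over
  the pair of these the two families of algebra tuples have the same germ, so they agree almost
  everywhere and each standard weight lives on the algebra of its index.\<close>

lemma repr_exists: "\<exists>z A t. repr z A t"
proof -
  let ?p = "opair (nst N) (htuple (nst N) H) (atuple (nst N) M)" and ?q = "opair (nst N) (atuple (nst N) M) \<theta>"
  let ?z = "opair (nst N) ?p ?q"
  have p: "intern ?p" "eventually (\<lambda>k. \<exists>h a. k = opair (std N) (htuple (std N) h) (atuple (std N) a) \<and> standard_cstar N h a) (ult ?p)"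
    using internal_instD[OF alg[unfolded internal_cstar_def]] by auto
  have q: "intern ?q" "eventually (\<lambda>k. \<exists>a t. k = opair (std N) (atuple (std N) a) t \<and> standard_weight N a t) (ult ?q)"
    using internal_instD[OF wt[unfolded internal_weight_def]] by auto
  note pp = germ_projections[OF p(1)] and qq = germ_projections[OF q(1)]
  have z: "intern ?z" using p q intern_opair by blast
  note zz = germ_projections[OF z]
  let ?a = "\<lambda>k. S.osnd (S.ofst k)" and ?b = "\<lambda>k. S.ofst (S.osnd k)" and ?t = "\<lambda>k. S.osnd (S.osnd k)"
  have a: "bg ?z ?a" "germ ?z ?a = atuple (nst N) M"
    using bg_comp[OF zz(1), of S.osnd] germ_germ[OF zz(1), of S.osnd] zz(3) pp by auto
  have b: "bg ?z ?b" "germ ?z ?b = atuple (nst N) M"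
    using bg_comp[OF zz(2), of S.ofst] germ_germ[OF zz(2), of S.ofst] zz(4) qq by auto
  have t: "bg ?z ?t" "germ ?z ?t = \<theta>"
    using bg_comp[OF zz(2), of S.osnd] germ_germ[OF zz(2), of S.osnd] zz(4) qq by auto
  have "eventually (\<lambda>k. ?a k = ?b k) (ult ?z)" using germ_eq_iff[OF a(1) b(1)] a(2) b(2) by simp
  moreover have "eventually (\<lambda>k. \<exists>h a. S.ofst k = opair (std N) (htuple (std N) h) (atuple (std N) a) \<and> standard_cstar N h a) (ult ?z)"
    using p(2) ult_germ[OF zz(1)] zz(3) by simp
  moreover have "eventually (\<lambda>k. \<exists>a t. S.osnd k = opair (std N) (atuple (std N) a) t \<and> standard_weight N a t) (ult ?z)"
    using q(2) ult_germ[OF zz(2)] zz(4) by simp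
  ultimately have ev: "eventually (\<lambda>k. \<exists>a. ?a k = atuple (std N) a \<and> std_alg a (?t k)) (ult ?z)"
  proof eventually_elim
    case (elim k)
    then obtain h a a' t where "S.ofst k = opair (std N) (htuple (std N) h) (atuple (std N) a)" "standard_cstar N h a"
      "S.osnd k = opair (std N) (atuple (std N) a') t" "standard_weight N a' t" by blast
    then show ?case using elim(1) by (auto simp: atuple_inject)
  qed
  define A where "A k = (SOME a. ?a k = atuple (std N) a)" for k
  have ev: "eventually (\<lambda>k. ?a k = atuple (std N) (A k) \<and> std_alg (A k) (?t k)) (ult ?z)"
    using ev
  proof eventually_elim
    case (elim k)
    then obtain a where a: "?a k = atuple (std N) a" "std_alg a (?t k)" by blast
    then have "A k = a" unfolding A_def by (auto simp: atuple_inject)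
    then show ?case using a by simp
  qed
  then have eq: "eventually (\<lambda>k. ?a k = atuple (std N) (A k)) (ult ?z)" by (rule eventually_mono) simp
  have "repr ?z A ?t"
    unfolding repr_def using bg_cong[OF a(1) eq] germ_cong[OF a(1) bg_cong[OF a(1) eq] eq] a(2) t ev
    by (auto elim: eventually_mono)
  then show ?thesis by blast
qed

definition elem :: "'v \<Rightarrow> ('u \<Rightarrow> 'u acode) \<Rightarrow> ('u \<Rightarrow> 'u) \<Rightarrow> 'v \<Rightarrow> bool" where
  "elem z A x a \<longleftrightarrow> bg z x \<and> germ z x = a \<and> eventually (\<lambda>k. x k \<in> carrier (calg N (A k))) (ult z)"

lemma carrier_calg: "x \<in> carrier (calg N a) \<longleftrightarrow> mem (std N) x (acar a)"
  by (simp add: calg_def elts_def)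

lemma elem_ev: "elem z A x a \<Longrightarrow> eventually (\<lambda>k. x k \<in> carrier (calg N (A k))) (ult z)"
  unfolding elem_def by blast

lemma elem_in:
  assumes r: "repr z A t" and x: "elem z A x a"
  shows "a \<in> elts (nst N) (acar M)"
  using mem_germ_iff[of z x "\<lambda>k. acar (A k)"] repr_fields(1)[OF r] x
  by (auto simp: elem_def carrier_calg elts_def)

text \<open>Any pointwise selection of algebra elements has a germ; families obtained by the choice
  operator thereby yield internal elements.\<close>

lemma elemI:
  assumes r: "repr z A t" and x: "eventually (\<lambda>k. x k \<in> carrier (calg N (A k))) (ult z)"
  shows "elem z A x (germ z x)"
  using bg_mem[of z "\<lambda>k. acar (A k)" x] repr_fields(1)[OF r] x by (simp add: elem_def carrier_calg)

lemma elem_eq_iff: "elem z A x a \<Longrightarrow> elem z A y b \<Longrightarrow> a = b \<longleftrightarrow> eventually (\<lambda>k. x k = y k) (ult z)"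
  unfolding elem_def using germ_eq_iff[of z x y] by auto

lemma repr_extend:
  assumes r: "repr z A t" and y: "intern y"
  shows "repr (opair (nst N) z y) (\<lambda>k. A (S.ofst k)) (\<lambda>k. t (S.ofst k))"
  using r extend(2,3)[OF repr_intern[OF r] y, of t] extend(2,3)[OF repr_intern[OF r] y, of "\<lambda>k. atuple (std N) (A k)"]
    extend(4)[OF repr_intern[OF r] y, of "\<lambda>k. std_alg (A k) (t k)"]
  unfolding repr_def by simp

lemma elem_extend:
  assumes x: "elem z A x a" and y: "intern y"
  shows "elem (opair (nst N) z y) (\<lambda>k. A (S.ofst k)) (\<lambda>k. x (S.ofst k)) a"
proof -
  have z: "intern z" using x bg_intern unfolding elem_def by blast
  show ?thesis
    using x extend(2,3)[OF z y, of x] extend(4)[OF z y, of "\<lambda>k. x k \<in> carrier (calg N (A k))"]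
    unfolding elem_def by simp
qed

lemma elem_new:
  assumes r: "repr z A t" and a: "a \<in> elts (nst N) (acar M)"
  shows "intern a" "elem (opair (nst N) z a) (\<lambda>k. A (S.ofst k)) S.osnd a"
proof -
  note f = repr_fields(1)[OF r]
  show i: "intern a" using intern_elt[of "acar M" a] intern_germ[of z "\<lambda>k. acar (A k)"] f a by simp
  note e = extend[OF repr_intern[OF r] i]
  have "mem (nst N) (germ (opair (nst N) z a) S.osnd) (germ (opair (nst N) z a) (\<lambda>k. acar (A (S.ofst k))))"
    using a e(6) e(3)[of "\<lambda>k. acar (A k)"] f by (simp add: elts_def)
  then have "eventually (\<lambda>k. mem (std N) (S.osnd k) (acar (A (S.ofst k)))) (ult (opair (nst N) z a))"
    using mem_germ_iff[OF e(5) e(2)[of "\<lambda>k. acar (A k)"]] f by simp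
  then show "elem (opair (nst N) z a) (\<lambda>k. A (S.ofst k)) S.osnd a"
    unfolding elem_def carrier_calg using e by simp
qed

text \<open>Each further element enlarges the base point by one pairing, and the families found
  before are pulled back.\<close>

lemma representation:
  assumes "set as \<subseteq> elts (nst N) (acar M)"
  shows "\<exists>z A t xs. repr z A t \<and> list_all2 (elem z A) xs as"
  using assms
proof (induction as)
  case Nil
  then show ?case using repr_exists by blast
next
  case (Cons a as)
  then obtain z A t xs where r: "repr z A t" and xs: "list_all2 (elem z A) xs as" by auto
  have a: "a \<in> elts (nst N) (acar M)" using Cons by simp
  note n = elem_new[OF r a]
  have "list_all2 (elem (opair (nst N) z a) (\<lambda>k. A (S.ofst k))) (map (\<lambda>x k. x (S.ofst k)) xs) as"
    using xs elem_extend[OF _ n(1)] by (simp add: list_all2_map1) (auto elim: list_all2_mono)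
  then have "list_all2 (elem (opair (nst N) z a) (\<lambda>k. A (S.ofst k))) (S.osnd # map (\<lambda>x k. x (S.ofst k)) xs) (a # as)"
    using n(2) by simp
  then show ?case using repr_extend[OF r n(1)] by blast
qed

lemma std_func:
  assumes "std_alg a t"
  shows "func (std N) (aadd a) (cart (std N) (carrier (calg N a)) (carrier (calg N a))) (carrier (calg N a))" (is ?f0)
    "func (std N) (ascale a) (cart (std N) (range (cnum N)) (carrier (calg N a))) (carrier (calg N a))" (is ?f1)
    "func (std N) (amult a) (cart (std N) (carrier (calg N a)) (carrier (calg N a))) (carrier (calg N a))" (is ?f2)
    "func (std N) (aadj a) (carrier (calg N a)) (carrier (calg N a))" (is ?f3)
    "func (std N) (anorm a) (carrier (calg N a)) {cnum N (complex_of_real r) | r. True}" (is ?f4)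
    "func (std N) t (carrier (calg N a)) (range (cnum N))" (is ?f5)
proof -
  have C: "carrier (calg N a) = elts (std N) (acar a)" by (simp add: calg_def)
  obtain h where "standard_cstar N h a" using assms by blast
  then show ?f0 ?f1 ?f2 ?f3 ?f4
    unfolding C standard_cstar_def Let_def by blast+
  show ?f5
    using assms unfolding C standard_weight_def by blast
qed

context
  fixes z A t assumes r: "repr z A t"
begin

lemma ev_func:
  "eventually (\<lambda>k. func (std N) (aadd (A k)) (cart (std N) (carrier (calg N (A k))) (carrier (calg N (A k)))) (carrier (calg N (A k)))) (ult z)"
  "eventually (\<lambda>k. func (std N) (ascale (A k)) (cart (std N) (range (cnum N)) (carrier (calg N (A k)))) (carrier (calg N (A k)))) (ult z)"
  "eventually (\<lambda>k. func (std N) (amult (A k)) (cart (std N) (carrier (calg N (A k))) (carrier (calg N (A k)))) (carrier (calg N (A k)))) (ult z)"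
  "eventually (\<lambda>k. func (std N) (aadj (A k)) (carrier (calg N (A k))) (carrier (calg N (A k)))) (ult z)"
  "eventually (\<lambda>k. func (std N) (anorm (A k)) (carrier (calg N (A k))) {cnum N (complex_of_real r) | r. True}) (ult z)"
  "eventually (\<lambda>k. func (std N) (t k) (carrier (calg N (A k))) (range (cnum N))) (ult z)"
  by (rule eventually_mono[OF repr_ev[OF r]], erule std_func)+

lemma elem_zero: "elem z A (\<lambda>k. \<zero>\<^bsub>calg N (A k)\<^esub>) (azero M)"
  and elem_one: "elem z A (\<lambda>k. \<one>\<^bsub>calg N (A k)\<^esub>) (aone M)"
proof -
  have "eventually (\<lambda>k. star_seminorm (calg N (A k)) (fn (t k))) (ult z)"
    using repr_ev[OF r] by (rule eventually_mono) (rule std_alg_seminorm)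
  then have "eventually (\<lambda>k. \<zero>\<^bsub>calg N (A k)\<^esub> \<in> carrier (calg N (A k))) (ult z)"
    "eventually (\<lambda>k. \<one>\<^bsub>calg N (A k)\<^esub> \<in> carrier (calg N (A k))) (ult z)"
    by (auto elim!: eventually_mono simp: star_seminorm.closed)
  then show "elem z A (\<lambda>k. \<zero>\<^bsub>calg N (A k)\<^esub>) (azero M)" "elem z A (\<lambda>k. \<one>\<^bsub>calg N (A k)\<^esub>) (aone M)"
    using repr_fields(3,4)[OF r] unfolding elem_def by (simp_all add: calg_def)
qed

lemma elem_add:
  assumes x: "elem z A x a" and y: "elem z A y b"
  shows "elem z A (\<lambda>k. x k \<oplus>\<^bsub>calg N (A k)\<^esub> y k) (app2 (nst N) (aadd M) a b)"
proof -
  have "eventually (\<lambda>k. x k \<oplus>\<^bsub>calg N (A k)\<^esub> y k \<in> carrier (calg N (A k))) (ult z)"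
    using repr_ev[OF r] elem_ev[OF x] elem_ev[OF y]
    by eventually_elim (metis std_alg_seminorm star_seminorm.closed(3))
  then show ?thesis
    using germ_app2[of z "\<lambda>k. aadd (A k)" x y, OF _ _ _ ev_func(1)] repr_fields(2)[OF r] x y
    by (simp add: elem_def) (simp add: calg_def)
qed

lemma elem_mult:
  assumes x: "elem z A x a" and y: "elem z A y b"
  shows "elem z A (\<lambda>k. x k \<otimes>\<^bsub>calg N (A k)\<^esub> y k) (app2 (nst N) (amult M) a b)"
proof -
  have "eventually (\<lambda>k. x k \<otimes>\<^bsub>calg N (A k)\<^esub> y k \<in> carrier (calg N (A k))) (ult z)"
    using repr_ev[OF r] elem_ev[OF x] elem_ev[OF y]
    by eventually_elim (metis std_alg_seminorm star_seminorm.closed(4))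
  then show ?thesis
    using germ_app2[of z "\<lambda>k. amult (A k)" x y, OF _ _ _ ev_func(3)] repr_fields(6)[OF r] x y
    by (simp add: elem_def) (simp add: calg_def)
qed

text \<open>The scalar may vary with the index; infinitesimal scalars of this kind are used to show
  that the weight is bounded.\<close>

lemma elem_smult_germ:
  assumes x: "elem z A x a"
  shows "elem z A (\<lambda>k. c k \<odot>\<^bsub>calg N (A k)\<^esub> x k) (app2 (nst N) (ascale M) (germ z (\<lambda>k. cnum N (c k))) a)"
proof -
  have "eventually (\<lambda>k. c k \<odot>\<^bsub>calg N (A k)\<^esub> x k \<in> carrier (calg N (A k))) (ult z)"
    using repr_ev[OF r] elem_ev[OF x]
    by eventually_elim (metis std_alg_seminorm star_seminorm.closed(5))
  then show ?thesis
    using germ_app2[of z "\<lambda>k. ascale (A k)" "\<lambda>k. cnum N (c k)" x, OF _ _ _ ev_func(2)] repr_fields(5)[OF r] x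
      repr_intern[OF r]
    by (simp add: elem_def) (simp add: calg_def)
qed

lemma elem_smult:
  "elem z A x a \<Longrightarrow> elem z A (\<lambda>k. c \<odot>\<^bsub>calg N (A k)\<^esub> x k) (app2 (nst N) (ascale M) (scx N c) a)"
  using elem_smult_germ[of x a "\<lambda>_. c"] scx_germ[OF repr_intern[OF r]] by simp

lemma elem_adj:
  assumes x: "elem z A x a"
  shows "elem z A (\<lambda>k. adj (calg N (A k)) (x k)) (app (nst N) (aadj M) a)"
proof -
  have "eventually (\<lambda>k. adj (calg N (A k)) (x k) \<in> carrier (calg N (A k))) (ult z)"
    using repr_ev[OF r] elem_ev[OF x]
    by eventually_elim (metis std_alg_seminorm star_seminorm.closed(6))
  then show ?thesis
    using germ_app[of z "\<lambda>k. aadj (A k)" x, OF _ _ ev_func(4)] repr_fields(7)[OF r] x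
    by (simp add: elem_def) (simp add: calg_def)
qed

lemma inorm_germ:
  assumes x: "elem z A x a"
  shows "inorm N M a = germ z (\<lambda>k. cnum N (complex_of_real (nrm (calg N (A k)) (x k))))"
proof -
  have f: "bg z (\<lambda>k. app (std N) (anorm (A k)) (x k))"
    "inorm N M a = germ z (\<lambda>k. app (std N) (anorm (A k)) (x k))"
    using germ_app[of z "\<lambda>k. anorm (A k)" x, OF _ _ ev_func(5)] repr_fields(8)[OF r] x
    by (simp_all add: elem_def inorm_def)
  have "eventually (\<lambda>k. app (std N) (anorm (A k)) (x k) = cnum N (complex_of_real (nrm (calg N (A k)) (x k)))) (ult z)"
    using ev_func(5) elem_ev[OF x]
  proof eventually_elim
    case (elim k)
    from app_in[OF S.V elim] show ?case by (auto simp: calg_def)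
  qed
  then show ?thesis unfolding f(2) by (intro germ_cong f(1) bg_cnum repr_intern[OF r])
qed

lemma theta_germ:
  assumes x: "elem z A x a"
  shows "app (nst N) \<theta> a = germ z (\<lambda>k. cnum N (fn (t k) (x k)))"
proof -
  have t: "bg z t" "germ z t = \<theta>" using r unfolding repr_def by auto
  have f: "bg z (\<lambda>k. app (std N) (t k) (x k))"
    "app (nst N) \<theta> a = germ z (\<lambda>k. app (std N) (t k) (x k))"
    using germ_app[of z t x, OF _ _ ev_func(6)] t x by (simp_all add: elem_def)
  have "eventually (\<lambda>k. app (std N) (t k) (x k) = cnum N (fn (t k) (x k))) (ult z)"
    using ev_func(6) elem_ev[OF x]
  proof eventually_elim
    case (elim k)
    from app_in[OF S.V elim] show ?case by auto
  qed
  then show ?thesis unfolding f(2) by (intro germ_cong f(1) bg_cnum repr_intern[OF r])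
qed

end

end

section \<open>The seminormed algebra of finite elements\<close>

locale scontinuous_weight = internal_algebra +
  assumes scont: "S_continuous N M \<theta>"
begin

definition nn :: "'b \<Rightarrow> real" where "nn a = Re (stdpart N (inorm N M a))"
definition tt :: "'b \<Rightarrow> complex" where "tt a = stdpart N (app (nst N) \<theta> a)"

text \<open>The hull is the quotient of this algebra by the null space of its seminorm.\<close>

definition FA :: "'b cstar" where
  "FA = \<lparr>carrier = Fin N M, monoid.mult = app2 (nst N) (amult M), one = aone M, zero = azero M,
     add = app2 (nst N) (aadd M), smult = (\<lambda>c. app2 (nst N) (ascale M) (scx N c)),
     adj = app (nst N) (aadj M), nrm = nn\<rparr>"

lemma FA_simps:
  "carrier FA = Fin N M" "a \<otimes>\<^bsub>FA\<^esub> b = app2 (nst N) (amult M) a b" "\<one>\<^bsub>FA\<^esub> = aone M" "\<zero>\<^bsub>FA\<^esub> = azero M"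
  "a \<oplus>\<^bsub>FA\<^esub> b = app2 (nst N) (aadd M) a b" "c \<odot>\<^bsub>FA\<^esub> a = app2 (nst N) (ascale M) (scx N c) a"
  "adj FA a = app (nst N) (aadj M) a" "nrm FA a = nn a"
  by (simp_all add: FA_def)

lemma ev_star: "repr z A t \<Longrightarrow> eventually (\<lambda>k. star_functional (calg N (A k)) (fn (t k))) (ult z)"
  by (drule repr_ev, erule eventually_mono, rule std_alg_star)

lemma ev_seminorm: "repr z A t \<Longrightarrow> eventually (\<lambda>k. star_seminorm (calg N (A k)) (fn (t k))) (ult z)"
  by (drule ev_star, erule eventually_mono, rule star_functional.axioms(1))

lemma ev_nonneg:
  assumes "repr z A t" "elem z A x a"
  shows "eventually (\<lambda>k. 0 \<le> nrm (calg N (A k)) (x k)) (ult z)"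
  using ev_seminorm[OF assms(1)] elem_ev[OF assms(2)] by eventually_elim (rule star_seminorm.nrm_nonneg)

lemma Fin_iff:
  assumes r: "repr z A t" and x: "elem z A x a"
  shows "a \<in> Fin N M \<longleftrightarrow> (\<exists>B. eventually (\<lambda>k. nrm (calg N (A k)) (x k) \<le> B) (ult z))"
proof -
  have "eventually (\<lambda>k. cmod (complex_of_real (nrm (calg N (A k)) (x k))) \<le> B) (ult z) \<longleftrightarrow>
    eventually (\<lambda>k. nrm (calg N (A k)) (x k) \<le> B) (ult z)" for B
    using ev_nonneg[OF r x] by (rule eventually_cong) simp
  moreover have "a \<in> Fin N M \<longleftrightarrow> limited N (inorm N M a)" using elem_in[OF r x] by (simp add: Fin_def)
  ultimately show ?thesis unfolding inorm_germ[OF r x] limited_germ[OF repr_intern[OF r]] by simp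
qed

lemma nn_lim:
  assumes r: "repr z A t" and x: "elem z A x a" and a: "a \<in> Fin N M"
  shows "((\<lambda>k. nrm (calg N (A k)) (x k)) \<longlongrightarrow> nn a) (ult z)"
proof -
  note i = repr_intern[OF r]
  have "limited N (inorm N M a)" using a unfolding Fin_def by blast
  then obtain B where "eventually (\<lambda>k. cmod (complex_of_real (nrm (calg N (A k)) (x k))) \<le> B) (ult z)"
    unfolding inorm_germ[OF r x] limited_germ[OF i] by blast
  from ult_convergent[OF i this]
  obtain c where c: "((\<lambda>k. complex_of_real (nrm (calg N (A k)) (x k))) \<longlongrightarrow> c) (ult z)" by blast
  from stdpart_germ[OF i c] have "nn a = Re c" by (simp add: nn_def inorm_germ[OF r x])
  with tendsto_Re[OF c] show ?thesis by simp
qed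

text \<open>Estimates in the standard algebras pass to the finite elements in this form: an
  eventually bounded family of norms has a limit, and limits preserve weak inequalities.\<close>

lemma Fin_le:
  assumes r: "repr z A t" and x: "elem z A x a"
    and le: "eventually (\<lambda>k. nrm (calg N (A k)) (x k) \<le> g k) (ult z)" and g: "(g \<longlongrightarrow> l) (ult z)"
  shows "a \<in> Fin N M" "nn a \<le> l"
proof -
  have "eventually (\<lambda>k. g k < l + 1) (ult z)" using g by (rule order_tendstoD) simp
  with le have "eventually (\<lambda>k. nrm (calg N (A k)) (x k) \<le> l + 1) (ult z)" by eventually_elim simp
  then show a: "a \<in> Fin N M" using Fin_iff[OF r x] by blast
  show "nn a \<le> l" by (rule tendsto_le[OF ult_neq_bot[OF repr_intern[OF r]] g nn_lim[OF r x a] le])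
qed

lemma nn_unique:
  assumes r: "repr z A t" and x: "elem z A x a"
    and g: "((\<lambda>k. nrm (calg N (A k)) (x k)) \<longlongrightarrow> l) (ult z)"
  shows "nn a = l"
  using tendsto_unique[OF ult_neq_bot[OF repr_intern[OF r]] nn_lim[OF r x] g] Fin_le(1)[OF r x _ g] by simp

lemma approx_zero_iff:
  assumes r: "repr z A t" and x: "elem z A x a"
  shows "approx N M a (azero M) \<longleftrightarrow> ((\<lambda>k. nrm (calg N (A k)) (x k)) \<longlongrightarrow> 0) (ult z)"
proof -
  let ?s = "\<lambda>k. x k \<oplus>\<^bsub>calg N (A k)\<^esub> (-1) \<odot>\<^bsub>calg N (A k)\<^esub> \<zero>\<^bsub>calg N (A k)\<^esub>"
  have s: "elem z A ?s (app2 (nst N) (aadd M) a (app2 (nst N) (ascale M) (scx N (-1)) (azero M)))"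
    by (intro elem_add[OF r] elem_smult[OF r] elem_zero[OF r] x)
  have "eventually (\<lambda>k. ?s k = x k) (ult z)"
    using ev_seminorm[OF r] elem_ev[OF x]
    by eventually_elim (metis star_seminorm.add_zero_right star_seminorm.smult_zero(2))
  then have "eventually (\<lambda>k. complex_of_real (nrm (calg N (A k)) (?s k)) = complex_of_real (nrm (calg N (A k)) (x k))) (ult z)"
    by (rule eventually_mono) simp
  then show ?thesis
    unfolding approx_def inorm_germ[OF r s] near_germ_scx[OF repr_intern[OF r]]
    by (subst tendsto_cong) (simp_all flip: tendsto_of_real_iff[where ?'a=complex])
qed

text \<open>S-continuity concerns positive infinitesimals only. Polarisation in each standard
  algebra expresses the value at \<open>x k\<close> by values at four squares of norm at most
  \<open>4 \<parallel>x k\<parallel>\<close>, whose germs are positive and infinitesimal.\<close>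

lemma theta_infinitesimal:
  assumes r: "repr z A t" and x: "elem z A x a"
    and lim: "((\<lambda>k. nrm (calg N (A k)) (x k)) \<longlongrightarrow> 0) (ult z)"
  shows "((\<lambda>k. fn (t k) (x k)) \<longlongrightarrow> 0) (ult z)"
proof -
  let ?sq = "\<lambda>k b. adj (calg N (A k)) b \<otimes>\<^bsub>calg N (A k)\<^esub> b"
  define P where "P k b \<longleftrightarrow> (\<forall>i. b i \<in> carrier (calg N (A k)) \<and> nrm (calg N (A k)) (?sq k (b i)) \<le> 4 * nrm (calg N (A k)) (x k)) \<and>
    fn (t k) (x k) = (\<Sum>i<4::nat. \<i> ^ i * fn (t k) (?sq k (b i))) / 4" for k and b :: "nat \<Rightarrow> 'a"
  have "eventually (\<lambda>k. \<exists>b. P k b) (ult z)"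
    using ev_star[OF r] elem_ev[OF x] unfolding P_def by eventually_elim (rule star_functional.polarisation)
  then have P: "eventually (\<lambda>k. P k (SOME b. P k b)) (ult z)"
  proof (rule eventually_mono)
    fix k assume "\<exists>b. P k b"
    then show "P k (SOME b. P k b)" by (rule someI_ex)
  qed
  define b where "b i k = (SOME b. P k b) i" for i k
  have "((\<lambda>k. fn (t k) (?sq k (b i k))) \<longlongrightarrow> 0) (ult z)" for i
  proof -
    have "eventually (\<lambda>k. b i k \<in> carrier (calg N (A k))) (ult z)"
      using P by (rule eventually_mono) (simp add: P_def b_def)
    from elemI[OF r this] obtain \<beta> where \<beta>: "elem z A (b i) \<beta>" by blast
    let ?p = "app2 (nst N) (amult M) (app (nst N) (aadj M) \<beta>) \<beta>"
    have p: "elem z A (\<lambda>k. ?sq k (b i k)) ?p" by (intro elem_mult[OF r] elem_adj[OF r] \<beta>)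
    have "((\<lambda>k. nrm (calg N (A k)) (?sq k (b i k))) \<longlongrightarrow> 0) (ult z)"
    proof (rule tendsto_sandwich[OF ev_nonneg[OF r p]])
      show "eventually (\<lambda>k. nrm (calg N (A k)) (?sq k (b i k)) \<le> 4 * nrm (calg N (A k)) (x k)) (ult z)"
        using P by (rule eventually_mono) (simp add: P_def b_def)
      show "((\<lambda>k. 4 * nrm (calg N (A k)) (x k)) \<longlongrightarrow> 0) (ult z)" using tendsto_mult_right_zero[OF lim] .
    qed simp
    then have "approx N M ?p (azero M)" using approx_zero_iff[OF r p] by blast
    moreover have "?p \<in> internal_pos N M" using elem_in[OF r \<beta>] unfolding internal_pos_def by blast
    ultimately have "near N (app (nst N) \<theta> ?p) (scx N 0)" using scont unfolding S_continuous_def by blast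
    then show ?thesis unfolding theta_germ[OF r p] near_germ_scx[OF repr_intern[OF r]] .
  qed
  then have "((\<lambda>k. (\<Sum>i<4::nat. \<i> ^ i * fn (t k) (?sq k (b i k))) / 4) \<longlongrightarrow> (\<Sum>i<4::nat. \<i> ^ i * 0) / 4) (ult z)"
    by (intro tendsto_intros) auto
  moreover have "eventually (\<lambda>k. (\<Sum>i<4::nat. \<i> ^ i * fn (t k) (?sq k (b i k))) / 4 = fn (t k) (x k)) (ult z)"
    using P by (rule eventually_mono) (simp add: P_def b_def)
  ultimately show ?thesis using Lim_transform_eventually by fastforce
qed

text \<open>Unbounded values would exceed every bound almost everywhere, so that their inverses
  \<open>c\<close> are infinitesimal. Then \<open>c x\<close> has infinitesimal norm but weight
  1.\<close>

lemma theta_bounded: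
  assumes r: "repr z A t" and x: "elem z A x a" and a: "a \<in> Fin N M"
  shows "\<exists>B. eventually (\<lambda>k. cmod (fn (t k) (x k)) \<le> B) (ult z)"
proof (rule ccontr)
  note i = repr_intern[OF r]
  assume "\<not> ?thesis"
  then have big: "eventually (\<lambda>k. cmod (fn (t k) (x k)) > B) (ult z)" for B
    using ult_not[OF i, of "\<lambda>k. cmod (fn (t k) (x k)) \<le> B"] by (simp add: not_le)
  define c where "c k = inverse (fn (t k) (x k))" for k
  have "filterlim (\<lambda>k. fn (t k) (x k)) at_infinity (ult z)"
    unfolding filterlim_at_infinity[OF order_refl] by (intro allI impI, rule eventually_mono[OF big], erule less_imp_le)
  then have c: "(c \<longlongrightarrow> 0) (ult z)"
    unfolding c_def using filterlim_compose[OF tendsto_inverse_0] by blast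
  note cx = elem_smult_germ[OF r x, of c]
  have "eventually (\<lambda>k. cmod (c k) * nrm (calg N (A k)) (x k) = nrm (calg N (A k)) (c k \<odot>\<^bsub>calg N (A k)\<^esub> x k)) (ult z)"
    using ev_seminorm[OF r] elem_ev[OF x] by eventually_elim (metis star_seminorm.nrm_smult)
  moreover have "((\<lambda>k. cmod (c k) * nrm (calg N (A k)) (x k)) \<longlongrightarrow> 0 * nn a) (ult z)"
    using tendsto_norm[OF c] nn_lim[OF r x a] by (intro tendsto_mult) auto
  ultimately have "((\<lambda>k. nrm (calg N (A k)) (c k \<odot>\<^bsub>calg N (A k)\<^esub> x k)) \<longlongrightarrow> 0) (ult z)"
    using Lim_transform_eventually by fastforce
  from theta_infinitesimal[OF r cx this]
  have L: "((\<lambda>k. fn (t k) (c k \<odot>\<^bsub>calg N (A k)\<^esub> x k)) \<longlongrightarrow> 0) (ult z)" .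
  have E: "eventually (\<lambda>k. fn (t k) (c k \<odot>\<^bsub>calg N (A k)\<^esub> x k) = 1) (ult z)"
    using ev_seminorm[OF r] elem_ev[OF x] big[of 0]
  proof eventually_elim
    case (elim k)
    have "fn (t k) (x k) \<noteq> 0" using elim(3) by auto
    then have "c k * fn (t k) (x k) = 1" by (simp add: c_def)
    then show ?case using star_seminorm.f_smult[OF elim(1,2)] by metis
  qed
  from Lim_transform_eventually[OF L E] show False using ult_neq_bot[OF i] by (simp add: tendsto_const_iff)
qed

lemma tt_lim:
  assumes r: "repr z A t" and x: "elem z A x a" and a: "a \<in> Fin N M"
  shows "((\<lambda>k. fn (t k) (x k)) \<longlongrightarrow> tt a) (ult z)"
proof -
  note i = repr_intern[OF r]
  obtain B where "eventually (\<lambda>k. cmod (fn (t k) (x k)) \<le> B) (ult z)" using theta_bounded[OF assms] by blast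
  from ult_convergent[OF i this] obtain c where c: "((\<lambda>k. fn (t k) (x k)) \<longlongrightarrow> c) (ult z)" by blast
  from stdpart_germ[OF i c] have "tt a = c" by (simp add: tt_def theta_germ[OF r x])
  with c show ?thesis by simp
qed

lemma tt_unique:
  assumes r: "repr z A t" and x: "elem z A x a" and a: "a \<in> Fin N M"
    and l: "((\<lambda>k. fn (t k) (x k)) \<longlongrightarrow> l) (ult z)"
  shows "tt a = l"
  using tendsto_unique[OF ult_neq_bot[OF repr_intern[OF r]] tt_lim[OF r x a] l] .

lemma tt_infinitesimal:
  assumes a: "a \<in> Fin N M" and "nn a = 0"
  shows "tt a = 0"
proof -
  have "set [a] \<subseteq> elts (nst N) (acar M)" using a by (auto simp: Fin_def)
  from representation[OF this] obtain z A t x where r: "repr z A t" and x: "elem z A x a"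
    by (auto simp: list_all2_Cons2)
  show ?thesis
    using tt_unique[OF r x a theta_infinitesimal[OF r x]] nn_lim[OF r x a] assms(2) by simp
qed

lemma representation3:
  assumes "a \<in> Fin N M" "b \<in> Fin N M" "d \<in> Fin N M"
  obtains z A t x y w where "repr z A t" "elem z A x a" "elem z A y b" "elem z A w d"
    "eventually (\<lambda>k. star_seminorm (calg N (A k)) (fn (t k)) \<and> x k \<in> carrier (calg N (A k)) \<and>
       y k \<in> carrier (calg N (A k)) \<and> w k \<in> carrier (calg N (A k))) (ult z)"
proof -
  have "set [a, b, d] \<subseteq> elts (nst N) (acar M)" using assms by (auto simp: Fin_def)
  from representation[OF this] obtain z A t xs where r0: "repr z A t" and "list_all2 (elem z A) xs [a, b, d]"
    by blast
  then obtain x y w where "elem z A x a" "elem z A y b" "elem z A w d"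
    by (auto simp: list_all2_Cons2)
  note r = r0 this
  show thesis
    by (rule that[OF r]) (intro eventually_conj ev_seminorm[OF r(1)] elem_ev[OF r(2)] elem_ev[OF r(3)] elem_ev[OF r(4)])
qed

lemma elem_eqI: "elem z A x a \<Longrightarrow> elem z A y b \<Longrightarrow> eventually (\<lambda>k. x k = y k) (ult z) \<Longrightarrow> a = b"
  using elem_eq_iff by blast

text \<open>The equations hold exactly among internal elements because they hold in the standard
  algebras at almost every index; no standard parts are involved.\<close>

lemma FA_identities:
  assumes abd: "a \<in> Fin N M" "b \<in> Fin N M" "d \<in> Fin N M"
  shows "(a \<oplus>\<^bsub>FA\<^esub> b) \<oplus>\<^bsub>FA\<^esub> d = a \<oplus>\<^bsub>FA\<^esub> (b \<oplus>\<^bsub>FA\<^esub> d)" (is ?e1)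
    "a \<oplus>\<^bsub>FA\<^esub> b = b \<oplus>\<^bsub>FA\<^esub> a" (is ?e2)
    "\<zero>\<^bsub>FA\<^esub> \<oplus>\<^bsub>FA\<^esub> a = a" (is ?e3)
    "(-1) \<odot>\<^bsub>FA\<^esub> a \<oplus>\<^bsub>FA\<^esub> a = \<zero>\<^bsub>FA\<^esub>" (is ?e4)
    "c \<odot>\<^bsub>FA\<^esub> (a \<oplus>\<^bsub>FA\<^esub> b) = c \<odot>\<^bsub>FA\<^esub> a \<oplus>\<^bsub>FA\<^esub> c \<odot>\<^bsub>FA\<^esub> b" (is ?e5)
    "(c + c') \<odot>\<^bsub>FA\<^esub> a = c \<odot>\<^bsub>FA\<^esub> a \<oplus>\<^bsub>FA\<^esub> c' \<odot>\<^bsub>FA\<^esub> a" (is ?e6)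
    "c \<odot>\<^bsub>FA\<^esub> (c' \<odot>\<^bsub>FA\<^esub> a) = (c * c') \<odot>\<^bsub>FA\<^esub> a" (is ?e7)
    "1 \<odot>\<^bsub>FA\<^esub> a = a" (is ?e8)
    "\<one>\<^bsub>FA\<^esub> \<otimes>\<^bsub>FA\<^esub> a = a" (is ?e9)
    "a \<otimes>\<^bsub>FA\<^esub> \<one>\<^bsub>FA\<^esub> = a" (is ?e10)
    "(a \<oplus>\<^bsub>FA\<^esub> b) \<otimes>\<^bsub>FA\<^esub> d = a \<otimes>\<^bsub>FA\<^esub> d \<oplus>\<^bsub>FA\<^esub> b \<otimes>\<^bsub>FA\<^esub> d" (is ?e11)
    "d \<otimes>\<^bsub>FA\<^esub> (a \<oplus>\<^bsub>FA\<^esub> b) = d \<otimes>\<^bsub>FA\<^esub> a \<oplus>\<^bsub>FA\<^esub> d \<otimes>\<^bsub>FA\<^esub> b" (is ?e12)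
    "(c \<odot>\<^bsub>FA\<^esub> a) \<otimes>\<^bsub>FA\<^esub> b = c \<odot>\<^bsub>FA\<^esub> (a \<otimes>\<^bsub>FA\<^esub> b)" (is ?e13)
    "a \<otimes>\<^bsub>FA\<^esub> (c \<odot>\<^bsub>FA\<^esub> b) = c \<odot>\<^bsub>FA\<^esub> (a \<otimes>\<^bsub>FA\<^esub> b)" (is ?e14)
    "adj FA (a \<oplus>\<^bsub>FA\<^esub> b) = adj FA a \<oplus>\<^bsub>FA\<^esub> adj FA b" (is ?e15)
    "adj FA (c \<odot>\<^bsub>FA\<^esub> a) = cnj c \<odot>\<^bsub>FA\<^esub> adj FA a" (is ?e16)
    "(a \<otimes>\<^bsub>FA\<^esub> b) \<otimes>\<^bsub>FA\<^esub> d = a \<otimes>\<^bsub>FA\<^esub> (b \<otimes>\<^bsub>FA\<^esub> d)" (is ?e17)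
    "adj FA (adj FA a) = a" (is ?e18)
    "adj FA (a \<otimes>\<^bsub>FA\<^esub> b) = adj FA b \<otimes>\<^bsub>FA\<^esub> adj FA a" (is ?e19)
proof -
  obtain z A t x y w where r: "repr z A t" and xyw: "elem z A x a" "elem z A y b" "elem z A w d"
    and ev: "eventually (\<lambda>k. star_seminorm (calg N (A k)) (fn (t k)) \<and> x k \<in> carrier (calg N (A k)) \<and>
       y k \<in> carrier (calg N (A k)) \<and> w k \<in> carrier (calg N (A k))) (ult z)"
    using representation3[OF abd] by blast
  note el = elem_add[OF r] elem_mult[OF r] elem_smult[OF r] elem_adj[OF r] elem_zero[OF r] elem_one[OF r] xyw
  note evm = eventually_mono[OF ev]
  show ?e1
    unfolding FA_simps by (rule elem_eqI, (rule el)+, rule evm, elim conjE, rule star_seminorm.add_assoc)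
  show ?e2
    unfolding FA_simps by (rule elem_eqI, (rule el)+, rule evm, elim conjE, rule star_seminorm.add_commute)
  show ?e3
    unfolding FA_simps by (rule elem_eqI, (rule el)+, rule evm, elim conjE, rule star_seminorm.add_zero)
  show ?e4
    unfolding FA_simps by (rule elem_eqI, (rule el)+, rule evm, elim conjE, rule star_seminorm.add_neg)
  show ?e5
    unfolding FA_simps by (rule elem_eqI, (rule el)+, rule evm, elim conjE, rule star_seminorm.smult_add)
  show ?e6
    unfolding FA_simps by (rule elem_eqI, (rule el)+, rule evm, elim conjE, rule star_seminorm.smult_add_left)
  show ?e7
    unfolding FA_simps by (rule elem_eqI, (rule el)+, rule evm, elim conjE, rule star_seminorm.smult_smult)
  show ?e8
    unfolding FA_simps by (rule elem_eqI, (rule el)+, rule evm, elim conjE, rule star_seminorm.smult_1)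
  show ?e9
    unfolding FA_simps by (rule elem_eqI, (rule el)+, rule evm, elim conjE, rule star_seminorm.mult_one(1))
  show ?e10
    unfolding FA_simps by (rule elem_eqI, (rule el)+, rule evm, elim conjE, rule star_seminorm.mult_one(2))
  show ?e11
    unfolding FA_simps by (rule elem_eqI, (rule el)+, rule evm, elim conjE, rule star_seminorm.mult_add(1))
  show ?e12
    unfolding FA_simps by (rule elem_eqI, (rule el)+, rule evm, elim conjE, rule star_seminorm.mult_add(2))
  show ?e13
    unfolding FA_simps by (rule elem_eqI, (rule el)+, rule evm, elim conjE, rule star_seminorm.mult_smult(1))
  show ?e14
    unfolding FA_simps by (rule elem_eqI, (rule el)+, rule evm, elim conjE, rule star_seminorm.mult_smult(2))
  show ?e15
    unfolding FA_simps by (rule elem_eqI, (rule el)+, rule evm, elim conjE, rule star_seminorm.adj_add)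
  show ?e16
    unfolding FA_simps by (rule elem_eqI, (rule el)+, rule evm, elim conjE, rule star_seminorm.adj_smult)
  show ?e17
    unfolding FA_simps by (rule elem_eqI, (rule el)+, rule evm, elim conjE, rule star_seminorm.mult_assoc)
  show ?e18
    unfolding FA_simps by (rule elem_eqI, (rule el)+, rule evm, elim conjE, rule star_seminorm.adj_adj)
  show ?e19
    unfolding FA_simps by (rule elem_eqI, (rule el)+, rule evm, elim conjE, rule star_seminorm.adj_mult)
qed

lemma FA_const: "\<zero>\<^bsub>FA\<^esub> \<in> Fin N M" "\<one>\<^bsub>FA\<^esub> \<in> Fin N M" "nn \<one>\<^bsub>FA\<^esub> \<le> 1"
proof -
  obtain z A t where r: "repr z A t" using repr_exists by blast
  note evm = eventually_mono[OF ev_seminorm[OF r]]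
  have "eventually (\<lambda>k. nrm (calg N (A k)) \<zero>\<^bsub>calg N (A k)\<^esub> \<le> 0) (ult z)"
    by (rule evm) (rule eq_refl, rule star_seminorm.nrm_zero)
  from Fin_le(1)[OF r elem_zero[OF r] this tendsto_const] show "\<zero>\<^bsub>FA\<^esub> \<in> Fin N M" unfolding FA_simps .
  have "eventually (\<lambda>k. nrm (calg N (A k)) \<one>\<^bsub>calg N (A k)\<^esub> \<le> 1) (ult z)"
    by (rule evm, (elim conjE)?, rule star_seminorm.nrm_one)
  from Fin_le[OF r elem_one[OF r] this tendsto_const]
  show "\<one>\<^bsub>FA\<^esub> \<in> Fin N M" "nn \<one>\<^bsub>FA\<^esub> \<le> 1" unfolding FA_simps by auto
qed

lemma FA_norms:
  assumes ab: "a \<in> Fin N M" "b \<in> Fin N M"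
  shows "a \<oplus>\<^bsub>FA\<^esub> b \<in> Fin N M" (is ?n1)
    "nn (a \<oplus>\<^bsub>FA\<^esub> b) \<le> nn a + nn b" (is ?n2)
    "a \<otimes>\<^bsub>FA\<^esub> b \<in> Fin N M" (is ?n3)
    "nn (a \<otimes>\<^bsub>FA\<^esub> b) \<le> nn a * nn b" (is ?n4)
    "c \<odot>\<^bsub>FA\<^esub> a \<in> Fin N M" (is ?n5)
    "nn (c \<odot>\<^bsub>FA\<^esub> a) = cmod c * nn a" (is ?n6)
    "adj FA a \<in> Fin N M" (is ?n7)
    "nn (adj FA a) \<le> nn a" (is ?n8)
    "0 \<le> nn a" (is ?n9)
    "(nn a)\<^sup>2 \<le> nn (adj FA a \<otimes>\<^bsub>FA\<^esub> a)" (is ?n10)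
    "tt (a \<oplus>\<^bsub>FA\<^esub> b) = tt a + tt b" (is ?n11)
    "tt (c \<odot>\<^bsub>FA\<^esub> a) = c * tt a" (is ?n12)
    "tt (adj FA a \<otimes>\<^bsub>FA\<^esub> a) = complex_of_real (Re (tt (adj FA a \<otimes>\<^bsub>FA\<^esub> a))) \<and> 0 \<le> Re (tt (adj FA a \<otimes>\<^bsub>FA\<^esub> a))" (is ?n13)
proof -
  obtain z A t x y w where r: "repr z A t" and x: "elem z A x a" and y: "elem z A y b" and w: "elem z A w b"
    and ev: "eventually (\<lambda>k. star_seminorm (calg N (A k)) (fn (t k)) \<and> x k \<in> carrier (calg N (A k)) \<and>
       y k \<in> carrier (calg N (A k)) \<and> w k \<in> carrier (calg N (A k))) (ult z)"
    using representation3[OF ab ab(2)] by blast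
  note evm = eventually_mono[OF ev]
  note bot = ult_neq_bot[OF repr_intern[OF r]]
  note lx = nn_lim[OF r x ab(1)] and ly = nn_lim[OF r y ab(2)]
  note tx = tt_lim[OF r x ab(1)] and ty = tt_lim[OF r y ab(2)]
  have "eventually (\<lambda>k. nrm (calg N (A k)) (x k \<oplus>\<^bsub>calg N (A k)\<^esub> y k) \<le> nrm (calg N (A k)) (x k) + nrm (calg N (A k)) (y k)) (ult z)"
    by (rule evm, (elim conjE)?, rule star_seminorm.nrm_add)
  from Fin_le[OF r elem_add[OF r x y] this tendsto_add[OF lx ly]]
  show add: ?n1 ?n2 unfolding FA_simps by auto
  have "eventually (\<lambda>k. nrm (calg N (A k)) (x k \<otimes>\<^bsub>calg N (A k)\<^esub> y k) \<le> nrm (calg N (A k)) (x k) * nrm (calg N (A k)) (y k)) (ult z)"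
    by (rule evm, (elim conjE)?, rule star_seminorm.nrm_mult)
  from Fin_le[OF r elem_mult[OF r x y] this tendsto_mult[OF lx ly]]
  show ?n3 ?n4 unfolding FA_simps by auto
  have eq: "eventually (\<lambda>k. cmod c * nrm (calg N (A k)) (x k) = nrm (calg N (A k)) (c \<odot>\<^bsub>calg N (A k)\<^esub> x k)) (ult z)"
    by (rule evm, elim conjE, rule star_seminorm.nrm_smult[symmetric])
  have lc: "((\<lambda>k. nrm (calg N (A k)) (c \<odot>\<^bsub>calg N (A k)\<^esub> x k)) \<longlongrightarrow> cmod c * nn a) (ult z)"
    by (rule Lim_transform_eventually[OF tendsto_mult[OF tendsto_const lx] eq])
  from Fin_le(1)[OF r elem_smult[OF r x] _ lc] nn_unique[OF r elem_smult[OF r x] lc]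
  show smult: ?n5 ?n6 unfolding FA_simps by auto
  have "eventually (\<lambda>k. nrm (calg N (A k)) (adj (calg N (A k)) (x k)) \<le> nrm (calg N (A k)) (x k)) (ult z)"
    by (rule evm, (elim conjE)?, rule star_seminorm.nrm_adj)
  from Fin_le[OF r elem_adj[OF r x] this lx]
  show adj: ?n7 ?n8 unfolding FA_simps by auto
  show ?n9 by (rule tendsto_lowerbound[OF lx ev_nonneg[OF r x] bot])
  note s = elem_mult[OF r elem_adj[OF r x] x]
  have "eventually (\<lambda>k. nrm (calg N (A k)) (adj (calg N (A k)) (x k) \<otimes>\<^bsub>calg N (A k)\<^esub> x k) \<le>
      nrm (calg N (A k)) (adj (calg N (A k)) (x k)) * nrm (calg N (A k)) (x k)) (ult z)"
    by (rule evm) (blast intro: star_seminorm.nrm_mult star_seminorm.closed(6))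
  from Fin_le(1)[OF r s this tendsto_mult[OF nn_lim[OF r elem_adj[OF r x] adj(1)[unfolded FA_simps]] lx]]
  have sF: "adj FA a \<otimes>\<^bsub>FA\<^esub> a \<in> Fin N M" unfolding FA_simps .
  note ls = nn_lim[OF r s sF[unfolded FA_simps]] and ts = tt_lim[OF r s sF[unfolded FA_simps]]
  show ?n10
    unfolding FA_simps
    by (rule tendsto_le[OF bot ls tendsto_power[OF lx]], rule evm, elim conjE, rule star_seminorm.nrm_star)
  have "eventually (\<lambda>k. fn (t k) (x k) + fn (t k) (y k) = fn (t k) (x k \<oplus>\<^bsub>calg N (A k)\<^esub> y k)) (ult z)"
    by (rule evm, elim conjE, rule star_seminorm.f_add[symmetric])
  from Lim_transform_eventually[OF tendsto_add[OF tx ty] this]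
  show ?n11
    using tt_unique[OF r elem_add[OF r x y]] add(1) unfolding FA_simps by blast
  have "eventually (\<lambda>k. c * fn (t k) (x k) = fn (t k) (c \<odot>\<^bsub>calg N (A k)\<^esub> x k)) (ult z)"
    by (rule evm, elim conjE, rule star_seminorm.f_smult[symmetric])
  from Lim_transform_eventually[OF tendsto_mult[OF tendsto_const tx] this]
  show ?n12
    using tt_unique[OF r elem_smult[OF r x]] smult(1) unfolding FA_simps by blast
  let ?f = "\<lambda>k. fn (t k) (adj (calg N (A k)) (x k) \<otimes>\<^bsub>calg N (A k)\<^esub> x k)"
  have pos: "eventually (\<lambda>k. ?f k = complex_of_real (Re (?f k)) \<and> 0 \<le> Re (?f k)) (ult z)"
    by (rule evm, elim conjE, rule star_seminorm.f_pos)
  have "eventually (\<lambda>k. complex_of_real (Re (?f k)) = ?f k) (ult z)" "eventually (\<lambda>k. 0 \<le> Re (?f k)) (ult z)"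
    using pos by (auto elim: eventually_mono)
  from tendsto_unique[OF bot Lim_transform_eventually[OF tendsto_of_real[OF tendsto_Re[OF ts]] this(1)] ts]
    tendsto_lowerbound[OF tendsto_Re[OF ts] this(2) bot]
  show ?n13
    unfolding FA_simps by simp
qed

text \<open>The strict premise holds at almost all indices because the norms converge to
  \<open>nn a\<close>; the weak conclusion survives the limit. Hence the asymmetric form of
  \<open>nrm_one_minus\<close>.\<close>

lemma FA_one_minus:
  assumes a: "a \<in> Fin N M" and a1: "nn a < 1"
  shows "nn (\<one>\<^bsub>FA\<^esub> \<oplus>\<^bsub>FA\<^esub> (-1) \<odot>\<^bsub>FA\<^esub> (adj FA a \<otimes>\<^bsub>FA\<^esub> a)) \<le> 1"
proof -
  obtain z A t x where r: "repr z A t" and x: "elem z A x a"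
    by (rule representation3[OF a a a]) (rule that)
  have "eventually (\<lambda>k. nrm (calg N (A k)) (x k) < 1) (ult z)" using nn_lim[OF r x a] a1 by (rule order_tendstoD)
  then have "eventually (\<lambda>k. nrm (calg N (A k)) (\<one>\<^bsub>calg N (A k)\<^esub> \<oplus>\<^bsub>calg N (A k)\<^esub>
      (-1) \<odot>\<^bsub>calg N (A k)\<^esub> (adj (calg N (A k)) (x k) \<otimes>\<^bsub>calg N (A k)\<^esub> x k)) \<le> 1) (ult z)"
    using ev_seminorm[OF r] elem_ev[OF x] by eventually_elim (rule star_seminorm.nrm_one_minus)
  then show ?thesis
    unfolding FA_simps
    by (rule Fin_le(2)[OF r _ _ tendsto_const, rotated])
      (intro elem_add[OF r] elem_smult[OF r] elem_mult[OF r] elem_adj[OF r] elem_one[OF r] x)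
qed

sublocale FA: star_seminorm FA tt
  apply (unfold_locales, unfold FA_simps(1,8))
  subgoal by (rule FA_const(1))
  subgoal by (rule FA_const(2))
  subgoal by (rule FA_norms(1))
  subgoal by (rule FA_norms(3))
  subgoal by (rule FA_norms(5))
  subgoal by (rule FA_norms(7))
  subgoal by (rule FA_identities(1))
  subgoal by (rule FA_identities(2))
  subgoal by (rule FA_identities(3))
  subgoal by (rule FA_identities(4))
  subgoal by (rule FA_identities(5))
  subgoal by (rule FA_identities(6))
  subgoal by (rule FA_identities(7))
  subgoal by (rule FA_identities(8))
  subgoal by (rule FA_identities(9))
  subgoal by (rule FA_identities(10))
  subgoal by (rule FA_identities(11))
  subgoal by (rule FA_identities(12))
  subgoal by (rule FA_identities(13))
  subgoal by (rule FA_identities(14))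
  subgoal by (rule FA_identities(15))
  subgoal by (rule FA_identities(16))
  subgoal by (rule FA_identities(17))
  subgoal by (rule FA_identities(18))
  subgoal by (rule FA_identities(19))
  subgoal by (rule FA_norms(9))
  subgoal by (rule FA_norms(2))
  subgoal by (rule FA_norms(6))
  subgoal by (rule FA_norms(4))
  subgoal by (rule FA_norms(8))
  subgoal by (rule FA_norms(10))
  subgoal by (rule FA_const(3))
  subgoal by (rule FA_one_minus)
  subgoal by (rule FA_norms(11))
  subgoal by (rule FA_norms(12))
  subgoal by (rule FA_norms(13))
  done

end

section \<open>Saturation\<close>

context internal_algebra
begin

text \<open>The internal set of elements satisfying a condition with parameter \<open>a\<close>. The
  condition is any HOL predicate on standard algebras, and membership can be read off from every
  representation, not only from the one used to build the set.\<close>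

definition solutions :: "('u cstar \<Rightarrow> ('u \<Rightarrow> complex) \<Rightarrow> 'u \<Rightarrow> 'u \<Rightarrow> bool) \<Rightarrow> 'v \<Rightarrow> 'v \<Rightarrow> bool" where
  "solutions \<phi> a s \<longleftrightarrow> intern s \<and> elts (nst N) s \<subseteq> elts (nst N) (acar M) \<and>
    (\<forall>z A t x y c. repr z A t \<longrightarrow> elem z A x a \<longrightarrow> elem z A y c \<longrightarrow>
      (c \<in> elts (nst N) s \<longleftrightarrow> eventually (\<lambda>k. \<phi> (calg N (A k)) (fn (t k)) (x k) (y k)) (ult z)))"

lemma solutions_iff:
  "solutions \<phi> a s \<Longrightarrow> repr z A t \<Longrightarrow> elem z A x a \<Longrightarrow> elem z A y c \<Longrightarrow>
    c \<in> elts (nst N) s \<longleftrightarrow> eventually (\<lambda>k. \<phi> (calg N (A k)) (fn (t k)) (x k) (y k)) (ult z)"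
  unfolding solutions_def by blast

text \<open>At each index the solutions form a subset of the carrier of the standard algebra, so the
  corresponding objects are bounded and have a germ.\<close>

lemma solutions_exist:
  assumes a: "a \<in> elts (nst N) (acar M)"
  shows "\<exists>s. solutions \<phi> a s"
proof -
  have "set [a] \<subseteq> elts (nst N) (acar M)" using a by simp
  from representation[OF this] obtain z0 A0 t0 x0 where r0: "repr z0 A0 t0" and x0: "elem z0 A0 x0 a"
    by (auto simp: list_all2_Cons2)
  define G where "G k = {c \<in> carrier (calg N (A0 k)). \<phi> (calg N (A0 k)) (fn (t0 k)) (x0 k) c}" for k
  define g where "g k = mkset (std N) (G k)" for k
  have G: "G k \<subseteq> elts (std N) (acar (A0 k))" for k by (auto simp: G_def calg_def)
  then have bG: "bdd (std N) (G k)" for k using bdd_subset[OF S.bdd_elts] by blast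
  note ac = repr_fields(1)[OF r0]
  obtain B where B: "bdd (std N) B" "z0 \<in> st B" "bdd (std N) ((\<lambda>k. acar (A0 k)) ` B)"
    using ac unfolding bg_def by blast
  obtain n where n: "(\<lambda>k. acar (A0 k)) ` B \<subseteq> level (std N) n" using B(3) unfolding bdd_def by blast
  have "g ` B \<subseteq> level (std N) (Suc n)"
  proof
    fix v assume "v \<in> g ` B"
    then obtain k where k: "k \<in> B" "v = g k" by blast
    then have "G k \<subseteq> level (std N) n" using G[of k] S.elts_level[of "acar (A0 k)" n] n by blast
    then show "v \<in> level (std N) (Suc n)" unfolding k(2) g_def by (rule S.mkset_level)
  qed
  then have bg: "bg z0 g" using B(1,2) unfolding bg_def bdd_def[of _ "g ` _"] by blast
  define s where "s = germ z0 g"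
  have si: "intern s" unfolding s_def using intern_germ[OF bg] .
  have sub: "c \<in> elts (nst N) (acar M)" if c: "c \<in> elts (nst N) s" for c
  proof -
    note e = extend[OF repr_intern[OF r0] intern_elt[OF si c]]
    let ?z = "opair (nst N) z0 c"
    have "mem (nst N) (germ ?z S.osnd) (germ ?z (\<lambda>k. g (S.ofst k)))"
      using c e(3)[OF bg] e(6) by (simp add: s_def elts_def)
    then have "eventually (\<lambda>k. mem (std N) (S.osnd k) (g (S.ofst k))) (ult ?z)"
      using mem_germ_iff[OF e(5) e(2)[OF bg]] by blast
    then have "eventually (\<lambda>k. mem (std N) (S.osnd k) (acar (A0 (S.ofst k)))) (ult ?z)"
      by (rule eventually_mono) (simp add: g_def bG, simp add: G_def carrier_calg)
    then have "mem (nst N) (germ ?z S.osnd) (germ ?z (\<lambda>k. acar (A0 (S.ofst k))))"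
      using mem_germ_iff[OF e(5) e(2)[OF conjunct1[OF ac]]] by blast
    then show ?thesis using e(3)[OF conjunct1[OF ac]] e(6) ac by (simp add: elts_def)
  qed
  have iff: "c \<in> elts (nst N) s \<longleftrightarrow> eventually (\<lambda>k. \<phi> (calg N (A k)) (fn (t k)) (x k) (y k)) (ult z)"
    if r: "repr z A t" and x: "elem z A x a" and y: "elem z A y c" for z A t x y c
  proof -
    \<comment> \<open>The fixed representation and an arbitrary one meet over the pair of their base
      points, where algebras, functionals and parameters have equal germs and hence agree almost
      everywhere.\<close>
    let ?z = "opair (nst N) z0 z"
    note e = extend[OF repr_intern[OF r0] repr_intern[OF r]]
    have q: "bg ?z (\<lambda>k. f (S.osnd k))" "germ ?z (\<lambda>k. f (S.osnd k)) = germ z f" if "bg z f" for f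
      using bg_comp[OF e(5), of f] germ_germ[OF e(5), of f] e(6) that by auto
    have "eventually (\<lambda>k. atuple (std N) (A0 (S.ofst k)) = atuple (std N) (A (S.osnd k))) (ult ?z)"
      using r0 r e(2,3)[of "\<lambda>k. atuple (std N) (A0 k)"] q[of "\<lambda>k. atuple (std N) (A k)"]
        germ_eq_iff[of ?z "\<lambda>k. atuple (std N) (A0 (S.ofst k))" "\<lambda>k. atuple (std N) (A (S.osnd k))"]
      unfolding repr_def by simp
    moreover have "eventually (\<lambda>k. t0 (S.ofst k) = t (S.osnd k)) (ult ?z)"
      using r0 r e(2,3)[of t0] q[of t] germ_eq_iff[of ?z "\<lambda>k. t0 (S.ofst k)" "\<lambda>k. t (S.osnd k)"]
      unfolding repr_def by simp
    moreover have "eventually (\<lambda>k. x0 (S.ofst k) = x (S.osnd k)) (ult ?z)"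
      using x0 x e(2,3)[of x0] q[of x] germ_eq_iff[of ?z "\<lambda>k. x0 (S.ofst k)" "\<lambda>k. x (S.osnd k)"]
      unfolding elem_def by simp
    moreover have "eventually (\<lambda>k. y (S.osnd k) \<in> carrier (calg N (A (S.osnd k)))) (ult ?z)"
      using ult_germ[OF e(5), of "\<lambda>k. y k \<in> carrier (calg N (A k))"] e(6) elem_ev[OF y] by simp
    ultimately have eq: "eventually (\<lambda>k. mem (std N) (y (S.osnd k)) (g (S.ofst k)) \<longleftrightarrow>
        \<phi> (calg N (A (S.osnd k))) (fn (t (S.osnd k))) (x (S.osnd k)) (y (S.osnd k))) (ult ?z)"
      by eventually_elim (simp add: g_def bG, simp add: G_def atuple_inject)
    have y': "bg z y" "germ z y = c" using y unfolding elem_def by auto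
    have "c \<in> elts (nst N) s \<longleftrightarrow> mem (nst N) (germ ?z (\<lambda>k. y (S.osnd k))) (germ ?z (\<lambda>k. g (S.ofst k)))"
      using e(3)[OF bg] q(2)[OF y'(1)] y' by (simp add: s_def elts_def)
    also have "\<dots> \<longleftrightarrow> eventually (\<lambda>k. mem (std N) (y (S.osnd k)) (g (S.ofst k))) (ult ?z)"
      by (rule mem_germ_iff[OF q(1)[OF y'(1)] e(2)[OF bg]])
    also have "\<dots> \<longleftrightarrow> eventually (\<lambda>k. \<phi> (calg N (A (S.osnd k))) (fn (t (S.osnd k))) (x (S.osnd k)) (y (S.osnd k))) (ult ?z)"
      by (rule eventually_cong[OF eq]) simp
    also have "\<dots> \<longleftrightarrow> eventually (\<lambda>k. \<phi> (calg N (A k)) (fn (t k)) (x k) (y k)) (ult z)"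
      using ult_germ[OF e(5), of "\<lambda>k. \<phi> (calg N (A k)) (fn (t k)) (x k) (y k)"] e(6) by simp
    finally show ?thesis .
  qed
  show ?thesis unfolding solutions_def using si sub iff by blast
qed

end

lemma reciprocal_small: "(e :: real) > 0 \<Longrightarrow> \<exists>n. 1 / (real n + 1) < e"
  by (erule nat_approx_posE) (auto simp: add.commute)

locale saturated_weight = scontinuous_weight +
  fixes \<kappa> :: "'k rel"
  assumes card: "Card_order \<kappa>" and uncountable: "natLeq <o \<kappa>" and sat: "saturated N \<kappa>"
begin

abbreviation "sqr b \<equiv> adj FA b \<otimes>\<^bsub>FA\<^esub> b"

text \<open>Serves cardinal arithmetic: below an infinite cardinal, sums of two smaller ones stay
  smaller.\<close>

lemma infinite_Field: "\<not> finite (Field \<kappa>)"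
proof
  assume "finite (Field \<kappa>)"
  then have "|Field \<kappa>| <o natLeq" using finite_iff_ordLess_natLeq by blast
  then have "\<kappa> <o natLeq"
    using card_of_Field_ordIso[OF card] ordIso_ordLess_trans ordIso_symmetric by blast
  then have "natLeq <o natLeq" using ordLess_transitive[OF uncountable] by blast
  then show False using ordLess_irreflexive by blast
qed

lemma saturation:
  assumes I: "|I| <o \<kappa>" and int: "\<And>i. i \<in> I \<Longrightarrow> intern (s i)"
    and fip: "\<And>J. J \<subseteq> I \<Longrightarrow> finite J \<Longrightarrow> \<exists>x. \<forall>i\<in>J. x \<in> elts (nst N) (s i)"
  shows "\<exists>x. \<forall>i\<in>I. x \<in> elts (nst N) (s i)"
proof -
  have "|s ` I| <o \<kappa>" using card_of_image I ordLeq_ordLess_trans by blast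
  moreover have "internal N v \<and> v \<notin> indiv (nst N)" if v: "v \<in> s ` I" for v
  proof -
    obtain i where i: "i \<in> I" "v = s i" using v by blast
    \<comment> \<open>Saturation speaks of sets, not of individuals; the intersection property of a
      one-member family shows that \<open>s i\<close> has an element.\<close>
    obtain x where "x \<in> elts (nst N) v" using fip[of "{i}"] i by auto
    then show ?thesis using T.elts_indiv int i internal_iff_intern by blast
  qed
  moreover have "\<exists>x. \<forall>t\<in>K. x \<in> elts (nst N) t" if K: "K \<subseteq> s ` I" "finite K" for K
  proof -
    obtain J where "J \<subseteq> I" "finite J" "K = s ` J" using finite_subset_image[OF K(2,1)] by blast
    then show ?thesis using fip[of J] by blast
  qed
  ultimately have "\<exists>x. \<forall>v\<in>s ` I. x \<in> elts (nst N) v"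
    using sat unfolding saturated_def by blast
  then show ?thesis by blast
qed

lemma Fin_elts: "a \<in> Fin N M \<Longrightarrow> a \<in> elts (nst N) (acar M)"
  by (simp add: Fin_def)

lemma FA_closed [simp]:
  "\<zero>\<^bsub>FA\<^esub> \<in> Fin N M" "\<one>\<^bsub>FA\<^esub> \<in> Fin N M"
  "a \<in> Fin N M \<Longrightarrow> b \<in> Fin N M \<Longrightarrow> a \<oplus>\<^bsub>FA\<^esub> b \<in> Fin N M"
  "a \<in> Fin N M \<Longrightarrow> b \<in> Fin N M \<Longrightarrow> a \<otimes>\<^bsub>FA\<^esub> b \<in> Fin N M"
  "a \<in> Fin N M \<Longrightarrow> c \<odot>\<^bsub>FA\<^esub> a \<in> Fin N M"
  "a \<in> Fin N M \<Longrightarrow> adj FA a \<in> Fin N M"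
  using FA.closed unfolding FA_simps(1) by auto

text \<open>From \<open>\<parallel>y\<parallel>\<^sup>2 \<le> \<parallel>y\<^sup>* y\<parallel>
  \<le> \<parallel>x\<parallel> + 1\<close> approximate roots of a finite element are finite. A norm
  above \<open>\<parallel>x\<parallel> + 2\<close> would exceed 1, hence be at most its own square,
  which is at most \<open>\<parallel>x\<parallel> + 1\<close>.\<close>

lemma Fin_of_square:
  assumes r: "repr z A t" and x: "elem z A x a" and a: "a \<in> Fin N M" and y: "elem z A y b"
    and le: "eventually (\<lambda>k. nrm (calg N (A k)) (x k \<oplus>\<^bsub>calg N (A k)\<^esub> (-1) \<odot>\<^bsub>calg N (A k)\<^esub>
      (adj (calg N (A k)) (y k) \<otimes>\<^bsub>calg N (A k)\<^esub> y k)) < 1) (ult z)"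
  shows "b \<in> Fin N M"
proof -
  have "eventually (\<lambda>k. nrm (calg N (A k)) (y k) \<le> nrm (calg N (A k)) (x k) + 2) (ult z)"
    using ev_seminorm[OF r] elem_ev[OF x] elem_ev[OF y] le
  proof eventually_elim
    case (elim k)
    interpret star_seminorm "calg N (A k)" "fn (t k)" by fact
    let ?n = "nrm (calg N (A k))" and ?s = "adj (calg N (A k)) (y k) \<otimes>\<^bsub>calg N (A k)\<^esub> y k"
    have "(?n (y k))\<^sup>2 \<le> ?n ?s" by (rule nrm_star) fact
    also have "\<dots> \<le> ?n (x k) + ?n (sub ?s (x k))" by (rule nrm_le_sub) (use elim in auto)
    also have "\<dots> \<le> ?n (x k) + 1" using elim nrm_sub_commute[of ?s "x k"] by simp
    finally have sq: "(?n (y k))\<^sup>2 \<le> ?n (x k) + 1" .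
    have "0 \<le> ?n (x k)" by (rule nrm_nonneg) fact
    show ?case
    proof (rule ccontr)
      assume "\<not> ?thesis"
      then have big: "?n (y k) > ?n (x k) + 2" by simp
      then have "1 * ?n (y k) \<le> ?n (y k) * ?n (y k)" using \<open>0 \<le> ?n (x k)\<close> by (intro mult_right_mono) auto
      then show False using sq big by (simp add: power2_eq_square)
    qed
  qed
  then show ?thesis using Fin_le(1)[OF r y _ tendsto_add[OF nn_lim[OF r x a] tendsto_const]] by blast
qed

text \<open>The conditions \<open>\<parallel>a - b\<^sup>* b\<parallel> < 1 / (n + 1)\<close> grow
  stronger with \<open>n\<close>, so finitely many of them follow from one, and countably many have
  a common solution.\<close>

lemma square_root_by_saturation:
  assumes a: "a \<in> Fin N M" and ap: "\<And>e. e > 0 \<Longrightarrow> \<exists>b\<in>Fin N M. nn (FA.sub a (sqr b)) < e"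
  shows "\<exists>b\<in>Fin N M. nn (FA.sub a (sqr b)) = 0"
proof -
  define \<phi> where "\<phi> n A f x y \<longleftrightarrow> nrm A (x \<oplus>\<^bsub>A\<^esub> (-1) \<odot>\<^bsub>A\<^esub> (adj A y \<otimes>\<^bsub>A\<^esub> y)) < 1 / (real n + 1)"
    for n and A :: "'a cstar" and f :: "'a \<Rightarrow> complex" and x y :: 'a
  have "\<forall>n. \<exists>s. solutions (\<phi> n) a s"
    by (intro allI solutions_exist Fin_elts a)
  from choice[OF this] obtain s where s': "\<And>n. solutions (\<phi> n) a (s n)" by blast
  then have s: "\<And>n. intern (s n)" "\<And>n. elts (nst N) (s n) \<subseteq> elts (nst N) (acar M)"
    unfolding solutions_def by blast+
  note iff = solutions_iff[OF s']
  have rep: "\<exists>z A t x y. repr z A t \<and> elem z A x a \<and> elem z A y b" if "b \<in> elts (nst N) (acar M)" for b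
    using representation[of "[a, b]"] Fin_elts[OF a] that by (auto simp: list_all2_Cons2)
  have "|UNIV :: nat set| <o \<kappa>" using card_of_nat uncountable ordIso_ordLess_trans by blast
  moreover have "\<exists>x. \<forall>n\<in>J. x \<in> elts (nst N) (s n)" if J: "finite J" for J
  proof -
    obtain m where "\<forall>n\<in>J. n \<le> m" using J unfolding finite_nat_set_iff_bounded_le by blast
    then have m: "\<And>n. n \<in> J \<Longrightarrow> n \<le> m" by blast
    obtain b where b: "b \<in> Fin N M" "nn (FA.sub a (sqr b)) < 1 / (real m + 1)"
      using ap[of "1 / (real m + 1)"] by auto
    obtain z A t x y where r: "repr z A t" and x: "elem z A x a" and y: "elem z A y b"
      using rep[OF Fin_elts[OF b(1)]] by blast
    note d = elem_add[OF r x elem_smult[OF r elem_mult[OF r elem_adj[OF r y] y], of "-1"]]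
    have dF: "FA.sub a (sqr b) \<in> Fin N M" using a b by simp
    have "b \<in> elts (nst N) (s n)" if "n \<in> J" for n
    proof -
      have "1 / (real m + 1) \<le> 1 / (real n + 1)" using m[OF that] by (simp add: frac_le)
      then have "nn (FA.sub a (sqr b)) < 1 / (real n + 1)" using b(2) by simp
      from order_tendstoD(2)[OF nn_lim[OF r d dF[unfolded FA_simps]] this[unfolded FA_simps]]
      show ?thesis unfolding iff[OF r x y] \<phi>_def .
    qed
    then show ?thesis by blast
  qed
  ultimately obtain b where b: "\<And>n. b \<in> elts (nst N) (s n)"
    using saturation[of "UNIV :: nat set" s] s(1) by auto
  obtain z A t x y where r: "repr z A t" and x: "elem z A x a" and y: "elem z A y b"
    using rep[of b] b s(2) by blast
  have ev: "eventually (\<lambda>k. \<phi> n (calg N (A k)) (fn (t k)) (x k) (y k)) (ult z)" for n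
    using iff[OF r x y] b by blast
  \<comment> \<open>The condition for \<open>n = 0\<close> has tolerance 1 and thereby forces
    \<open>b\<close> to be finite.\<close>
  have bF: "b \<in> Fin N M"
    using Fin_of_square[OF r x a y] ev[of 0] unfolding \<phi>_def by simp
  note d = elem_add[OF r x elem_smult[OF r elem_mult[OF r elem_adj[OF r y] y], of "-1"]]
  have dF: "FA.sub a (sqr b) \<in> Fin N M" using a bF by simp
  have le: "nn (FA.sub a (sqr b)) \<le> 1 / (real n + 1)" for n
  proof -
    have "eventually (\<lambda>k. nrm (calg N (A k)) (x k \<oplus>\<^bsub>calg N (A k)\<^esub> (-1) \<odot>\<^bsub>calg N (A k)\<^esub>
      (adj (calg N (A k)) (y k) \<otimes>\<^bsub>calg N (A k)\<^esub> y k)) \<le> 1 / (real n + 1)) (ult z)"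
      by (rule eventually_mono[OF ev[of n]]) (simp add: \<phi>_def)
    from Fin_le(2)[OF r d this tendsto_const] show ?thesis unfolding FA_simps .
  qed
  have "nn (FA.sub a (sqr b)) \<le> 0"
  proof (rule field_le_epsilon)
    fix e :: real assume "e > 0"
    then obtain n where "1 / (real n + 1) < e" using reciprocal_small by blast
    then show "nn (FA.sub a (sqr b)) \<le> 0 + e" using le[of n] by linarith
  qed
  moreover have "0 \<le> nn (FA.sub a (sqr b))" using FA_norms(9)[OF dF dF] .
  ultimately show ?thesis using bF by (intro bexI[of _ b]) auto
qed

section \<open>The nonstandard hull\<close>

abbreviation eqv :: "'b \<Rightarrow> 'b \<Rightarrow> bool" (infix "\<sim>" 50) where
  "a \<sim> b \<equiv> nn (FA.sub a b) = 0"

lemma nn_nonneg: "a \<in> Fin N M \<Longrightarrow> 0 \<le> nn a"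
  using FA_norms(9) by blast

lemma eqv_refl: "a \<in> Fin N M \<Longrightarrow> a \<sim> a"
  using FA.sub_self[of a] FA.nrm_zero by (simp add: FA_simps(1,8))

lemma eqv_sym: "a \<in> Fin N M \<Longrightarrow> b \<in> Fin N M \<Longrightarrow> a \<sim> b \<Longrightarrow> b \<sim> a"
  using FA.nrm_sub_commute[of a b] by (simp add: FA_simps(1,8))

lemma eqv_le:
  assumes "c \<in> Fin N M" "nn c \<le> r + s" "r = 0" "s = 0" shows "nn c = 0"
  using assms nn_nonneg[of c] by simp

lemma eqv_trans: "a \<in> Fin N M \<Longrightarrow> b \<in> Fin N M \<Longrightarrow> d \<in> Fin N M \<Longrightarrow> a \<sim> b \<Longrightarrow> b \<sim> d \<Longrightarrow> a \<sim> d"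
  using eqv_le[of "FA.sub a d"] FA.nrm_sub_trans[of a b d] by (simp add: FA_simps(1,8))

lemma eqv_add:
  assumes F: "a \<in> Fin N M" "b \<in> Fin N M" "a' \<in> Fin N M" "b' \<in> Fin N M" and "a \<sim> a'" "b \<sim> b'"
  shows "a \<oplus>\<^bsub>FA\<^esub> b \<sim> a' \<oplus>\<^bsub>FA\<^esub> b'"
  using assms eqv_le[of "FA.sub a a' \<oplus>\<^bsub>FA\<^esub> FA.sub b b'"] FA.sub_add[of a b a' b'] FA.nrm_add[of "FA.sub a a'" "FA.sub b b'"]
  by (simp add: FA_simps(1,8))

lemma eqv_smult:
  assumes F: "a \<in> Fin N M" "a' \<in> Fin N M" and "a \<sim> a'"
  shows "c \<odot>\<^bsub>FA\<^esub> a \<sim> c \<odot>\<^bsub>FA\<^esub> a'"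
proof -
  have "FA.sub (c \<odot>\<^bsub>FA\<^esub> a) (c \<odot>\<^bsub>FA\<^esub> a') = c \<odot>\<^bsub>FA\<^esub> FA.sub a a'"
    using F by (simp add: FA_simps(1) FA.smult_add FA.smult_smult)
  then show ?thesis using assms FA.nrm_smult[of "FA.sub a a'" c] by (simp add: FA_simps(1,8))
qed

lemma eqv_adj:
  assumes F: "a \<in> Fin N M" "a' \<in> Fin N M" and "a \<sim> a'"
  shows "adj FA a \<sim> adj FA a'"
proof -
  have "FA.sub (adj FA a) (adj FA a') = adj FA (FA.sub a a')"
    using F by (simp add: FA_simps(1) FA.adj_add FA.adj_smult)
  then show ?thesis using assms FA.nrm_adj[of "FA.sub a a'"] eqv_le[of "adj FA (FA.sub a a')" 0 0] by (simp add: FA_simps(1,8))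
qed

lemma eqv_mult:
  assumes F: "a \<in> Fin N M" "b \<in> Fin N M" "a' \<in> Fin N M" "b' \<in> Fin N M" and e: "a \<sim> a'" "b \<sim> b'"
  shows "a \<otimes>\<^bsub>FA\<^esub> b \<sim> a' \<otimes>\<^bsub>FA\<^esub> b'"
proof -
  have "nn (a \<otimes>\<^bsub>FA\<^esub> FA.sub b b') \<le> nn a * 0" "nn (FA.sub a a' \<otimes>\<^bsub>FA\<^esub> b') \<le> 0 * nn b'"
    using FA.nrm_mult[of a "FA.sub b b'"] FA.nrm_mult[of "FA.sub a a'" b'] F e by (simp_all add: FA_simps(1,8))
  then have "nn (a \<otimes>\<^bsub>FA\<^esub> FA.sub b b' \<oplus>\<^bsub>FA\<^esub> FA.sub a a' \<otimes>\<^bsub>FA\<^esub> b') \<le> 0 + 0"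
    using FA.nrm_add[of "a \<otimes>\<^bsub>FA\<^esub> FA.sub b b'" "FA.sub a a' \<otimes>\<^bsub>FA\<^esub> b'"] F by (simp add: FA_simps(1,8))
  then show ?thesis
    using FA.sub_mult[of a b a' b'] F eqv_le[of _ 0 0] by (simp add: FA_simps(1))
qed

lemma eqv_nn: "a \<in> Fin N M \<Longrightarrow> b \<in> Fin N M \<Longrightarrow> a \<sim> b \<Longrightarrow> nn a = nn b"
  using FA.nrm_le_sub[of a b] FA.nrm_le_sub[of b a] eqv_sym[of a b] by (simp add: FA_simps(1,8))

lemma eqv_tt:
  assumes F: "a \<in> Fin N M" "b \<in> Fin N M" and "a \<sim> b"
  shows "tt a = tt b"
  using tt_infinitesimal[of "FA.sub a b"] assms FA.f_add[of a "(-1) \<odot>\<^bsub>FA\<^esub> b"] FA.f_smult[of b "-1"]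
  by (simp add: FA_simps(1))

text \<open>An element infinitely close to a finite one is finite, so the class of a finite element,
  although collected from all of \<open>M\<close>, stays inside the seminormed algebra.\<close>

lemma hat_eq_set:
  assumes a: "a \<in> Fin N M"
  shows "hat N M a = {x \<in> Fin N M. x \<sim> a}"
proof -
  have "approx N M b a \<longleftrightarrow> b \<in> Fin N M \<and> b \<sim> a" if b: "b \<in> elts (nst N) (acar M)" for b
  proof -
    obtain z A t x y where r: "repr z A t" and x: "elem z A x a" and y: "elem z A y b"
      using representation[of "[a, b]"] Fin_elts[OF a] b by (auto simp: list_all2_Cons2)
    let ?d = "\<lambda>k. y k \<oplus>\<^bsub>calg N (A k)\<^esub> (-1) \<odot>\<^bsub>calg N (A k)\<^esub> x k"
    have d: "elem z A ?d (FA.sub b a)" unfolding FA_simps by (rule elem_add[OF r y elem_smult[OF r x]])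
    have "approx N M b a \<longleftrightarrow> ((\<lambda>k. nrm (calg N (A k)) (?d k)) \<longlongrightarrow> 0) (ult z)"
      unfolding approx_def FA_simps[symmetric] inorm_germ[OF r d] near_germ_scx[OF repr_intern[OF r]]
      by (simp flip: tendsto_of_real_iff[where ?'a=complex])
    also have "\<dots> \<longleftrightarrow> b \<in> Fin N M \<and> b \<sim> a"
    proof
      assume l: "((\<lambda>k. nrm (calg N (A k)) (?d k)) \<longlongrightarrow> 0) (ult z)"
      have "eventually (\<lambda>k. nrm (calg N (A k)) (y k) \<le> nrm (calg N (A k)) (x k) + nrm (calg N (A k)) (?d k)) (ult z)"
        using ev_seminorm[OF r] elem_ev[OF y] elem_ev[OF x] by eventually_elim (rule star_seminorm.nrm_le_sub)
      from Fin_le(1)[OF r y this tendsto_add[OF nn_lim[OF r x a] l]] nn_unique[OF r d l]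
      show "b \<in> Fin N M \<and> b \<sim> a" by simp
    next
      assume "b \<in> Fin N M \<and> b \<sim> a"
      then show "((\<lambda>k. nrm (calg N (A k)) (?d k)) \<longlongrightarrow> 0) (ult z)"
        using nn_lim[OF r d] a by simp
    qed
    finally show ?thesis .
  qed
  then show ?thesis unfolding hat_def using Fin_elts by blast
qed

lemma hat_eq_iff:
  assumes a: "a \<in> Fin N M" and b: "b \<in> Fin N M"
  shows "hat N M a = hat N M b \<longleftrightarrow> a \<sim> b"
proof
  assume "hat N M a = hat N M b"
  moreover have "a \<in> hat N M a" using a eqv_refl[OF a] by (simp add: hat_eq_set)
  ultimately have "a \<in> hat N M b" by (rule subst)
  then show "a \<sim> b" using hat_eq_set[OF b] by simp
next
  assume "a \<sim> b"
  then show "hat N M a = hat N M b"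
    unfolding hat_eq_set[OF a] hat_eq_set[OF b] using eqv_trans eqv_sym a b by blast
qed

text \<open>The hull operations are unions over representatives; if the result depends on the class
  only, all sets in the union coincide.\<close>

lemma hat_Union:
  assumes a: "a \<in> Fin N M" and eq: "\<And>x. x \<in> Fin N M \<Longrightarrow> x \<sim> a \<Longrightarrow> g x = g a"
  shows "(\<Union>x\<in>hat N M a. g x) = g a"
proof -
  have "(\<Union>x\<in>hat N M a. g x) = (\<Union>x\<in>hat N M a. g a)"
    by (intro SUP_cong refl eq) (simp_all add: hat_eq_set[OF a])
  moreover have "a \<in> hat N M a" using a eqv_refl[OF a] by (simp add: hat_eq_set)
  ultimately show ?thesis by auto
qed

section \<open>Hull operations on representatives\<close>

abbreviation "HU \<equiv> ns_hull N M"

lemma hull_simps: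
  "carrier HU = hat N M ` Fin N M" "\<one>\<^bsub>HU\<^esub> = hat N M \<one>\<^bsub>FA\<^esub>" "\<zero>\<^bsub>HU\<^esub> = hat N M \<zero>\<^bsub>FA\<^esub>"
  by (simp_all add: ns_hull_def FA_simps)

lemma hull_add:
  assumes F: "a \<in> Fin N M" "b \<in> Fin N M"
  shows "hat N M a \<oplus>\<^bsub>HU\<^esub> hat N M b = hat N M (a \<oplus>\<^bsub>FA\<^esub> b)"
proof -
  have "(\<Union>y\<in>hat N M b. hat N M (x \<oplus>\<^bsub>FA\<^esub> y)) = hat N M (x \<oplus>\<^bsub>FA\<^esub> b)" if "x \<in> Fin N M" for x
    using that F by (intro hat_Union) (auto simp: hat_eq_iff intro: eqv_add eqv_refl)
  then have "(\<Union>x\<in>hat N M a. \<Union>y\<in>hat N M b. hat N M (x \<oplus>\<^bsub>FA\<^esub> y)) = hat N M (a \<oplus>\<^bsub>FA\<^esub> b)"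
    using F by (subst hat_Union) (auto simp: hat_eq_iff intro: eqv_add eqv_refl)
  then show ?thesis by (simp add: ns_hull_def FA_simps)
qed

lemma hull_mult:
  assumes F: "a \<in> Fin N M" "b \<in> Fin N M"
  shows "hat N M a \<otimes>\<^bsub>HU\<^esub> hat N M b = hat N M (a \<otimes>\<^bsub>FA\<^esub> b)"
proof -
  have "(\<Union>y\<in>hat N M b. hat N M (x \<otimes>\<^bsub>FA\<^esub> y)) = hat N M (x \<otimes>\<^bsub>FA\<^esub> b)" if "x \<in> Fin N M" for x
    using that F by (intro hat_Union) (auto simp: hat_eq_iff intro: eqv_mult eqv_refl)
  then have "(\<Union>x\<in>hat N M a. \<Union>y\<in>hat N M b. hat N M (x \<otimes>\<^bsub>FA\<^esub> y)) = hat N M (a \<otimes>\<^bsub>FA\<^esub> b)"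
    using F by (subst hat_Union) (auto simp: hat_eq_iff intro: eqv_mult eqv_refl)
  then show ?thesis by (simp add: ns_hull_def FA_simps)
qed

lemma hull_smult: "a \<in> Fin N M \<Longrightarrow> c \<odot>\<^bsub>HU\<^esub> hat N M a = hat N M (c \<odot>\<^bsub>FA\<^esub> a)"
  using hat_Union[of a "\<lambda>x. hat N M (c \<odot>\<^bsub>FA\<^esub> x)"] by (simp add: hat_eq_iff eqv_smult) (simp add: ns_hull_def FA_simps)

lemma hull_adj: "a \<in> Fin N M \<Longrightarrow> adj HU (hat N M a) = hat N M (adj FA a)"
  using hat_Union[of a "\<lambda>x. hat N M (adj FA x)"] by (simp add: hat_eq_iff eqv_adj) (simp add: ns_hull_def FA_simps)

lemma hat_THE:
  assumes a: "a \<in> Fin N M" and eq: "\<And>x. x \<in> Fin N M \<Longrightarrow> x \<sim> a \<Longrightarrow> g x = g a"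
  shows "(THE r. \<forall>x\<in>hat N M a. r = g x) = g a"
proof (rule the_equality)
  show "\<forall>x\<in>hat N M a. g a = g x"
    by (intro ballI eq[symmetric]) (simp_all add: hat_eq_set[OF a])
  have "a \<in> hat N M a" using a eqv_refl[OF a] by (simp add: hat_eq_set)
  then show "\<And>r. \<forall>x\<in>hat N M a. r = g x \<Longrightarrow> r = g a" by blast
qed

lemma hull_nrm:
  assumes a: "a \<in> Fin N M" shows "nrm HU (hat N M a) = nn a"
proof -
  have "(THE r. \<forall>x\<in>hat N M a. r = nn x) = nn a" by (rule hat_THE[OF a]) (rule eqv_nn[OF _ a])
  then show ?thesis by (simp add: ns_hull_def flip: nn_def)
qed

lemma hull_functional_hat:
  assumes a: "a \<in> Fin N M" shows "hull_functional N \<theta> (hat N M a) = tt a"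
proof -
  have "(THE r. \<forall>x\<in>hat N M a. r = tt x) = tt a" by (rule hat_THE[OF a]) (rule eqv_tt[OF _ a])
  then show ?thesis by (simp add: hull_functional_def flip: tt_def)
qed

lemma hull_weight_hat: "a \<in> Fin N M \<Longrightarrow> hull_weight N \<theta> (hat N M a) = ennreal (Re (tt a))"
  by (simp add: hull_weight_def hull_functional_hat)

text \<open>The order uses the library's subtraction, whose inverse is a description; the group laws
  identify that inverse with multiplication by -1.\<close>

lemma abelian_group_hull: "abelian_group HU"
proof (rule abelian_groupI)
  fix X Y Z assume "X \<in> carrier HU" "Y \<in> carrier HU" "Z \<in> carrier HU"
  then show "X \<oplus>\<^bsub>HU\<^esub> Y \<oplus>\<^bsub>HU\<^esub> Z = X \<oplus>\<^bsub>HU\<^esub> (Y \<oplus>\<^bsub>HU\<^esub> Z)"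
    by (auto simp: hull_simps hull_add FA_identities(1))
next
  fix X Y assume "X \<in> carrier HU" "Y \<in> carrier HU"
  then show "X \<oplus>\<^bsub>HU\<^esub> Y = Y \<oplus>\<^bsub>HU\<^esub> X" "X \<oplus>\<^bsub>HU\<^esub> Y \<in> carrier HU"
    by (auto simp: hull_simps hull_add FA_identities(2))
next
  fix X assume "X \<in> carrier HU"
  then obtain a where a: "a \<in> Fin N M" "X = hat N M a" by (auto simp: hull_simps)
  then show "\<zero>\<^bsub>HU\<^esub> \<oplus>\<^bsub>HU\<^esub> X = X"
    by (simp add: hull_simps hull_add FA_identities(3))
  show "\<exists>Y\<in>carrier HU. Y \<oplus>\<^bsub>HU\<^esub> X = \<zero>\<^bsub>HU\<^esub>"
    using a FA_identities(4)[of a] by (intro bexI[of _ "hat N M ((-1) \<odot>\<^bsub>FA\<^esub> a)"]) (auto simp: hull_simps hull_add)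
qed (auto simp: hull_simps)

lemma hull_minus:
  assumes a: "a \<in> Fin N M" and b: "b \<in> Fin N M"
  shows "hat N M b \<ominus>\<^bsub>HU\<^esub> hat N M a = hat N M (FA.sub b a)"
proof -
  interpret HU: abelian_group HU by (rule abelian_group_hull)
  have "\<ominus>\<^bsub>HU\<^esub> hat N M a = hat N M ((-1) \<odot>\<^bsub>FA\<^esub> a)"
    using a FA_identities(4)[of a] by (intro HU.minus_equality) (auto simp: hull_simps hull_add)
  then show ?thesis using a b by (simp add: a_minus_def hull_add)
qed

section \<open>Order and weight on the hull\<close>

lemma hull_cpos: "X \<in> cpos HU \<longleftrightarrow> (\<exists>b\<in>Fin N M. X = hat N M (sqr b))"
proof -
  have sq: "adj HU (hat N M b) \<otimes>\<^bsub>HU\<^esub> hat N M b = hat N M (sqr b)" if "b \<in> Fin N M" for b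
    using that by (simp add: hull_adj hull_mult)
  show ?thesis
  proof
    assume "X \<in> cpos HU"
    then show "\<exists>b\<in>Fin N M. X = hat N M (sqr b)"
      unfolding cpos_def hull_simps using sq by auto
  next
    assume "\<exists>b\<in>Fin N M. X = hat N M (sqr b)"
    then obtain b where "b \<in> Fin N M" "X = adj HU (hat N M b) \<otimes>\<^bsub>HU\<^esub> hat N M b" using sq by auto
    then show "X \<in> cpos HU" unfolding cpos_def hull_simps by blast
  qed
qed

lemma hull_cle:
  assumes a: "a \<in> Fin N M" and b: "b \<in> Fin N M"
  shows "cle HU (hat N M a) (hat N M b) \<longleftrightarrow> (\<exists>c\<in>Fin N M. FA.sub b a \<sim> sqr c)"
  unfolding cle_def hull_minus[OF a b] hull_cpos using a b by (auto simp: hat_eq_iff)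

lemma sum_of_squares:
  assumes b: "b \<in> Fin N M" and c: "c \<in> Fin N M"
  shows "\<exists>d\<in>Fin N M. sqr b \<oplus>\<^bsub>FA\<^esub> sqr c \<sim> sqr d"
  by (rule square_root_by_saturation)
    (use b c FA.approx_sum_of_squares[of b c] in \<open>simp_all add: FA_simps(1,8)\<close>)

text \<open>\<open>c - a\<close> is the sum of \<open>c - b\<close> and \<open>b - a\<close>, both
  squares up to infinitesimals.\<close>

lemma cle_trans:
  assumes "a \<in> Fin N M" "b \<in> Fin N M" "c \<in> Fin N M"
    and "cle HU (hat N M a) (hat N M b)" "cle HU (hat N M b) (hat N M c)"
  shows "cle HU (hat N M a) (hat N M c)"
proof -
  obtain u where u: "u \<in> Fin N M" "FA.sub b a \<sim> sqr u" using assms hull_cle by blast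
  obtain v where v: "v \<in> Fin N M" "FA.sub c b \<sim> sqr v" using assms hull_cle by blast
  obtain d where d: "d \<in> Fin N M" "sqr v \<oplus>\<^bsub>FA\<^esub> sqr u \<sim> sqr d"
    using sum_of_squares[OF v(1) u(1)] by blast
  have "FA.sub c a = FA.sub c b \<oplus>\<^bsub>FA\<^esub> FA.sub b a" using assms FA.sub_trans[of c b a] by (simp add: FA_simps(1))
  moreover have "FA.sub c b \<oplus>\<^bsub>FA\<^esub> FA.sub b a \<sim> sqr v \<oplus>\<^bsub>FA\<^esub> sqr u"
    by (rule eqv_add) (use assms u v in auto)
  ultimately have "FA.sub c a \<sim> sqr v \<oplus>\<^bsub>FA\<^esub> sqr u" by simp
  then have "FA.sub c a \<sim> sqr d"
    by (rule eqv_trans[rotated 3]) (use assms u v d in auto)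
  then show ?thesis using hull_cle assms d(1) by blast
qed

lemma tt_square:
  assumes b: "b \<in> Fin N M"
  shows "tt (sqr b) = complex_of_real (Re (tt (sqr b)))" "0 \<le> Re (tt (sqr b))"
  using FA_norms(13)[OF b b] by auto

lemma weight_mono:
  assumes a: "a \<in> Fin N M" and b: "b \<in> Fin N M" and "cle HU (hat N M a) (hat N M b)"
  shows "Re (tt a) \<le> Re (tt b)"
proof -
  obtain c where c: "c \<in> Fin N M" "FA.sub b a \<sim> sqr c" using assms hull_cle by blast
  have "tt (FA.sub b a) = tt (sqr c)" by (rule eqv_tt) (use a b c in auto)
  moreover have "tt (FA.sub b a) = tt b - tt a"
    using FA.f_add[of b "(-1) \<odot>\<^bsub>FA\<^esub> a"] FA.f_smult[of a "-1"] a b by (simp add: FA_simps(1))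
  ultimately show ?thesis using tt_square(2)[OF c(1)] by (metis diff_ge_0_iff_ge minus_complex.simps(1))
qed

text \<open>Squares have real nonnegative values, so the cut-off at 0 in \<open>ennreal\<close>
  changes nothing on positive elements, and additivity and homogeneity are inherited from
  \<open>tt\<close>.\<close>

lemma weight_extension_hull: "weight_extension HU (hull_weight N \<theta>) (hull_functional N \<theta>)"
  unfolding weight_extension_def weight_def
proof (intro conjI ballI allI impI)
  fix X Y assume "X \<in> cpos HU" "Y \<in> cpos HU"
  then obtain b c where "b \<in> Fin N M" "X = hat N M (sqr b)" "c \<in> Fin N M" "Y = hat N M (sqr c)"
    unfolding hull_cpos by blast
  then show "hull_weight N \<theta> (X \<oplus>\<^bsub>HU\<^esub> Y) = hull_weight N \<theta> X + hull_weight N \<theta> Y"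
    using tt_square(2)[of b] tt_square(2)[of c] by (simp add: hull_add hull_weight_hat FA_norms(11))
next
  fix r :: real and X assume r: "0 \<le> r" and "X \<in> cpos HU"
  then obtain b where "b \<in> Fin N M" "X = hat N M (sqr b)"
    unfolding hull_cpos by blast
  then show "hull_weight N \<theta> (complex_of_real r \<odot>\<^bsub>HU\<^esub> X) = ennreal r * hull_weight N \<theta> X"
    using r tt_square(2)[of b] by (simp add: hull_smult hull_weight_hat FA_norms(12) ennreal_mult)
next
  fix X assume "X \<in> cpos HU"
  then obtain b where b: "b \<in> Fin N M" "X = hat N M (sqr b)"
    unfolding hull_cpos by blast
  then show "hull_functional N \<theta> X = complex_of_real (enn2real (hull_weight N \<theta> X))"
    using tt_square[of b] by (simp add: hull_functional_hat hull_weight_hat)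
next
  fix X Y assume "X \<in> carrier HU" "Y \<in> carrier HU"
  then show "hull_functional N \<theta> (X \<oplus>\<^bsub>HU\<^esub> Y) = hull_functional N \<theta> X + hull_functional N \<theta> Y"
    by (auto simp: hull_simps hull_add hull_functional_hat FA_norms(11))
next
  fix c X assume "X \<in> carrier HU"
  then show "hull_functional N \<theta> (c \<odot>\<^bsub>HU\<^esub> X) = c * hull_functional N \<theta> X"
    by (auto simp: hull_simps hull_smult hull_functional_hat FA_norms(12))
qed (auto simp: hull_weight_def)

text \<open>The upper bound is produced from representatives of \<open>F\<close> alone, without
  reference to a supremum, and can then be compared with one.\<close>

lemma majorant:
  assumes F: "F \<subseteq> cpos HU" and dir: "directed_up HU F" and C: "\<And>X. X \<in> F \<Longrightarrow> nrm HU X \<le> C"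
    and cF: "|F| <o \<kappa>" and \<rho>: "\<And>X. X \<in> F \<Longrightarrow> Re (hull_functional N \<theta> X) \<le> \<rho>"
  shows "\<exists>c\<in>Fin N M. Re (tt (sqr c)) \<le> \<rho> \<and> (\<forall>X\<in>F. cle HU X (hat N M (sqr c)))"
proof -
  \<comment> \<open>The square of the norm of a root is at most the norm of the positive element,
    hence at most \<open>C\<close>; the slack in \<open>K\<close> makes the bound strict, so that it
    passes to almost all indices.\<close>
  define K where "K = \<bar>C\<bar> + 2"
  have "\<exists>a. \<forall>X\<in>F. a X \<in> Fin N M \<and> X = hat N M (adj FA (a X) \<otimes>\<^bsub>FA\<^esub> a X)"
    using F hull_cpos by (intro bchoice) blast
  then obtain sr where sr: "\<And>X. X \<in> F \<Longrightarrow> sr X \<in> Fin N M" "\<And>X. X \<in> F \<Longrightarrow> X = hat N M (adj FA (sr X) \<otimes>\<^bsub>FA\<^esub> sr X)"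
    by blast
  define g where "g X = adj FA (sr X) \<otimes>\<^bsub>FA\<^esub> sr X" for X
  have g: "g X \<in> Fin N M" "X = hat N M (g X)" if "X \<in> F" for X
    using sr(1)[OF that] sr(2)[OF that] by (simp_all add: g_def)
  \<comment> \<open>The root \<open>b\<close> is quantified inside the standard algebra, so each
    member of \<open>F\<close> and each \<open>n\<close> give one internal set of elements
    \<open>y\<close>. It is approximate because equality in the hull does not give equality at the
    indices.\<close>
  define \<phi> where "\<phi> n A f x y \<longleftrightarrow> nrm A y < K \<and> Re (f (adj A y \<otimes>\<^bsub>A\<^esub> y)) < \<rho> + 1 / (real n + 1) \<and>
      (\<exists>b\<in>carrier A. nrm A (((adj A y \<otimes>\<^bsub>A\<^esub> y) \<oplus>\<^bsub>A\<^esub> (-1) \<odot>\<^bsub>A\<^esub> x) \<oplus>\<^bsub>A\<^esub> (-1) \<odot>\<^bsub>A\<^esub> (adj A b \<otimes>\<^bsub>A\<^esub> b)) < 1 / (real n + 1))"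
    for n and A :: "'a cstar" and f :: "'a \<Rightarrow> complex" and x y :: 'a
  have "\<forall>i\<in>F \<times> (UNIV :: nat set). \<exists>s. solutions (\<phi> (snd i)) (g (fst i)) s"
    using solutions_exist Fin_elts g(1) by auto
  from bchoice[OF this] obtain s
    where s': "\<And>i. i \<in> F \<times> (UNIV :: nat set) \<Longrightarrow> solutions (\<phi> (snd i)) (g (fst i)) (s i)" by blast
  then have s: "\<And>i. i \<in> F \<times> UNIV \<Longrightarrow> intern (s i)" "\<And>i. i \<in> F \<times> UNIV \<Longrightarrow> elts (nst N) (s i) \<subseteq> elts (nst N) (acar M)"
    unfolding solutions_def by blast+
  have iff: "c \<in> elts (nst N) (s (X, n)) \<longleftrightarrow> eventually (\<lambda>k. \<phi> n (calg N (A k)) (fn (t k)) (x k) (y k)) (ult z)"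
    if "X \<in> F" "repr z A t" "elem z A x (g X)" "elem z A y c" for X n z A t x y c
    using solutions_iff[OF s'[of "(X, n)"]] that by simp
  \<comment> \<open>Directedness bounds two members at a time; transitivity extends this to finite
    subsets, and the empty one is settled by nonemptiness of \<open>F\<close>.\<close>
  have ub: "\<exists>Y\<in>F. \<forall>X\<in>G. cle HU X Y" if "finite G" "G \<subseteq> F" for G
    using that
  proof (induction G rule: finite_induct)
    case empty
    then show ?case using dir unfolding directed_up_def by blast
  next
    case (insert X G)
    then obtain Y where Y: "Y \<in> F" "\<And>X. X \<in> G \<Longrightarrow> cle HU X Y" by auto
    obtain Z where Z: "Z \<in> F" "cle HU X Z" "cle HU Y Z"
      using dir insert.prems Y(1) unfolding directed_up_def by blast
    have "cle HU W Z" if "W \<in> G" for W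
      using cle_trans[of "g W" "g Y" "g Z"] g Y Z that insert.prems by auto
    then show ?case using Z by auto
  qed
  \<comment> \<open>Uncountability handles the natural numbers; the sum of two sets smaller than
    \<kappa> is smaller than \<kappa>, and the infinite sum bounds the product.\<close>
  have "|UNIV :: nat set| <o \<kappa>" using card_of_nat uncountable ordIso_ordLess_trans by blast
  then have "|F <+> (UNIV :: nat set)| <o \<kappa>"
    using card_of_Plus_ordLess_infinite_Field[OF infinite_Field card cF] by blast
  moreover have "|F \<times> (UNIV :: nat set)| \<le>o |F <+> (UNIV :: nat set)|"
    by (rule card_of_Times_ordLeq_infinite_Field)
      (simp_all add: card_of_Plus1 card_of_Plus2 card_of_card_order_on Field_card_of finite_Plus_iff)
  ultimately have "|F \<times> (UNIV :: nat set)| <o \<kappa>" using ordLeq_ordLess_trans by blast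
  moreover have "\<exists>c. \<forall>i\<in>J. c \<in> elts (nst N) (s i)" if J: "J \<subseteq> F \<times> UNIV" "finite J" for J
  proof -
    have "finite (fst ` J)" "fst ` J \<subseteq> F" using J by auto
    from ub[OF this] obtain Y where Y: "Y \<in> F" "\<And>X. X \<in> fst ` J \<Longrightarrow> cle HU X Y" by blast
    \<comment> \<open>One root of a single upper bound \<open>Y\<close> meets all conditions in
      \<open>J\<close>, whatever their tolerances.\<close>
    define c where "c = sr Y"
    have c: "c \<in> Fin N M" "sqr c = g Y" using sr Y by (simp_all add: c_def g_def)
    have "(nn c)\<^sup>2 \<le> C"
      using FA_norms(10)[OF c(1) c(1)] C[OF Y(1)] hull_nrm[OF g(1)[OF Y(1)]] g(2)[OF Y(1)] c(2) by simp
    have nc: "nn c < K"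
    proof (rule ccontr)
      assume "\<not> nn c < K"
      then have big: "\<bar>C\<bar> + 2 \<le> nn c" by (simp add: K_def)
      then have "1 * nn c \<le> nn c * nn c" by (intro mult_right_mono) auto
      then show False using big \<open>(nn c)\<^sup>2 \<le> C\<close> by (simp add: power2_eq_square)
    qed
    have tc: "Re (tt (sqr c)) \<le> \<rho>"
      using \<rho>[OF Y(1)] hull_functional_hat[OF g(1)[OF Y(1)]] g(2)[OF Y(1)] c(2) by simp
    have "c \<in> elts (nst N) (s (X, n))" if Xn: "(X, n) \<in> J" for X n
    proof -
      have X: "X \<in> F" "cle HU X Y" using Xn J Y(2) by force+
      then obtain b where b: "b \<in> Fin N M" "FA.sub (g Y) (g X) \<sim> sqr b"
        using hull_cle[of "g X" "g Y"] g Y(1) by auto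
      obtain z A t x y w where r: "repr z A t" and x: "elem z A x (g X)" and y: "elem z A y c" and w: "elem z A w b"
        by (rule representation3[OF g(1)[OF X(1)] c(1) b(1)]) (rule that)
      note sq = elem_mult[OF r elem_adj[OF r y] y]
      note d = elem_add[OF r elem_add[OF r sq elem_smult[OF r x, of "-1"]]
          elem_smult[OF r elem_mult[OF r elem_adj[OF r w] w], of "-1"]]
      have sqF: "sqr c \<in> Fin N M" using c(1) by simp
      have dF: "FA.sub (FA.sub (sqr c) (g X)) (sqr b) \<in> Fin N M"
        using c(1) b g X by simp
      have n: "0 < 1 / (real n + 1)" by simp
      have d0: "nn (FA.sub (FA.sub (sqr c) (g X)) (sqr b)) < 1 / (real n + 1)"
        using b(2) c(2) n by simp
      have t0: "Re (tt (sqr c)) < \<rho> + 1 / (real n + 1)" using tc n by linarith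
      have "eventually (\<lambda>k. nrm (calg N (A k)) (y k) < K) (ult z)"
        by (rule order_tendstoD(2)[OF nn_lim[OF r y c(1)] nc])
      moreover note order_tendstoD(2)[OF tendsto_Re[OF tt_lim[OF r sq sqF[unfolded FA_simps]]] t0[unfolded FA_simps]]
        order_tendstoD(2)[OF nn_lim[OF r d dF[unfolded FA_simps]] d0[unfolded FA_simps]]
        elem_ev[OF w]
      ultimately have "eventually (\<lambda>k. \<phi> n (calg N (A k)) (fn (t k)) (x k) (y k)) (ult z)"
        unfolding \<phi>_def by eventually_elim blast
      then show ?thesis using iff[OF X(1) r x y] by blast
    qed
    then show ?thesis by (metis surj_pair)
  qed
  ultimately obtain c where "\<forall>i\<in>F \<times> UNIV. c \<in> elts (nst N) (s i)"
    using saturation[of "F \<times> UNIV" s] s(1) by blast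
  then have c: "\<And>X n. X \<in> F \<Longrightarrow> c \<in> elts (nst N) (s (X, n))" by blast
  have one: "c \<in> Fin N M \<and> Re (tt (sqr c)) \<le> \<rho> + 1 / (real n + 1) \<and>
      (\<exists>b\<in>Fin N M. nn (FA.sub (FA.sub (sqr c) (g X)) (sqr b)) \<le> 1 / (real n + 1))"
    if X: "X \<in> F" for X n
  proof -
    have "set [g X, c] \<subseteq> elts (nst N) (acar M)" using Fin_elts[OF g(1)[OF X]] c[OF X] s(2)[of "(X, n)"] X by auto
    from representation[OF this] obtain z A t xs where r: "repr z A t" and "list_all2 (elem z A) xs [g X, c]" by blast
    then obtain x y where x: "elem z A x (g X)" and y: "elem z A y c" by (auto simp: list_all2_Cons2)
    have ev: "eventually (\<lambda>k. \<phi> n (calg N (A k)) (fn (t k)) (x k) (y k)) (ult z)"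
      using iff[OF X r x y] c[OF X] by blast
    have "eventually (\<lambda>k. nrm (calg N (A k)) (y k) \<le> K) (ult z)"
      by (rule eventually_mono[OF ev]) (simp add: \<phi>_def)
    from Fin_le(1)[OF r y this tendsto_const] have cF: "c \<in> Fin N M" .
    note sq = elem_mult[OF r elem_adj[OF r y] y]
    have sqF: "sqr c \<in> Fin N M" using cF by simp
    have "eventually (\<lambda>k. Re (fn (t k) (adj (calg N (A k)) (y k) \<otimes>\<^bsub>calg N (A k)\<^esub> y k)) \<le> \<rho> + 1 / (real n + 1)) (ult z)"
      by (rule eventually_mono[OF ev]) (simp add: \<phi>_def)
    from tendsto_upperbound[OF tendsto_Re[OF tt_lim[OF r sq sqF[unfolded FA_simps]]] this ult_neq_bot[OF repr_intern[OF r]]]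
    have tc: "Re (tt (sqr c)) \<le> \<rho> + 1 / (real n + 1)" unfolding FA_simps .
    let ?A = "\<lambda>k. calg N (A k)"
    define P where "P k b \<longleftrightarrow> b \<in> carrier (?A k) \<and> nrm (?A k) (((adj (?A k) (y k) \<otimes>\<^bsub>?A k\<^esub> y k) \<oplus>\<^bsub>?A k\<^esub> (-1) \<odot>\<^bsub>?A k\<^esub> x k)
      \<oplus>\<^bsub>?A k\<^esub> (-1) \<odot>\<^bsub>?A k\<^esub> (adj (?A k) b \<otimes>\<^bsub>?A k\<^esub> b)) < 1 / (real n + 1)" for k b
    \<comment> \<open>The inner existential is undone by choosing \<open>b\<close> at each index;
      the chosen family has a germ, which is finite because the tolerance is at most 1.\<close>
    define w where "w k = (SOME b. P k b)" for k
    have P: "eventually (\<lambda>k. P k (w k)) (ult z)"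
    proof (rule eventually_mono[OF ev])
      fix k assume "\<phi> n (calg N (A k)) (fn (t k)) (x k) (y k)"
      then have "\<exists>b. P k b" unfolding \<phi>_def P_def by blast
      then show "P k (w k)" unfolding w_def by (rule someI_ex)
    qed
    have "eventually (\<lambda>k. w k \<in> carrier (calg N (A k))) (ult z)"
      by (rule eventually_mono[OF P]) (simp add: P_def)
    from elemI[OF r this] obtain b where w: "elem z A w b" by blast
    note d1 = elem_add[OF r sq elem_smult[OF r x, of "-1"]]
    have d1F: "FA.sub (sqr c) (g X) \<in> Fin N M" using cF g X by simp
    have "1 / (real n + 1) \<le> 1" by simp
    then have "eventually (\<lambda>k. nrm (?A k) (((adj (?A k) (y k) \<otimes>\<^bsub>?A k\<^esub> y k) \<oplus>\<^bsub>?A k\<^esub> (-1) \<odot>\<^bsub>?A k\<^esub> x k)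
      \<oplus>\<^bsub>?A k\<^esub> (-1) \<odot>\<^bsub>?A k\<^esub> (adj (?A k) (w k) \<otimes>\<^bsub>?A k\<^esub> w k)) < 1) (ult z)"
      by (intro eventually_mono[OF P]) (simp only: P_def, linarith)
    from Fin_of_square[OF r d1 d1F[unfolded FA_simps] w this] have b: "b \<in> Fin N M" .
    note d = elem_add[OF r d1 elem_smult[OF r elem_mult[OF r elem_adj[OF r w] w], of "-1"]]
    have "eventually (\<lambda>k. nrm (?A k) (((adj (?A k) (y k) \<otimes>\<^bsub>?A k\<^esub> y k) \<oplus>\<^bsub>?A k\<^esub> (-1) \<odot>\<^bsub>?A k\<^esub> x k)
      \<oplus>\<^bsub>?A k\<^esub> (-1) \<odot>\<^bsub>?A k\<^esub> (adj (?A k) (w k) \<otimes>\<^bsub>?A k\<^esub> w k)) \<le> 1 / (real n + 1)) (ult z)"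
      by (rule eventually_mono[OF P]) (simp add: P_def)
    from Fin_le(2)[OF r d this tendsto_const]
    have "nn (FA.sub (FA.sub (sqr c) (g X)) (sqr b)) \<le> 1 / (real n + 1)" unfolding FA_simps .
    then show ?thesis using cF tc b by blast
  qed
  obtain X0 where X0: "X0 \<in> F" using dir unfolding directed_up_def by blast
  then have cF: "c \<in> Fin N M" using one by blast
  have "Re (tt (sqr c)) \<le> \<rho>"
  proof (rule field_le_epsilon)
    fix e :: real assume "e > 0"
    then obtain n where "1 / (real n + 1) < e" using reciprocal_small by blast
    then show "Re (tt (sqr c)) \<le> \<rho> + e" using one[OF X0, of n] by linarith
  qed
  moreover have "cle HU X (hat N M (sqr c))" if X: "X \<in> F" for X
  proof -
    \<comment> \<open>For fixed \<open>X\<close> the roots may still differ with \<open>n\<close>; a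
      second saturation replaces them by one root that is correct up to an infinitesimal.\<close>
    have "\<exists>b\<in>Fin N M. FA.sub (sqr c) (g X) \<sim> sqr b"
    proof (rule square_root_by_saturation)
      show "FA.sub (sqr c) (g X) \<in> Fin N M" using cF g X by simp
      fix e :: real assume "e > 0"
      then obtain n where "1 / (real n + 1) < e" using reciprocal_small by blast
      then show "\<exists>b\<in>Fin N M. nn (FA.sub (FA.sub (sqr c) (g X)) (sqr b)) < e"
        using one[OF X, of n] by (meson le_less_trans)
    qed
    then show ?thesis using hull_cle[of "g X" "sqr c"] g[OF X] cF by simp
  qed
  ultimately show ?thesis using cF by blast
qed

text \<open>One inequality is monotonicity of the weight. For the other, the majorant is a positive
  upper bound of \<open>F\<close>, so it dominates \<open>S\<close>, and its weight is at most the
  supremum of the weights.\<close>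

lemma kappa_normal_hull: "kappa_normal \<kappa> HU (hull_weight N \<theta>)"
  unfolding kappa_normal_def
proof (intro allI impI)
  fix F S assume F: "F \<subseteq> cpos HU" and dir: "directed_up HU F" and "\<exists>C. \<forall>X\<in>F. nrm HU X \<le> C"
    and cF: "|F| <o \<kappa>" and sup: "is_sup HU F S"
  then obtain C where C: "\<And>X. X \<in> F \<Longrightarrow> nrm HU X \<le> C" by blast
  have rep: "\<exists>a\<in>Fin N M. X = hat N M a" if "X \<in> cpos HU" for X
    using that unfolding hull_cpos by force
  have mono: "hull_weight N \<theta> X \<le> hull_weight N \<theta> Y" if "X \<in> cpos HU" "Y \<in> cpos HU" "cle HU X Y" for X Y
    using rep[OF that(1)] rep[OF that(2)] that(3) weight_mono by (auto simp: hull_weight_hat intro!: ennreal_leI)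
  have S: "S \<in> cpos HU" and le: "\<And>X. X \<in> F \<Longrightarrow> cle HU X S"
    and least: "\<And>U. U \<in> cpos HU \<Longrightarrow> (\<And>X. X \<in> F \<Longrightarrow> cle HU X U) \<Longrightarrow> cle HU S U"
    using sup unfolding is_sup_def by auto
  let ?R = "SUP X\<in>F. hull_weight N \<theta> X"
  have R: "?R \<le> hull_weight N \<theta> S" using mono F S le by (intro SUP_least) auto
  \<comment> \<open>\<open>hull_weight\<close> takes finite values by definition, so the supremum,
    being at most the weight of \<open>S\<close>, is a real number.\<close>
  then have fin: "?R < \<infinity>" by (simp add: hull_weight_def le_less_trans)
  define \<rho> where "\<rho> = enn2real ?R"
  have \<rho>: "ennreal \<rho> = ?R" using fin by (simp add: \<rho>_def)
  have "Re (hull_functional N \<theta> X) \<le> \<rho>" if "X \<in> F" for X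
  proof -
    have "hull_weight N \<theta> X \<le> ennreal \<rho>" unfolding \<rho> using that by (rule SUP_upper)
    then show ?thesis unfolding hull_weight_def by (subst (asm) ennreal_le_iff) (simp_all add: \<rho>_def)
  qed
  then obtain c where c: "c \<in> Fin N M" "Re (tt (sqr c)) \<le> \<rho>"
    "\<And>X. X \<in> F \<Longrightarrow> cle HU X (hat N M (sqr c))"
    using majorant[OF F dir C cF] by blast
  let ?U = "hat N M (sqr c)"
  have U: "?U \<in> cpos HU" using c(1) hull_cpos by blast
  have "hull_weight N \<theta> S \<le> hull_weight N \<theta> ?U" using mono[OF S U least[OF U c(3)]] .
  also have "\<dots> \<le> ennreal \<rho>" using c by (simp add: hull_weight_hat ennreal_leI)
  finally show "hull_weight N \<theta> S = ?R" using R unfolding \<rho> by (rule antisym)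
qed

end

theorem theorem36:
  fixes N :: "('u, 'v) nonstd" and \<kappa> :: "'k rel"
    and H :: "'v hcode" and M :: "'v acode" and \<theta> :: 'v
  assumes "nonstandard_universe N"
    and "Card_order \<kappa>" and "natLeq <o \<kappa>"
    and "saturated N \<kappa>"
    and "internal_hilbert N H"
    and "internal_cstar N H M"
    and "internal_weight N M \<theta>"
    and "S_continuous N M \<theta>"
  shows "weight_extension (ns_hull N M) (hull_weight N \<theta>) (hull_functional N \<theta>) \<and>
         kappa_normal \<kappa> (ns_hull N M) (hull_weight N \<theta>)"
proof -
  interpret saturated_weight N H M \<theta> \<kappa>
    by unfold_locales fact+
  show ?thesis using weight_extension_hull kappa_normal_hull by blast
qed

end
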